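(* For $0\le r\le n$ we have $$P^{(C_n,C_n)}_{(1^r)}(x\,|\,t;q,t)=\sum_{j=0}^{\lfloor r/2\rfloor}\frac{(1/(qt);t^2)_j\,(t^{2n-2r};t^2)_j}{(t^2;t^2)_j\,(qt^{2n-2r+3};t^2)_j}\,\frac{1-t^{2n-2r+4j}}{1-t^{2n-2r}}\,(qt)^j\,E_{r-2j}(x),$$ $$E_r(x)=\sum_{j=0}^{\lfloor r/2\rfloor}\frac{(qt;t^2)_j\,(t^{2n-2r+2j+2};t^2)_j}{(t^2;t^2)_j\,(qt^{2n-2r+2j+1};t^2)_j}\,P^{(C_n,C_n)}_{(1^{r-2j})}(x\,|\,t;q,t),$$ $$P^{(D_n,D_n)}_{(1^r)}(x\,|\,q,t)=\sum_{j=0}^{\lfloor r/2\rfloor}\frac{(t/q;t^2)_j\,(t^{2n-2r};t^2)_j}{(t^2;t^2)_j\,(qt^{2n-2r+1};t^2)_j}\,\frac{1-t^{n-r+2j}}{1-t^{n-r}}\,q^j\,E_{r-2j}(x),$$ $$E_r(x)=\sum_{j=0}^{\lfloor r/2\rfloor}\frac{(q/t;t^2)_j\,(t^{2n-2r+2j+2};t^2)_j}{(t^2;t^2)_j\,(qt^{2n-2r+2j-1};t^2)_j}\,\frac{1+t^{n-r}}{1+t^{n-r+2j}}\,t^j\,P^{(D_n,D_n)}_{(1^{r-2j})}(x\,|\,q,t).$$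
   Context: $(z;q)_k=\prod_{j=0}^{k-1}(1-q^jz)$. $E_r(x)$ is defined by $\prod_{i=1}^n(1-yx_i)(1-y/x_i)=\sum_{r\ge0}(-1)^rE_r(x)y^r$. Koornwinder polynomials. Let $n\ge1$, $x=(x_1,\dots,x_n)$, and let $a,b,c,d,q,t$ be generic complex parameters, $|q|<1$; put $\alpha=(abcd/q)^{1/2}$. The group $W_n=\mathbb{Z}_2^n\rtimes\mathfrak{S}_n$ acts on Laurent polynomials by permuting the variables and inverting $x_i\mapsto x_i^{-1}$. For a partition $\lambda=(\lambda_1\ge\dots\ge\lambda_n\ge0)$, $m_\lambda$ is the sum of the distinct monomials $x^\mu$, $\mu$ in the $W_n$-orbit of $\lambda$. Let $T_{q,x_i}^{\pm1}$ replace $x_i$ by $q^{\pm1}x_i$, and set $$\mathcal{D}_x=\sum_{i=1}^n\frac{(1-ax_i)(1-bx_i)(1-cx_i)(1-dx_i)}{\alpha t^{n-1}(1-x_i^2)(1-qx_i^2)}\prod_{j\ne i}\frac{(1-tx_ix_j)(1-tx_i/x_j)}{(1-x_ix_j)(1-x_i/x_j)}\big(T_{q,x_i}-1\big)$$ $$\qquad+\sum_{i=1}^n\frac{(1-a/x_i)(1-b/x_i)(1-c/x_i)(1-d/x_i)}{\alpha t^{n-1}(1-1/x_i^2)(1-q/x_i^2)}\prod_{j\ne i}\frac{(1-tx_j/x_i)(1-t/(x_ix_j))}{(1-x_j/x_i)(1-1/(x_ix_j))}\big(T_{q,x_i}^{-1}-1\big).$$ The Koornwinder polynomial $P_\lambda(x\,|\,a,b,c,d\,|\,q,t)$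 is the unique $W_n$-invariant Laurent polynomial with $P_\lambda=m_\lambda+$ (linear combination of $m_\mu$, $\mu<\lambda$ in dominance order: $\mu_1+\dots+\mu_i\le\lambda_1+\dots+\lambda_i$ for all $i$) and $\mathcal{D}_xP_\lambda=d_\lambda P_\lambda$, where $d_\lambda=\sum_{j=1}^n\big(\alpha t^{n-j}q^{\lambda_j}+\alpha^{-1}t^{-n+j}q^{-\lambda_j}-\alpha t^{n-j}-\alpha^{-1}t^{-n+j}\big)$. $(1^r)$ is the partition with $r$ parts equal to $1$. Specializations: $P^{(C_n,C_n)}_{\lambda}(x\,|\,b;q,t)=P_\lambda(x\,|\,b^{1/2},-b^{1/2},q^{1/2}b^{1/2},-q^{1/2}b^{1/2}\,|\,q,t)$ (used with $b=t$) and $P^{(D_n,D_n)}_\lambda(x\,|\,q,t)=P_\lambda(x\,|\,1,-1,q^{1/2},-q^{1/2}\,|\,q,t)$. For $r=n$ the coefficients containing $1-t^{2n-2r}$ or $1-t^{n-r}$ in the denominator are understood after cancellation, i.e. as rational functions of $u=t^{n-r}$ evaluated at $u=1$ (the $j=0$ coefficient is $1$). *)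

theory Defs
  imports "HOL-Complex_Analysis.Complex_Analysis" "HOL-Library.Poly_Mapping"
begin

definition qpoch :: "complex \<Rightarrow> complex \<Rightarrow> nat \<Rightarrow> complex" where
  "qpoch z q k = (\<Prod>j<k. 1 - q ^ j * z)"

(* Laurent polynomials form the group algebra of the exponent vectors.  The variables
   x_1, ..., x_n are indexed 0, ..., n - 1 throughout. *)

type_synonym expo = "nat \<Rightarrow>\<^sub>0 int"
type_synonym laurent = "expo \<Rightarrow>\<^sub>0 complex"

definition monomial :: "expo \<Rightarrow> laurent" where
  "monomial \<mu> = Poly_Mapping.single \<mu> 1"

definition lconst :: "complex \<Rightarrow> laurent" where
  "lconst c = Poly_Mapping.single 0 c"

definition in_vars :: "nat \<Rightarrow> laurent \<Rightarrow> bool" where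
  "in_vars n P \<longleftrightarrow> (\<forall>\<mu>\<in>Poly_Mapping.keys P. Poly_Mapping.keys \<mu> \<subseteq> {..<n})"

definition leval :: "laurent \<Rightarrow> (nat \<Rightarrow> complex) \<Rightarrow> complex" where
  "leval P x = (\<Sum>\<mu>\<in>Poly_Mapping.keys P. Poly_Mapping.lookup P \<mu> *
      (\<Prod>i\<in>Poly_Mapping.keys \<mu>. x i powi Poly_Mapping.lookup \<mu> i))"

definition E_poly :: "nat \<Rightarrow> nat \<Rightarrow> laurent" where
  "E_poly n r = (-1) ^ r * coeff (\<Prod>i<n.
      [:1, - monomial (Poly_Mapping.single i 1):] *
      [:1, - monomial (Poly_Mapping.single i (-1)):]) r"

definition is_partition :: "nat \<Rightarrow> expo \<Rightarrow> bool" where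
  "is_partition n la \<longleftrightarrow> Poly_Mapping.keys la \<subseteq> {..<n} \<and>
     (\<forall>i<n. 0 \<le> Poly_Mapping.lookup la i) \<and>
     (\<forall>i j. i \<le> j \<and> j < n \<longrightarrow> Poly_Mapping.lookup la j \<le> Poly_Mapping.lookup la i)"

(* The order does not require equal weights: (0) lies below every other partition. *)
definition dominated :: "nat \<Rightarrow> expo \<Rightarrow> expo \<Rightarrow> bool" where
  "dominated n \<mu> la \<longleftrightarrow> (\<forall>i\<in>{1..n}.
     (\<Sum>k<i. Poly_Mapping.lookup \<mu> k) \<le> (\<Sum>k<i. Poly_Mapping.lookup la k))"

definition W_orbit :: "nat \<Rightarrow> expo \<Rightarrow> expo set" where
  "W_orbit n la = {\<mu>. Poly_Mapping.keys \<mu> \<subseteq> {..<n} \<and>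
     (\<exists>\<pi> \<epsilon>. \<pi> permutes {..<n} \<and> (\<forall>i<n. \<epsilon> i \<in> {1, -1}) \<and>
        (\<forall>i<n. Poly_Mapping.lookup \<mu> i = \<epsilon> i * Poly_Mapping.lookup la (\<pi> i)))}"

definition m_poly :: "nat \<Rightarrow> expo \<Rightarrow> laurent" where
  "m_poly n la = (\<Sum>\<mu>\<in>W_orbit n la. monomial \<mu>)"

definition W_invariant :: "nat \<Rightarrow> laurent \<Rightarrow> bool" where
  "W_invariant n P \<longleftrightarrow> (\<forall>x. (\<forall>i<n. x i \<noteq> 0) \<longrightarrow>
     (\<forall>\<pi>. \<pi> permutes {..<n} \<longrightarrow> leval P (x \<circ> \<pi>) = leval P x) \<and>
     (\<forall>i<n. leval P (x(i := inverse (x i))) = leval P x))"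

(* The square root in alpha is the principal one.  The other choice changes the sign of both
   the operator and the eigenvalue below, so it gives the same eigenvalue equation. *)
definition koornwinder_alpha ::
    "complex \<Rightarrow> complex \<Rightarrow> complex \<Rightarrow> complex \<Rightarrow> complex \<Rightarrow> complex" where
  "koornwinder_alpha a b c d q = csqrt (a * b * c * d / q)"

definition koornwinder_op :: "nat \<Rightarrow> complex \<Rightarrow> complex \<Rightarrow> complex \<Rightarrow> complex \<Rightarrow> complex \<Rightarrow> complex \<Rightarrow>
    ((nat \<Rightarrow> complex) \<Rightarrow> complex) \<Rightarrow> (nat \<Rightarrow> complex) \<Rightarrow> complex" where
  "koornwinder_op n a b c d q t F x = (let \<alpha> = koornwinder_alpha a b c d q in
     (\<Sum>i<n. (1 - a * x i) * (1 - b * x i) * (1 - c * x i) * (1 - d * x i) /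
               (\<alpha> * t ^ (n - 1) * (1 - (x i)\<^sup>2) * (1 - q * (x i)\<^sup>2)) *
             (\<Prod>j\<in>{..<n} - {i}. ((1 - t * x i * x j) * (1 - t * x i / x j)) /
                               ((1 - x i * x j) * (1 - x i / x j))) *
             (F (x(i := q * x i)) - F x)) +
     (\<Sum>i<n. (1 - a / x i) * (1 - b / x i) * (1 - c / x i) * (1 - d / x i) /
               (\<alpha> * t ^ (n - 1) * (1 - 1 / (x i)\<^sup>2) * (1 - q / (x i)\<^sup>2)) *
             (\<Prod>j\<in>{..<n} - {i}. ((1 - t * x j / x i) * (1 - t / (x i * x j))) /
                               ((1 - x j / x i) * (1 - 1 / (x i * x j)))) *
             (F (x(i := x i / q)) - F x)))"

definition koornwinder_eigenvalue :: "nat \<Rightarrow> expo \<Rightarrow> complex \<Rightarrow> complex \<Rightarrow> complex \<Rightarrow> complex \<Rightarrow>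
    complex \<Rightarrow> complex \<Rightarrow> complex" where
  "koornwinder_eigenvalue n la a b c d q t = (let \<alpha> = koornwinder_alpha a b c d q in
     (\<Sum>j=1..n.
        \<alpha> * t powi (int n - int j) * q powi (Poly_Mapping.lookup la (j - 1)) +
        inverse \<alpha> * t powi (- int n + int j) * q powi (- Poly_Mapping.lookup la (j - 1)) -
        \<alpha> * t powi (int n - int j) -
        inverse \<alpha> * t powi (- int n + int j)))"

(* Points of the torus at which no coefficient of the operator has a pole. *)
definition regular_point :: "nat \<Rightarrow> complex \<Rightarrow> (nat \<Rightarrow> complex) \<Rightarrow> bool" where
  "regular_point n q x \<longleftrightarrow>
     (\<forall>i<n. x i \<noteq> 0 \<and> (x i)\<^sup>2 \<noteq> 1 \<and> q * (x i)\<^sup>2 \<noteq> 1 \<and> (x i)\<^sup>2 \<noteq> q) \<and>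
     (\<forall>i<n. \<forall>j<n. i \<noteq> j \<longrightarrow> x i \<noteq> x j \<and> x i * x j \<noteq> 1)"

(* For q \<noteq> 0 the regular points are Zariski dense, so the last conjunct is the eigenvalue
   equation as an identity of rational functions. *)
definition is_koornwinder :: "nat \<Rightarrow> expo \<Rightarrow> complex \<Rightarrow> complex \<Rightarrow> complex \<Rightarrow> complex \<Rightarrow>
    complex \<Rightarrow> complex \<Rightarrow> laurent \<Rightarrow> bool" where
  "is_koornwinder n la a b c d q t P \<longleftrightarrow>
     in_vars n P \<and> W_invariant n P \<and>
     (\<exists>w. P = m_poly n la +
        (\<Sum>\<mu> | is_partition n \<mu> \<and> dominated n \<mu> la \<and> \<mu> \<noteq> la. lconst (w \<mu>) * m_poly n \<mu>)) \<and>
     (\<forall>x. regular_point n q x \<longrightarrow>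
        koornwinder_op n a b c d q t (leval P) x =
        koornwinder_eigenvalue n la a b c d q t * leval P x)"

definition koornwinder :: "nat \<Rightarrow> expo \<Rightarrow> complex \<Rightarrow> complex \<Rightarrow> complex \<Rightarrow> complex \<Rightarrow>
    complex \<Rightarrow> complex \<Rightarrow> laurent" where
  "koornwinder n la a b c d q t = (THE P. is_koornwinder n la a b c d q t P)"

definition one_column :: "nat \<Rightarrow> expo" where
  "one_column r = (\<Sum>i<r. Poly_Mapping.single i 1)"

(* The choice of square roots is immaterial: another choice permutes the parameters
   within the pairs (a, b) and (c, d). *)
definition P_CC :: "nat \<Rightarrow> expo \<Rightarrow> complex \<Rightarrow> complex \<Rightarrow> complex \<Rightarrow> laurent" where
  "P_CC n la b q t =
     koornwinder n la (csqrt b) (- csqrt b) (csqrt q * csqrt b) (- (csqrt q * csqrt b)) q t"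

definition P_DD :: "nat \<Rightarrow> expo \<Rightarrow> complex \<Rightarrow> complex \<Rightarrow> laurent" where
  "P_DD n la q t = koornwinder n la 1 (-1) (csqrt q) (- csqrt q) q t"

(* The first and third coefficients below are rational functions of u, taken at u = t^(n - r).
   For r < n they are regular there; for r = n (u = 1) the singularity is removable and
   remove_sings yields the value after cancellation. *)

definition coeff_CC :: "nat \<Rightarrow> nat \<Rightarrow> nat \<Rightarrow> complex \<Rightarrow> complex \<Rightarrow> complex" where
  "coeff_CC n r j q t = remove_sings (\<lambda>u.
     (qpoch (1 / (q * t)) (t\<^sup>2) j * qpoch (u\<^sup>2) (t\<^sup>2) j) /
     (qpoch (t\<^sup>2) (t\<^sup>2) j * qpoch (q * u\<^sup>2 * t ^ 3) (t\<^sup>2) j) *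
     ((1 - u\<^sup>2 * t ^ (4 * j)) / (1 - u\<^sup>2)) * (q * t) ^ j) (t ^ (n - r))"

definition coeff_CC_inv :: "nat \<Rightarrow> nat \<Rightarrow> nat \<Rightarrow> complex \<Rightarrow> complex \<Rightarrow> complex" where
  "coeff_CC_inv n r j q t =
     (qpoch (q * t) (t\<^sup>2) j * qpoch (t powi (2 * int n - 2 * int r + 2 * int j + 2)) (t\<^sup>2) j) /
     (qpoch (t\<^sup>2) (t\<^sup>2) j * qpoch (q * t powi (2 * int n - 2 * int r + 2 * int j + 1)) (t\<^sup>2) j)"

definition coeff_DD :: "nat \<Rightarrow> nat \<Rightarrow> nat \<Rightarrow> complex \<Rightarrow> complex \<Rightarrow> complex" where
  "coeff_DD n r j q t = remove_sings (\<lambda>u.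
     (qpoch (t / q) (t\<^sup>2) j * qpoch (u\<^sup>2) (t\<^sup>2) j) /
     (qpoch (t\<^sup>2) (t\<^sup>2) j * qpoch (q * u\<^sup>2 * t) (t\<^sup>2) j) *
     ((1 - u * t ^ (2 * j)) / (1 - u)) * q ^ j) (t ^ (n - r))"

definition coeff_DD_inv :: "nat \<Rightarrow> nat \<Rightarrow> nat \<Rightarrow> complex \<Rightarrow> complex \<Rightarrow> complex" where
  "coeff_DD_inv n r j q t =
     (qpoch (q / t) (t\<^sup>2) j * qpoch (t powi (2 * int n - 2 * int r + 2 * int j + 2)) (t\<^sup>2) j) /
     (qpoch (t\<^sup>2) (t\<^sup>2) j * qpoch (q * t powi (2 * int n - 2 * int r + 2 * int j - 1)) (t\<^sup>2) j) *
     ((1 + t ^ (n - r)) / (1 + t ^ (n - r + 2 * j))) * t ^ j"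

end

theory Submission
  imports Defs
begin

text \<open>The generating function \<open>G(y) = \<Prod>\<^sub>i (1 - y x\<^sub>i)(1 - y/x\<^sub>i) = \<Sum>\<^sub>r (-y)\<^sup>r E\<^sub>r\<close> is a kernel
  function: for parameters \<open>\<plusminus>\<beta>\<^bsup>1/2\<^esup>, \<plusminus>(q\<beta>)\<^bsup>1/2\<^esup>\<close> the Koornwinder operator in \<open>x\<close> acts on \<open>G\<close> as an
  Askey-Wilson operator in \<open>y\<close> with base \<open>t\<close>.  For \<open>\<beta> = t\<close> and \<open>\<beta> = 1\<close> the coefficients of the latter
  simplify so much that comparing powers of \<open>y\<close> expresses the defect \<open>(D - d\<^sub>r\<^sub>+\<^sub>2) E\<^sub>r\<^sub>+\<^sub>2\<close> by
  \<open>(D - d\<^sub>r) E\<^sub>r\<close> and \<open>E\<^sub>r\<close> alone.  With such a two-term recurrence, applying \<open>D - d\<^sub>r\<close> to the claimed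
  expansion of the one-column Koornwinder polynomial telescopes to zero.  The inverse expansion satisfies
  the same eigenvalue problem up to lower terms, and its coefficients obey a first-order recurrence;
  it follows because the eigenvalues \<open>d\<^sub>s\<close>, \<open>s \<le> n\<close>, are distinct.\<close>

subsection \<open>Elementary symmetric functions of x + 1/x\<close>

text \<open>In \<open>y\<close> the denominators are 1 - y^2, 1 - t y^2 and t - y^2, and the
  numerators are (1 - beta y^2)(1 - q beta y^2) and (y^2 - beta)(y^2 - q beta). For beta = t the
  last two denominators cancel, and the remaining 1 - y^2 yields a two-term recurrence at once. For
  beta = 1 only 1 - y^2 cancels. The remaining (1 - t y^2)(t - y^2) yields a three-term recurrence
  for the defects, which is reduced to a two-term one by induction, starting from the vanishing of
  the first two defects. All indices move by two because the coefficients contain \<open>y\<close>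
  only through y^2.

  Triangularity of the operator is not proved for general partitions. The E_s are unitriangular in
  the m_(1^s), and the recurrence itself shows that the defect of E_r is a combination of lower E_s.
  Hence everything takes place in the span of the columns, and uniqueness needs only that such a
  combination is zero once it vanishes at all regular points.\<close>

definition esym :: "nat \<Rightarrow> nat \<Rightarrow> (nat \<Rightarrow> 'a::comm_ring_1) \<Rightarrow> 'a" where
  "esym n s V = (\<Sum>S | S \<subseteq> {..<n} \<and> card S = s. \<Prod>i\<in>S. V i)"

text \<open>For \<open>V i = x i + 1 / x i\<close> the factor 1 - V y + y^2 is (1 - y x)(1 - y/x),
  so this is G(y). The ring is general because both Laurent polynomials and complex values are
  substituted for \<open>V\<close>.\<close>

definition esym_gen :: "nat \<Rightarrow> (nat \<Rightarrow> 'a::comm_ring_1) \<Rightarrow> 'a poly" where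
  "esym_gen n V = (\<Prod>i<n. [:1, - V i, 1:])"

text \<open>The multiplicity of e_s(V) in E_r: of the n - s factors that contribute no
  \<open>V i\<close>, exactly (r - s)/2 contribute y^2. It is applied with s at most r only.\<close>

definition esym_coeff :: "nat \<Rightarrow> nat \<Rightarrow> nat \<Rightarrow> nat" where
  "esym_coeff n r s = (if even (r - s) then (n - s) choose ((r - s) div 2) else 0)"

lemma one_plus_square_power:
  "[:1, 0, 1:] ^ k = (\<Sum>i\<le>k. monom (of_nat (k choose i) :: 'a::comm_ring_1) (2 * i))"
proof -
  have "[:1, 0, 1:] = monom (1::'a) 2 + 1"
    by (simp add: numeral_2_eq_2 monom_Suc one_pCons)
  then have "[:1, 0, 1:] ^ k = (\<Sum>i\<le>k. of_nat (k choose i) * monom (1::'a) 2 ^ i * 1 ^ (k - i))"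
    by (simp only: binomial_ring)
  also have "\<dots> = (\<Sum>i\<le>k. monom (of_nat (k choose i) :: 'a::comm_ring_1) (2 * i))"
    by (intro sum.cong refl) (simp add: monom_power of_nat_poly smult_monom)
  finally show ?thesis .
qed

lemma coeff_one_plus_square_power:
  "coeff ([:1, 0, 1:] ^ k) m = (of_nat (if even m then k choose (m div 2) else 0) :: 'a::comm_ring_1)"
proof (cases "even m")
  case True
  then obtain l where l: "m = 2 * l" by (elim evenE)
  have "coeff ([:1, 0, 1:] ^ k) m = (\<Sum>i\<le>k. if i = l then of_nat (k choose i) else (0::'a))"
    unfolding one_plus_square_power coeff_sum l by (intro sum.cong refl) simp
  also have "\<dots> = of_nat (k choose l)" by (simp add: binomial_eq_0)
  finally show ?thesis using l by simp
next
  case False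
  then have "\<And>i. 2 * i \<noteq> m" by auto
  then show ?thesis using False by (simp add: one_plus_square_power coeff_sum)
qed

text \<open>Each factor contributes either - V_i y, for i in \<open>S\<close>, or 1 + y^2.\<close>

lemma esym_gen_expand:
  "esym_gen n V = (\<Sum>S\<in>Pow {..<n}. monom ((-1) ^ card S * (\<Prod>i\<in>S. V i)) (card S) *
     [:1, 0, 1:] ^ (n - card S))"
proof -
  have "esym_gen n V = (\<Prod>i<n. monom (- V i) 1 + [:1, 0, 1:])"
    unfolding esym_gen_def by (intro prod.cong refl) (simp add: monom_altdef)
  also have "\<dots> = (\<Sum>S\<in>Pow {..<n}. (\<Prod>i\<in>S. monom (- V i) 1) * (\<Prod>i\<in>{..<n} - S. [:1, 0, 1:]))"
    by (rule prod_add) simp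
  also have "\<dots> = (\<Sum>S\<in>Pow {..<n}. monom ((-1) ^ card S * (\<Prod>i\<in>S. V i)) (card S) *
     [:1, 0, 1:] ^ (n - card S))"
  proof (intro sum.cong refl arg_cong2[where f = "(*)"])
    fix S assume "S \<in> Pow {..<n}"
    then have fin: "finite S" and sub: "S \<subseteq> {..<n}" by (auto intro: finite_subset)
    from fin show "(\<Prod>i\<in>S. monom (- V i) 1) = monom ((-1) ^ card S * (\<Prod>i\<in>S. V i)) (card S)"
      by (induction S rule: finite_induct) (simp_all add: mult_monom one_pCons[symmetric] monom_0)
    show "(\<Prod>i\<in>{..<n} - S. [:1, 0, 1::'a:]) = [:1, 0, 1:] ^ (n - card S)"
      using fin sub by (simp add: card_Diff_subset)
  qed
  finally show ?thesis .
qed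

lemma coeff_esym_gen:
  "(-1) ^ r * coeff (esym_gen n V) r = (\<Sum>s\<le>r. of_nat (esym_coeff n r s) * esym n s V)"
proof -
  have fin: "finite {S. S \<subseteq> {..<n} \<and> card S = s}" for s by simp
  define h where "h S = (if card S \<le> r then of_nat (esym_coeff n r (card S)) * (\<Prod>i\<in>S. V i) else 0)" for S
  have "(-1) ^ r * coeff (esym_gen n V) r = (\<Sum>S\<in>Pow {..<n}. h S)"
    unfolding esym_gen_expand coeff_sum sum_distrib_left
  proof (intro sum.cong refl)
    fix S :: "nat set"
    \<comment> \<open>Powers of 1 + y^2 have only even degrees, so \<open>r\<close> and
      \<open>card S\<close> have equal parity and the signs cancel.\<close>
    have "(-1) ^ r * (-1) ^ card S = (1::'a)" if "card S \<le> r" "even (r - card S)"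
      using that by (metis even_add le_add_diff_inverse minus_one_power_iff mult_1 mult_minus1 minus_minus)
    then show "(-1) ^ r * coeff (monom ((-1) ^ card S * (\<Prod>i\<in>S. V i)) (card S) *
       [:1, 0, 1:] ^ (n - card S)) r = h S"
      by (auto simp: h_def coeff_monom_mult coeff_one_plus_square_power esym_coeff_def not_le
            simp flip: mult.assoc)
  qed
  also have "\<dots> = (\<Sum>S\<in>Pow {..<n} \<inter> {S. card S \<le> r}. h S)"
    by (rule sum.mono_neutral_right) (auto simp: h_def)
  also have "Pow {..<n} \<inter> {S. card S \<le> r} = (\<Union>s\<in>{..r}. {S. S \<subseteq> {..<n} \<and> card S = s})" by auto
  also have "(\<Sum>S\<in>(\<Union>s\<in>{..r}. {S. S \<subseteq> {..<n} \<and> card S = s}). h S) =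
      (\<Sum>s\<in>{..r}. \<Sum>S | S \<subseteq> {..<n} \<and> card S = s. h S)"
    by (rule sum.UNION_disjoint) (use fin in auto)
  also have "\<dots> = (\<Sum>s\<le>r. of_nat (esym_coeff n r s) * esym n s V)"
    unfolding esym_def sum_distrib_left by (intro sum.cong refl) (auto simp: h_def)
  finally show ?thesis .
qed

section \<open>Laurent polynomials and their evaluation\<close>

definition sym_var :: "nat \<Rightarrow> laurent" where
  "sym_var i = monomial (Poly_Mapping.single i 1) + monomial (Poly_Mapping.single i (-1))"

lemma lconst_0 [simp]: "lconst 0 = 0"
  by (simp add: lconst_def)

lemma lconst_1 [simp]: "lconst 1 = 1"
  by (simp add: lconst_def flip: single_one)

lemma lconst_add: "lconst (a + b) = lconst a + lconst b"
  by (simp add: lconst_def single_add)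

lemma lconst_mult: "lconst (a * b) = lconst a * lconst b"
  by (simp add: lconst_def mult_single)

lemma lconst_uminus: "lconst (- a) = - lconst a"
  by (simp add: lconst_def single_uminus)

lemma lconst_of_nat: "lconst (of_nat k) = of_nat k"
  by (simp add: lconst_def)

lemma monomial_mult: "monomial a * monomial b = monomial (a + b)"
  by (simp add: monomial_def mult_single)

lemma monomial_prod: "finite A \<Longrightarrow> (\<Prod>i\<in>A. monomial (f i)) = monomial (\<Sum>i\<in>A. f i)"
  by (induction A rule: finite_induct) (simp_all add: monomial_mult, simp add: monomial_def)

lemma E_poly_eq_esym_gen: "E_poly n r = (-1) ^ r * coeff (esym_gen n sym_var) r"
proof -
  have "[:1, - monomial (Poly_Mapping.single i 1):] * [:1, - monomial (Poly_Mapping.single i (-1)):]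
      = [:1, - sym_var i, 1:]" for i
    by (simp add: sym_var_def monomial_mult flip: single_add) (simp add: monomial_def)
  then show ?thesis by (simp add: E_poly_def esym_gen_def)
qed

text \<open>\<open>leval\<close> sums over the support, which cancellation can shrink. A common
  finite superset makes different evaluations comparable term by term.\<close>

lemma leval_superset:
  assumes "finite K" "Poly_Mapping.keys P \<subseteq> K"
  shows "leval P x = (\<Sum>\<mu>\<in>K. Poly_Mapping.lookup P \<mu> *
      (\<Prod>i\<in>Poly_Mapping.keys \<mu>. x i powi Poly_Mapping.lookup \<mu> i))"
  unfolding leval_def by (rule sum.mono_neutral_left) (use assms in \<open>auto simp: in_keys_iff\<close>)

lemma leval_add: "leval (P + Q) x = leval P x + leval Q x"
proof -
  let ?K = "Poly_Mapping.keys P \<union> Poly_Mapping.keys Q"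
  have K: "finite ?K" "Poly_Mapping.keys (P + Q) \<subseteq> ?K" "Poly_Mapping.keys P \<subseteq> ?K"
    "Poly_Mapping.keys Q \<subseteq> ?K"
    using Poly_Mapping.keys_add[of P Q] by auto
  show ?thesis
    unfolding leval_superset[OF K(1,2)] leval_superset[OF K(1,3)] leval_superset[OF K(1,4)]
    by (simp add: lookup_add distrib_right sum.distrib)
qed

lemma lookup_lconst_mult: "Poly_Mapping.lookup (lconst c * P) \<mu> = c * Poly_Mapping.lookup P \<mu>"
  unfolding lconst_def mult_map_scale_conv_mult[symmetric]
  by (simp add: Poly_Mapping.map.rep_eq when_def)

lemma leval_0 [simp]: "leval 0 x = 0"
  by (simp add: leval_def)

lemma leval_sum: "leval (\<Sum>a\<in>A. f a) x = (\<Sum>a\<in>A. leval (f a) x)"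
  by (induction A rule: infinite_finite_induct) (simp_all add: leval_add)

lemma leval_lconst_mult: "leval (lconst c * P) x = c * leval P x"
proof -
  have "Poly_Mapping.keys (lconst c * P) \<subseteq> Poly_Mapping.keys P"
    by (auto simp: in_keys_iff lookup_lconst_mult)
  from leval_superset[OF _ this] show ?thesis
    by (simp add: leval_def lookup_lconst_mult sum_distrib_left mult.assoc)
qed

lemma leval_uminus: "leval (- P) x = - leval P x"
  using leval_lconst_mult[of "-1" P x] by (simp add: lconst_uminus)

lemma leval_diff: "leval (P - Q) x = leval P x - leval Q x"
  using leval_add[of P "- Q" x] by (simp add: leval_uminus)

lemma leval_monomial:
  "leval (monomial \<mu>) x = (\<Prod>i\<in>Poly_Mapping.keys \<mu>. x i powi Poly_Mapping.lookup \<mu> i)"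
  by (simp add: leval_def monomial_def)

text \<open>The exponents in the expansion of the product of x_i + 1/x_i over \<open>S\<close>,
  where \<open>T\<close> marks the factors that contribute x_i. They also describe the orbits of the
  columns.\<close>

definition sign_expo :: "nat set \<Rightarrow> nat set \<Rightarrow> expo" where
  "sign_expo S T = (\<Sum>i\<in>T. Poly_Mapping.single i 1) + (\<Sum>i\<in>S - T. Poly_Mapping.single i (-1))"

lemma lookup_sum_single:
  "finite A \<Longrightarrow> Poly_Mapping.lookup (\<Sum>i\<in>A. Poly_Mapping.single i c) j = (if j \<in> A then c else 0)"
  by (simp add: lookup_sum lookup_single when_def)

lemma lookup_sign_expo:
  "finite S \<Longrightarrow> T \<subseteq> S \<Longrightarrow>
     Poly_Mapping.lookup (sign_expo S T) i = (if i \<in> T then 1 else if i \<in> S then -1 else 0)"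
  by (simp add: sign_expo_def lookup_add lookup_sum_single finite_subset)

lemma keys_sign_expo: "finite S \<Longrightarrow> T \<subseteq> S \<Longrightarrow> Poly_Mapping.keys (sign_expo S T) = S"
  by (auto simp: in_keys_iff lookup_sign_expo split: if_splits)

lemma prod_sym_var: "finite S \<Longrightarrow> (\<Prod>i\<in>S. sym_var i) = (\<Sum>T\<in>Pow S. monomial (sign_expo S T))"
  unfolding sym_var_def sign_expo_def
  by (subst prod_add, assumption, intro sum.cong refl)
     (auto simp: monomial_prod monomial_mult finite_subset)

text \<open>Evaluation is not multiplicative where a coordinate is 0: there the product of x and 1/x
  evaluates to 1, but both factors evaluate to 0. Expanding the product over distinct variables into
  monomials avoids this, so the equation holds at every point.\<close>

lemma leval_prod_sym_var:
  assumes "finite S"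
  shows "leval (\<Prod>i\<in>S. sym_var i) x = (\<Prod>i\<in>S. x i + inverse (x i))"
proof -
  have "leval (monomial (sign_expo S T)) x = (\<Prod>i\<in>T. x i) * (\<Prod>i\<in>S - T. inverse (x i))"
    if "T \<subseteq> S" for T
  proof -
    have "leval (monomial (sign_expo S T)) x =
        (\<Prod>i\<in>S. x i powi Poly_Mapping.lookup (sign_expo S T) i)"
      by (simp only: leval_monomial keys_sign_expo[OF assms that])
    also have "\<dots> = (\<Prod>i\<in>T. x i powi Poly_Mapping.lookup (sign_expo S T) i) *
         (\<Prod>i\<in>S - T. x i powi Poly_Mapping.lookup (sign_expo S T) i)"
      using prod.subset_diff[OF that assms] by (simp add: mult.commute)
    also have "\<dots> = (\<Prod>i\<in>T. x i) * (\<Prod>i\<in>S - T. inverse (x i))"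
      using assms that by (intro arg_cong2[where f = "(*)"] prod.cong refl)
        (auto simp: lookup_sign_expo power_int_minus)
    finally show ?thesis .
  qed
  then show ?thesis
    by (simp add: prod_sym_var leval_sum assms prod_add)
qed

lemma leval_esym: "leval (esym n s sym_var) x = esym n s (\<lambda>i. x i + inverse (x i))"
  unfolding esym_def leval_sum
  by (intro sum.cong refl leval_prod_sym_var) (auto intro: finite_subset)

section \<open>Orbits and dominance order of columns\<close>

lemma lookup_one_column: "Poly_Mapping.lookup (one_column r) i = (if i < r then 1 else 0)"
  by (simp add: one_column_def lookup_sum_single)

text \<open>An orbit element is determined by the set \<open>S\<close> of its s nonzero positions
  and the set \<open>T\<close> of its positive ones.\<close>

lemma W_orbit_one_column:
  assumes "s \<le> n"
  shows "W_orbit n (one_column s) =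
    (\<lambda>(S, T). sign_expo S T) ` (SIGMA S : {S. S \<subseteq> {..<n} \<and> card S = s}. Pow S)"
proof (intro equalityI subsetI)
  fix \<mu> assume "\<mu> \<in> W_orbit n (one_column s)"
  then obtain \<pi> \<epsilon> where keys: "Poly_Mapping.keys \<mu> \<subseteq> {..<n}" and \<pi>: "\<pi> permutes {..<n}"
    and \<epsilon>: "\<forall>i<n. \<epsilon> i \<in> {1, -1}"
    and \<mu>: "\<forall>i<n. Poly_Mapping.lookup \<mu> i = \<epsilon> i * Poly_Mapping.lookup (one_column s) (\<pi> i)"
    unfolding W_orbit_def by blast
  define S where "S = {i\<in>{..<n}. \<pi> i < s}"
  define T where "T = {i\<in>S. \<epsilon> i = 1}"
  have fin: "finite S" and sub: "T \<subseteq> S" by (auto simp: S_def T_def)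
  have "\<pi> ` S = {..<s}"
  proof (intro equalityI subsetI)
    fix j assume j: "j \<in> {..<s}"
    with assms have "j \<in> \<pi> ` {..<n}" using permutes_image[OF \<pi>] by auto
    with j show "j \<in> \<pi> ` S" by (auto simp: S_def)
  qed (auto simp: S_def)
  moreover have "inj_on \<pi> S" using permutes_inj_on[OF \<pi>] .
  ultimately have "card S = s" using card_image by force
  moreover have "\<mu> = sign_expo S T"
  proof (rule poly_mapping_eqI)
    fix i
    show "Poly_Mapping.lookup \<mu> i = Poly_Mapping.lookup (sign_expo S T) i"
    proof (cases "i < n")
      case True
      then have "i \<in> S \<longleftrightarrow> \<pi> i < s" "i \<in> T \<longleftrightarrow> \<pi> i < s \<and> \<epsilon> i = 1"
        "\<epsilon> i = 1 \<or> \<epsilon> i = -1" "Poly_Mapping.lookup \<mu> i = \<epsilon> i * (if \<pi> i < s then 1 else 0)"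
        using \<mu> \<epsilon> by (auto simp: S_def T_def lookup_one_column)
      then show ?thesis by (simp only: lookup_sign_expo[OF fin sub]) auto
    next
      case False
      then have "i \<notin> Poly_Mapping.keys \<mu>" "i \<notin> S" using keys by (auto simp: S_def)
      then show ?thesis using sub by (auto simp: lookup_sign_expo[OF fin sub] in_keys_iff)
    qed
  qed
  moreover have "S \<subseteq> {..<n}" by (auto simp: S_def)
  ultimately show "\<mu> \<in> (\<lambda>(S, T). sign_expo S T) ` (SIGMA S : {S. S \<subseteq> {..<n} \<and> card S = s}. Pow S)"
    using sub by blast
next
  fix \<mu> assume "\<mu> \<in> (\<lambda>(S, T). sign_expo S T) ` (SIGMA S : {S. S \<subseteq> {..<n} \<and> card S = s}. Pow S)"
  then obtain S T where S: "S \<subseteq> {..<n}" "card S = s" and T: "T \<subseteq> S" and \<mu>: "\<mu> = sign_expo S T"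
    by auto
  have fin: "finite S" using S finite_subset by blast
  obtain f where f: "bij_betw f S {..<s}"
    using finite_same_card_bij[OF fin, of "{..<s}"] S by auto
  have "card ({..<n} - S) = card {s..<n}" using S by (simp add: card_Diff_subset fin)
  then obtain g where g: "bij_betw g ({..<n} - S) {s..<n}"
    using finite_same_card_bij[of "{..<n} - S" "{s..<n}"] by auto
  \<comment> \<open>A bijection of \<open>S\<close> onto the first s positions and one of its
    complement onto the others glue to the required permutation. The signs are then read off from
    \<open>T\<close>.\<close>
  define \<pi> where "\<pi> i = (if i \<in> S then f i else if i < n then g i else i)" for i
  have "bij_betw \<pi> S {..<s}" by (rule iffD2[OF bij_betw_cong f]) (simp add: \<pi>_def)
  moreover have "bij_betw \<pi> ({..<n} - S) {s..<n}"
    by (rule iffD2[OF bij_betw_cong g]) (simp add: \<pi>_def)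
  ultimately have "bij_betw \<pi> (S \<union> ({..<n} - S)) ({..<s} \<union> {s..<n})"
    by (rule bij_betw_combine) auto
  moreover have "S \<union> ({..<n} - S) = {..<n}" "{..<s} \<union> {s..<n} = {..<n}" using S assms by auto
  ultimately have "\<pi> permutes {..<n}"
    using S by (intro bij_imp_permutes) (auto simp: \<pi>_def)
  moreover have "\<forall>i<n. Poly_Mapping.lookup \<mu> i =
      (if i \<in> S - T then -1 else 1) * Poly_Mapping.lookup (one_column s) (\<pi> i)"
  proof (intro allI impI)
    fix i assume "i < n"
    have "f i < s" if "i \<in> S" using bij_betwE[OF f] that by auto
    moreover have "\<not> g i < s" if "i \<notin> S" using bij_betwE[OF g, rule_format, of i] that \<open>i < n\<close> by auto
    ultimately show "Poly_Mapping.lookup \<mu> i =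
      (if i \<in> S - T then -1 else 1) * Poly_Mapping.lookup (one_column s) (\<pi> i)"
      using \<open>i < n\<close> T by (auto simp: \<mu> lookup_sign_expo[OF fin T] lookup_one_column \<pi>_def)
  qed
  moreover have "Poly_Mapping.keys \<mu> \<subseteq> {..<n}" using S T fin by (simp add: \<mu> keys_sign_expo)
  ultimately show "\<mu> \<in> W_orbit n (one_column s)"
    unfolding W_orbit_def
    by (intro CollectI conjI exI[of _ \<pi>] exI[of _ "\<lambda>i. if i \<in> S - T then -1 else 1"]) auto
qed

text \<open>Distinct pairs \<open>(S, T)\<close> have distinct exponents, so the orbit sum is the
  complete expansion of e_s(x + 1/x), each monomial occurring once.\<close>

lemma m_poly_one_column:
  assumes "s \<le> n"
  shows "m_poly n (one_column s) = esym n s sym_var"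
proof -
  let ?A = "{S. S \<subseteq> {..<n} \<and> card S = s}"
  have fin: "finite S" if "S \<in> ?A" for S using that finite_subset by blast
  have "inj_on (\<lambda>(S, T). sign_expo S T) (SIGMA S : ?A. Pow S)"
  proof (rule inj_onI)
    fix p p' assume pp: "p \<in> (SIGMA S : ?A. Pow S)" "p' \<in> (SIGMA S : ?A. Pow S)"
      "(\<lambda>(S, T). sign_expo S T) p = (\<lambda>(S, T). sign_expo S T) p'"
    obtain S T S' T' where p: "p = (S, T)" "p' = (S', T')" by (meson surj_pair)
    have "S \<in> ?A" "S' \<in> ?A" and T: "T \<subseteq> S" "T' \<subseteq> S'"
      using pp(1,2) unfolding p by simp_all
    then have sub: "finite S" "finite S'" "T \<subseteq> S" "T' \<subseteq> S'" using fin by blast+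
    have eq: "sign_expo S T = sign_expo S' T'" using pp(3) unfolding p by simp
    have "S = S'" using arg_cong[OF eq, of Poly_Mapping.keys] sub by (simp add: keys_sign_expo)
    moreover have "i \<in> T \<longleftrightarrow> i \<in> T'" for i
      using arg_cong[OF eq, of "\<lambda>p. Poly_Mapping.lookup p i"] sub
      by (auto simp: lookup_sign_expo split: if_splits)
    ultimately show "p = p'" using p by auto
  qed
  then have "m_poly n (one_column s) = (\<Sum>(S, T)\<in>(SIGMA S : ?A. Pow S). monomial (sign_expo S T))"
    unfolding m_poly_def W_orbit_one_column[OF assms]
    by (subst sum.reindex) (auto simp: case_prod_unfold)
  also have "\<dots> = (\<Sum>S\<in>?A. \<Sum>T\<in>Pow S. monomial (sign_expo S T))"
    by (rule sum.Sigma[symmetric]) (use fin in auto)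
  also have "\<dots> = esym n s sym_var"
    unfolding esym_def by (intro sum.cong refl prod_sym_var[symmetric] fin)
  finally show ?thesis .
qed

text \<open>The bound on the first part forces all entries to be 0 or 1, so everything below a
  column is a column. The bound on the full sum limits its length.\<close>

lemma dominated_one_column:
  assumes "r \<le> n"
  shows "{\<mu>. is_partition n \<mu> \<and> dominated n \<mu> (one_column r) \<and> \<mu> \<noteq> one_column r} =
    one_column ` {..<r}"
proof (intro equalityI subsetI)
  fix \<mu> assume "\<mu> \<in> {\<mu>. is_partition n \<mu> \<and> dominated n \<mu> (one_column r) \<and> \<mu> \<noteq> one_column r}"
  then have part: "is_partition n \<mu>" and dom: "dominated n \<mu> (one_column r)"
    and ne: "\<mu> \<noteq> one_column r" by auto
  let ?l = "Poly_Mapping.lookup \<mu>"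
  have nonneg: "0 \<le> ?l i" if "i < n" for i using part that by (simp add: is_partition_def)
  have mono: "?l j \<le> ?l i" if "i \<le> j" "j < n" for i j using part that by (simp add: is_partition_def)
  have sum_one: "(\<Sum>k<i. Poly_Mapping.lookup (one_column r) k) = int (min i r)" for i
    by (induction i) (auto simp: lookup_one_column)
  have dom': "(\<Sum>k<i. ?l k) \<le> int (min i r)" if "i \<in> {1..n}" for i
    using dom that unfolding dominated_def sum_one by blast
  have le1: "?l i \<le> 1" if "i < n" for i
    using dom'[of 1] that mono[of 0 i] by auto
  define s where "s = card {i\<in>{..<n}. ?l i = 1}"
  have val: "?l i = 0 \<or> ?l i = 1" if "i < n" for i using nonneg[OF that] le1[OF that] by linarith
  \<comment> \<open>The entries decrease, so the positions with entry 1 form an initial segment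
    whose length is their number.\<close>
  have "{i\<in>{..<n}. ?l i = 1} = {..<s}"
  proof -
    let ?A = "{i\<in>{..<n}. ?l i = 1}"
    have down: "j \<in> ?A" if "i \<in> ?A" "j \<le> i" for i j
      using that mono[of j i] le1[of j] by auto
    have "i < s" if "i \<in> ?A" for i
    proof -
      have "{..i} \<subseteq> ?A" using down[OF that] by auto
      then have "card {..i} \<le> s" unfolding s_def by (intro card_mono) auto
      then show ?thesis by simp
    qed
    then have "?A \<subseteq> {..<s}" by blast
    then show ?thesis by (intro card_subset_eq) (auto simp: s_def)
  qed
  then have l: "i < n \<Longrightarrow> ?l i = 1 \<longleftrightarrow> i < s" for i by (metis (mono_tags, lifting) lessThan_iff mem_Collect_eq)
  have sn: "s \<le> n" unfolding s_def using card_mono[of "{..<n}" "{i\<in>{..<n}. ?l i = 1}"] by auto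
  have eq: "\<mu> = one_column s"
  proof (rule poly_mapping_eqI)
    fix i show "?l i = Poly_Mapping.lookup (one_column s) i"
    proof (cases "i < n")
      case True then show ?thesis using l[of i] val[of i] by (auto simp: lookup_one_column)
    next
      case False
      then have "i \<notin> Poly_Mapping.keys \<mu>" using part by (auto simp: is_partition_def)
      then show ?thesis using False sn by (simp add: in_keys_iff lookup_one_column)
    qed
  qed
  have "s \<le> r"
  proof (cases "n = 0")
    case False
    have "(\<Sum>k<n. ?l k) = int (min n s)"
      unfolding eq by (induction n) (auto simp: lookup_one_column)
    then show ?thesis using dom'[of n] False sn assms by auto
  qed (use sn in simp)
  with eq ne have "s < r" by (cases "s = r") auto
  with eq show "\<mu> \<in> one_column ` {..<r}" by blast
next
  fix \<mu> assume "\<mu> \<in> one_column ` {..<r}"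
  then obtain s where s: "s < r" "\<mu> = one_column s" by auto
  have sum_one: "(\<Sum>k<i. Poly_Mapping.lookup (one_column r) k) = int (min i r)" for i r
    by (induction i) (auto simp: lookup_one_column)
  have "Poly_Mapping.lookup \<mu> s \<noteq> Poly_Mapping.lookup (one_column r) s"
    using s by (simp add: lookup_one_column)
  moreover have "is_partition n \<mu>"
    using s assms by (auto simp: is_partition_def lookup_one_column in_keys_iff split: if_splits)
  moreover have "dominated n \<mu> (one_column r)"
    using s by (auto simp: dominated_def sum_one)
  ultimately show "\<mu> \<in> {\<mu>. is_partition n \<mu> \<and> dominated n \<mu> (one_column r) \<and> \<mu> \<noteq> one_column r}"
    by auto
qed

lemma inj_one_column: "inj one_column"
proof (rule injI)
  fix r s assume "one_column r = one_column s"
  then have "i < r \<longleftrightarrow> i < s" for i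
    using lookup_one_column[of r i] lookup_one_column[of s i] by (auto split: if_splits)
  then show "r = s" by (metis linorder_neqE_nat less_irrefl)
qed

subsection \<open>The kernel identity\<close>

abbreviation gen_poly :: "nat \<Rightarrow> (nat \<Rightarrow> complex) \<Rightarrow> complex poly" where
  "gen_poly n x \<equiv> esym_gen n (\<lambda>i. x i + inverse (x i))"

definition koornwinder_plus :: "nat \<Rightarrow> complex \<Rightarrow> complex \<Rightarrow> complex \<Rightarrow> complex \<Rightarrow> complex \<Rightarrow> complex \<Rightarrow>
    (nat \<Rightarrow> complex) \<Rightarrow> nat \<Rightarrow> complex" where
  "koornwinder_plus n a b c d q t x i =
     (1 - a * x i) * (1 - b * x i) * (1 - c * x i) * (1 - d * x i) /
               (koornwinder_alpha a b c d q * t ^ (n - 1) * (1 - (x i)\<^sup>2) * (1 - q * (x i)\<^sup>2)) *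
             (\<Prod>j\<in>{..<n} - {i}. ((1 - t * x i * x j) * (1 - t * x i / x j)) /
                               ((1 - x i * x j) * (1 - x i / x j)))"

definition koornwinder_minus :: "nat \<Rightarrow> complex \<Rightarrow> complex \<Rightarrow> complex \<Rightarrow> complex \<Rightarrow> complex \<Rightarrow> complex \<Rightarrow>
    (nat \<Rightarrow> complex) \<Rightarrow> nat \<Rightarrow> complex" where
  "koornwinder_minus n a b c d q t x i =
     (1 - a / x i) * (1 - b / x i) * (1 - c / x i) * (1 - d / x i) /
               (koornwinder_alpha a b c d q * t ^ (n - 1) * (1 - 1 / (x i)\<^sup>2) * (1 - q / (x i)\<^sup>2)) *
             (\<Prod>j\<in>{..<n} - {i}. ((1 - t * x j / x i) * (1 - t / (x i * x j))) /
                               ((1 - x j / x i) * (1 - 1 / (x i * x j))))"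

lemma koornwinder_op_eq:
  "koornwinder_op n a b c d q t F x =
     (\<Sum>i<n. koornwinder_plus n a b c d q t x i * (F (x(i := q * x i)) - F x)) +
     (\<Sum>i<n. koornwinder_minus n a b c d q t x i * (F (x(i := x i / q)) - F x))"
  by (simp add: koornwinder_op_def koornwinder_plus_def koornwinder_minus_def Let_def)

lemma koornwinder_op_sum:
  "koornwinder_op n a b c d q t (\<lambda>x. \<Sum>k\<in>A. w k * F k x) x =
     (\<Sum>k\<in>A. w k * koornwinder_op n a b c d q t (F k) x)"
proof (induction A rule: infinite_finite_induct)
  case (insert k A)
  then show ?case
    by (simp add: koornwinder_op_eq algebra_simps sum.distrib sum_subtractf sum_distrib_left)
qed (simp_all add: koornwinder_op_eq)

lemma poly_gen_poly:
  "(\<And>i. i < n \<Longrightarrow> x i \<noteq> 0) \<Longrightarrow> poly (gen_poly n x) y = (\<Prod>i<n. (1 - y * x i) * (1 - y / x i))"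
  unfolding esym_gen_def poly_prod
  by (intro prod.cong refl) (simp add: field_simps)

lemma degree_gen_poly: "degree (gen_poly n x) \<le> 2 * n"
proof -
  have "degree (gen_poly n x) \<le> (\<Sum>i<n. degree [:1, - (x i + inverse (x i)), 1:])"
    unfolding esym_gen_def by (rule degree_prod_sum_le[unfolded o_def]) simp
  also have "\<dots> = 2 * n" by simp
  finally show ?thesis .
qed

text \<open>Every factor 1 - V y + y^2 is self-reciprocal. Through this symmetry zeros at
  \<open>y\<close> are carried over to 1/y.\<close>

lemma gen_poly_reflect:
  assumes "y \<noteq> 0"
  shows "poly (gen_poly n x) (1 / y) = poly (gen_poly n x) y / y ^ (2 * n)"
proof -
  have "poly (gen_poly n x) (1 / y) = (\<Prod>i<n. poly [:1, - (x i + inverse (x i)), 1:] y / y ^ 2)"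
    unfolding esym_gen_def poly_prod
    by (intro prod.cong refl) (use assms in \<open>simp add: field_simps power2_eq_square\<close>)
  also have "\<dots> = poly (gen_poly n x) y / y ^ (2 * n)"
    by (simp add: esym_gen_def poly_prod prod_dividef power_mult)
  finally show ?thesis .
qed

text \<open>At y = x_i the factors j ~= i of the shifted G are the denominators of the coefficient,
  and the factors j ~= i of G(t x_i) are its numerators. What is left comes from j = i. The
  assumption \<open>par\<close> encodes the parameters +-beta^(1/2), +-(q beta)^(1/2) without a
  choice of roots.\<close>

lemma kernel_plus:
  fixes x :: "nat \<Rightarrow> complex"
  assumes "i < n" and reg: "regular_point n q x" and t: "t \<noteq> 0" "t \<noteq> 1" and "q \<noteq> 0"
    and par: "\<And>z. (1 - a * z) * (1 - b * z) * (1 - c * z) * (1 - d * z) = (1 - \<beta> * z\<^sup>2) * (1 - q * \<beta> * z\<^sup>2)"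
    and \<alpha>: "koornwinder_alpha a b c d q \<noteq> 0"
  shows "(1 - (x i)\<^sup>2) * (1 - t * (x i)\<^sup>2) * koornwinder_plus n a b c d q t x i *
      poly (gen_poly n (x(i := q * x i))) (x i) =
    (1 - 1 / q) * t / (koornwinder_alpha a b c d q * (1 - t)) *
      ((1 - \<beta> * (x i)\<^sup>2) * (1 - q * \<beta> * (x i)\<^sup>2) * (poly (gen_poly n x) (t * x i) / t ^ n))"
proof -
  define z where "z = x i"
  have x0: "x j \<noteq> 0" if "j < n" for j using reg that by (simp add: regular_point_def)
  have z: "z \<noteq> 0" "z\<^sup>2 \<noteq> 1" "q * z\<^sup>2 \<noteq> 1"
    using reg \<open>i < n\<close> by (auto simp: regular_point_def z_def)
  define P1 where "P1 = (\<Prod>j\<in>{..<n} - {i}. (1 - z * x j) * (1 - z / x j))"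
  define P2 where "P2 = (\<Prod>j\<in>{..<n} - {i}. (1 - t * z * x j) * (1 - t * z / x j))"
  have "z * x j \<noteq> 1 \<and> z \<noteq> x j" if "j \<in> {..<n} - {i}" for j
    using reg \<open>i < n\<close> that by (auto simp: regular_point_def z_def)
  then have P1: "P1 \<noteq> 0" using x0 by (auto simp: P1_def)
  have "poly (gen_poly n (x(i := q * x i))) z =
      (\<Prod>j<n. (1 - z * (x(i := q * x i)) j) * (1 - z / (x(i := q * x i)) j))"
    by (rule poly_gen_poly) (use x0 \<open>q \<noteq> 0\<close> in auto)
  also have "\<dots> = (1 - q * z\<^sup>2) * (1 - 1 / q) *
      (\<Prod>j\<in>{..<n} - {i}. (1 - z * (x(i := q * x i)) j) * (1 - z / (x(i := q * x i)) j))"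
    using \<open>i < n\<close> z \<open>q \<noteq> 0\<close> by (subst prod.remove[of _ i]) (auto simp: z_def power2_eq_square)
  also have "(\<Prod>j\<in>{..<n} - {i}. (1 - z * (x(i := q * x i)) j) * (1 - z / (x(i := q * x i)) j)) = P1"
    unfolding P1_def by (intro prod.cong) auto
  finally have A: "poly (gen_poly n (x(i := q * x i))) z = (1 - q * z\<^sup>2) * (1 - 1 / q) * P1" .
  have "poly (gen_poly n x) (t * z) = (\<Prod>j<n. (1 - t * z * x j) * (1 - t * z / x j))"
    by (rule poly_gen_poly) (use x0 in auto)
  also have "\<dots> = (1 - t * z\<^sup>2) * (1 - t) * P2"
    unfolding P2_def using \<open>i < n\<close> z by (subst prod.remove[of _ i]) (auto simp: z_def power2_eq_square)
  finally have B: "poly (gen_poly n x) (t * z) = (1 - t * z\<^sup>2) * (1 - t) * P2" .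
  have C: "koornwinder_plus n a b c d q t x i = (1 - \<beta> * z\<^sup>2) * (1 - q * \<beta> * z\<^sup>2) /
      (koornwinder_alpha a b c d q * t ^ (n - 1) * (1 - z\<^sup>2) * (1 - q * z\<^sup>2)) * (P2 / P1)"
    unfolding koornwinder_plus_def par P1_def P2_def z_def prod_dividef ..
  have tn: "t ^ n = t * t ^ (n - 1)" using \<open>i < n\<close> by (cases n) auto
  have "1 - z\<^sup>2 \<noteq> 0" "1 - q * z\<^sup>2 \<noteq> 0" "1 - t \<noteq> 0" using z t by auto
  then show ?thesis
    unfolding A[unfolded z_def] B[unfolded z_def] C[unfolded z_def] tn
    using P1 t \<open>q \<noteq> 0\<close> \<alpha> by (simp add: divide_simps z_def)
qed

text \<open>The counterpart for the inverse shift, where the numerators of the coefficient are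
  matched with G(x_i/t).\<close>

lemma kernel_minus:
  fixes x :: "nat \<Rightarrow> complex"
  assumes "i < n" and reg: "regular_point n q x" and t: "t \<noteq> 0" "t \<noteq> 1" and "q \<noteq> 0"
    and par: "\<And>z. (1 - a * z) * (1 - b * z) * (1 - c * z) * (1 - d * z) = (1 - \<beta> * z\<^sup>2) * (1 - q * \<beta> * z\<^sup>2)"
    and \<alpha>: "koornwinder_alpha a b c d q \<noteq> 0"
  shows "(1 - (x i)\<^sup>2) * (t - (x i)\<^sup>2) * koornwinder_minus n a b c d q t x i *
      poly (gen_poly n (x(i := x i / q))) (x i) =
    (1 - 1 / q) * t / (koornwinder_alpha a b c d q * (1 - t)) *
      (((x i)\<^sup>2 - \<beta>) * ((x i)\<^sup>2 - q * \<beta>) * (t ^ n * poly (gen_poly n x) (x i / t)))"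
proof -
  define z where "z = x i"
  have x0: "x j \<noteq> 0" if "j < n" for j using reg that by (simp add: regular_point_def)
  have z: "z \<noteq> 0" "z\<^sup>2 \<noteq> 1" "z\<^sup>2 \<noteq> q"
    using reg \<open>i < n\<close> by (auto simp: regular_point_def z_def)
  define P3 where "P3 = (\<Prod>j\<in>{..<n} - {i}. (1 - t * x j / z) * (1 - t / (z * x j)))"
  define P4 where "P4 = (\<Prod>j\<in>{..<n} - {i}. (1 - x j / z) * (1 - 1 / (z * x j)))"
  have "z * x j \<noteq> 1 \<and> z \<noteq> x j" if "j \<in> {..<n} - {i}" for j
    using reg \<open>i < n\<close> that by (auto simp: regular_point_def z_def)
  then have P4: "P4 \<noteq> 0" using x0 z by (auto simp: P4_def)
  have card: "card ({..<n} - {i}) = n - 1" using \<open>i < n\<close> by simp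
  have "poly (gen_poly n (x(i := x i / q))) z =
      (\<Prod>j<n. (1 - z * (x(i := x i / q)) j) * (1 - z / (x(i := x i / q)) j))"
    by (rule poly_gen_poly) (use x0 \<open>q \<noteq> 0\<close> in auto)
  also have "\<dots> = (1 - z\<^sup>2 / q) * (1 - q) *
      (\<Prod>j\<in>{..<n} - {i}. (1 - z * (x(i := x i / q)) j) * (1 - z / (x(i := x i / q)) j))"
    using \<open>i < n\<close> z \<open>q \<noteq> 0\<close> by (subst prod.remove[of _ i]) (auto simp: z_def power2_eq_square)
  \<comment> \<open>The coefficient is written in 1/z. Pulling z^2 out of every pair of factors
    matches the two forms; the same power of \<open>z\<close> arises from G(z/t), together with
    powers of 1/t that are offset by t^n.\<close>
  also have "(\<Prod>j\<in>{..<n} - {i}. (1 - z * (x(i := x i / q)) j) * (1 - z / (x(i := x i / q)) j)) =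
      (\<Prod>j\<in>{..<n} - {i}. z\<^sup>2 * ((1 - x j / z) * (1 - 1 / (z * x j))))"
    using x0 z by (intro prod.cong) (auto simp: field_simps power2_eq_square)
  also have "\<dots> = (z\<^sup>2) ^ (n - 1) * P4"
    unfolding P4_def by (simp add: prod.distrib card)
  finally have A: "poly (gen_poly n (x(i := x i / q))) z =
      (1 - z\<^sup>2 / q) * (1 - q) * ((z\<^sup>2) ^ (n - 1) * P4)" .
  have "poly (gen_poly n x) (z / t) = (\<Prod>j<n. (1 - z / t * x j) * (1 - z / t / x j))"
    by (rule poly_gen_poly) (use x0 in auto)
  also have "\<dots> = (1 - z\<^sup>2 / t) * (1 - 1 / t) *
      (\<Prod>j\<in>{..<n} - {i}. (1 - z / t * x j) * (1 - z / t / x j))"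
    using \<open>i < n\<close> z by (subst prod.remove[of _ i]) (auto simp: z_def power2_eq_square)
  also have "(\<Prod>j\<in>{..<n} - {i}. (1 - z / t * x j) * (1 - z / t / x j)) =
      (\<Prod>j\<in>{..<n} - {i}. z\<^sup>2 / t\<^sup>2 * ((1 - t * x j / z) * (1 - t / (z * x j))))"
    using x0 z t by (intro prod.cong) (auto simp: field_simps power2_eq_square)
  also have "\<dots> = (z\<^sup>2) ^ (n - 1) / (t ^ (n - 1) * t ^ (n - 1)) * P3"
    unfolding P3_def prod.distrib[of "\<lambda>_. z\<^sup>2 / t\<^sup>2"] prod_constant card power_divide
    by (simp add: power_mult[symmetric] power_add[symmetric] mult_2)
  finally have B: "poly (gen_poly n x) (z / t) = (1 - z\<^sup>2 / t) * (1 - 1 / t) *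
      ((z\<^sup>2) ^ (n - 1) / (t ^ (n - 1) * t ^ (n - 1)) * P3)" .
  have C: "koornwinder_minus n a b c d q t x i = (1 - \<beta> * (1 / z)\<^sup>2) * (1 - q * \<beta> * (1 / z)\<^sup>2) /
      (koornwinder_alpha a b c d q * t ^ (n - 1) * (1 - 1 / z\<^sup>2) * (1 - q / z\<^sup>2)) * (P3 / P4)"
    unfolding koornwinder_minus_def par[symmetric] P3_def P4_def z_def prod_dividef by simp
  have tn: "t ^ n = t * t ^ (n - 1)" using \<open>i < n\<close> by (cases n) auto
  define w where "w = z\<^sup>2"
  have w: "w \<noteq> 0" "1 - w \<noteq> 0" "w - 1 \<noteq> 0" "w - q \<noteq> 0" "1 - t \<noteq> 0" "w \<noteq> 1" "w \<noteq> q"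
    using z t by (auto simp: w_def)
  have C': "koornwinder_minus n a b c d q t x i = (w - \<beta>) * (w - q * \<beta>) /
      (koornwinder_alpha a b c d q * t ^ (n - 1) * (w - 1) * (w - q)) * (P3 / P4)"
    unfolding C power_divide w_def[symmetric] power_one using w by (simp add: divide_simps)
  have A': "poly (gen_poly n (x(i := x i / q))) z = (q - w) * (1 - q) / q * (w ^ (n - 1) * P4)"
    unfolding A w_def using \<open>q \<noteq> 0\<close> by (simp add: divide_simps)
  have B': "poly (gen_poly n x) (z / t) = (t - w) * (t - 1) / (t * t) *
      (w ^ (n - 1) / (t ^ (n - 1) * t ^ (n - 1)) * P3)"
    unfolding B w_def using t by (simp add: divide_simps)
  define T where "T = t ^ (n - 1)"
  define W where "W = w ^ (n - 1)"
  have TW: "T \<noteq> 0" "W \<noteq> 0" using t w by (auto simp: T_def W_def)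
  have "(1 - w) * (t - w) * ((w - \<beta>) * (w - q * \<beta>) /
      (koornwinder_alpha a b c d q * T * (w - 1) * (w - q)) * (P3 / P4)) *
      ((q - w) * (1 - q) / q * (W * P4)) =
    (1 - 1 / q) * t / (koornwinder_alpha a b c d q * (1 - t)) *
      ((w - \<beta>) * (w - q * \<beta>) * (t * T * ((t - w) * (t - 1) / (t * t) * (W / (T * T) * P3))))"
  proof -
    have "(1 - w) * (t - w) * ((w - \<beta>) * (w - q * \<beta>) /
      (koornwinder_alpha a b c d q * T * (w - 1) * (w - q)) * (P3 / P4)) *
      ((q - w) * (1 - q) / q * (W * P4)) =
      ((1 - w) / (w - 1)) * ((q - w) / (w - q)) * (P4 / P4) *
      ((t - w) * (w - \<beta>) * (w - q * \<beta>) * (1 - q) * W * P3 / (koornwinder_alpha a b c d q * T * q))"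
      by (simp add: divide_simps)
    also have "\<dots> = (t - w) * (w - \<beta>) * (w - q * \<beta>) * (1 - q) * W * P3 / (koornwinder_alpha a b c d q * T * q)"
    proof -
      have "(1 - w) / (w - 1) = -1" "(q - w) / (w - q) = -1" "P4 / P4 = 1"
        using w P4 by (simp_all add: divide_simps)
      then show ?thesis by simp
    qed
    also have "\<dots> = ((1 - q) / q) * (t * t / (t * t)) * (T / T) * ((t - 1) / (t - 1)) * ((t - w) * (w - \<beta>) * (w - q * \<beta>) * W * P3 /
       (koornwinder_alpha a b c d q * T))" using TW t by (simp add: mult_ac)
    also have "\<dots> = (1 - 1 / q) * t / (koornwinder_alpha a b c d q * (1 - t)) *
      ((w - \<beta>) * (w - q * \<beta>) * (t * T * ((t - w) * (t - 1) / (t * t) * (W / (T * T) * P3))))"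
    proof -
      have "(1 - 1 / q) / (1 - t) = ((1 - q) / q) / (t - 1)"
        using w t \<open>q \<noteq> 0\<close> by (simp add: divide_simps) (simp add: algebra_simps)
      moreover have "(1 - 1 / q) * t / (koornwinder_alpha a b c d q * (1 - t)) =
          ((1 - 1 / q) / (1 - t)) * t / koornwinder_alpha a b c d q"
        by (simp add: mult.commute)
      ultimately have "(1 - 1 / q) * t / (koornwinder_alpha a b c d q * (1 - t)) =
          (((1 - q) / q) / (t - 1)) * t / koornwinder_alpha a b c d q"
        by (simp only:)
      then show ?thesis by (simp only:) (simp add: mult_ac)
    qed
    finally show ?thesis .
  qed
  then show ?thesis
    using A'[unfolded z_def] B'[unfolded z_def] C' unfolding tn w_def z_def T_def W_def by simp
qed

text \<open>The operator in \<open>x\<close> applied to G(y), kept as a polynomial in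
  \<open>y\<close> so that an identity for it can be proved by counting zeros in
  \<open>y\<close>.\<close>

definition op_poly :: "nat \<Rightarrow> complex \<Rightarrow> complex \<Rightarrow> complex \<Rightarrow> complex \<Rightarrow> complex \<Rightarrow> complex \<Rightarrow>
    (nat \<Rightarrow> complex) \<Rightarrow> complex poly" where
  "op_poly n a b c d q t x =
     (\<Sum>i<n. smult (koornwinder_plus n a b c d q t x i)
        (gen_poly n (x(i := q * x i)) - gen_poly n x)) +
     (\<Sum>i<n. smult (koornwinder_minus n a b c d q t x i)
        (gen_poly n (x(i := x i / q)) - gen_poly n x))"

lemma coeff_op_poly:
  "coeff (op_poly n a b c d q t x) r = koornwinder_op n a b c d q t (\<lambda>x. coeff (gen_poly n x) r) x"
  by (simp add: op_poly_def koornwinder_op_eq coeff_sum)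

lemma degree_op_poly: "degree (op_poly n a b c d q t x) \<le> 2 * n"
  unfolding op_poly_def
  by (intro degree_add_le degree_sum_le finite_lessThan order.trans[OF degree_smult_le]
      degree_diff_le degree_gen_poly)

lemma op_poly_reflect:
  "y \<noteq> 0 \<Longrightarrow> poly (op_poly n a b c d q t x) (1 / y) = poly (op_poly n a b c d q t x) y / y ^ (2 * n)"
  by (simp add: op_poly_def poly_sum gen_poly_reflect sum_divide_distrib add_divide_distrib
      diff_divide_distrib[symmetric])

lemma poly_gen_poly_0: "poly (gen_poly n x) 0 = 1"
  by (simp add: esym_gen_def poly_prod)

lemma poly_op_poly_0: "poly (op_poly n a b c d q t x) 0 = 0"
  by (simp add: op_poly_def poly_sum poly_gen_poly_0)

text \<open>What the factors with j = i leave at y = x_i: 1 - 1/q from the shifted G(x_i), 1 - t in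
  the denominator from G(t x_i), and t from t^n against t^(n-1).\<close>

definition kernel_const :: "complex \<Rightarrow> complex \<Rightarrow> complex \<Rightarrow> complex" where
  "kernel_const \<alpha> q t = (1 - 1 / q) * t / (\<alpha> * (1 - t))"

text \<open>\<open>kernel_const * kernel_rhs\<close> is the Askey-Wilson operator in \<open>y\<close> applied to \<open>y\<^sup>-\<^sup>n G(y)\<close>, shifted so as
  to annihilate the constant term of \<open>G\<close>, with \<open>y\<^sup>-\<^sup>n\<close> and the denominators
  \<open>(1 - y\<^sup>2)(1 - ty\<^sup>2)(t - y\<^sup>2)\<close> cleared.\<close>

definition kernel_rhs :: "nat \<Rightarrow> complex \<Rightarrow> complex \<Rightarrow> complex \<Rightarrow> (complex \<Rightarrow> complex) \<Rightarrow> complex \<Rightarrow> complex" where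
  "kernel_rhs n \<beta> q t G y =
     (1 - \<beta> * y\<^sup>2) * (1 - q * \<beta> * y\<^sup>2) * (t - y\<^sup>2) * (G (t * y) / t ^ n - G y) +
     (y\<^sup>2 - \<beta>) * (y\<^sup>2 - q * \<beta>) * (1 - t * y\<^sup>2) * (t ^ n * G (y / t) - G y) -
     ((1 / t ^ n - 1) + q * \<beta>\<^sup>2 / t * (t ^ n - 1)) *
       ((1 - y\<^sup>2) * (1 - t * y\<^sup>2) * (t - y\<^sup>2) * G y)"

text \<open>Inverting \<open>y\<close> exchanges the terms in G(ty) and G(y/t), because G(t/y) is
  the reflection of G(y/t). Their coefficients are exchanged as well, up to the common factor
  -1/y^6.\<close>

lemma kernel_rhs_reflect:
  assumes G: "\<And>y. y \<noteq> 0 \<Longrightarrow> G (1 / y) = G y / y ^ (2 * n)" and y: "y \<noteq> 0" and t: "t \<noteq> 0"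
  shows "kernel_rhs n \<beta> q t G (1 / y) = - kernel_rhs n \<beta> q t G y / (y ^ (2 * n) * y ^ 6)"
proof -
  define Y where "Y = y ^ (2 * n)"
  define T where "T = t ^ n"
  define u where "u = y\<^sup>2"
  define \<kappa> where "\<kappa> = (1 / T - 1) + q * \<beta>\<^sup>2 / t * (T - 1)"
  have nz: "Y \<noteq> 0" "T \<noteq> 0" "u \<noteq> 0" using y t by (auto simp: Y_def T_def u_def)
  have "(1 / y)\<^sup>2 = 1 / u" by (simp add: u_def power_divide)
  have g0: "G (1 / y) = G y / Y" using G[OF y] by (simp add: Y_def)
  have "G (t * (1 / y)) = G (1 / (y / t))" using t by simp
  also have "\<dots> = G (y / t) / (y / t) ^ (2 * n)" using y t by (intro G) auto
  finally have g1: "G (t * (1 / y)) = T * T * G (y / t) / Y"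
    by (simp add: power_divide Y_def T_def power_add[symmetric] mult_2[symmetric])
  have "G (1 / y / t) = G (1 / (t * y))" by (simp add: mult.commute)
  also have "\<dots> = G (t * y) / (t * y) ^ (2 * n)" using y t by (intro G) auto
  finally have g2: "G (1 / y / t) = G (t * y) / (T * T * Y)"
    by (simp add: power_mult_distrib Y_def T_def power_add[symmetric] mult_2[symmetric])
  have y6: "y ^ 6 = u * u * u" by (simp add: u_def power2_eq_square eval_nat_numeral)
  have a: "(1 - \<beta> * (1 / u)) * (1 - q * \<beta> * (1 / u)) * (t - 1 / u) =
      - ((u - \<beta>) * (u - q * \<beta>) * (1 - t * u) / (u * u * u))"
    using nz by (simp add: divide_simps) (simp add: algebra_simps)
  have b: "(1 / u - \<beta>) * (1 / u - q * \<beta>) * (1 - t * (1 / u)) =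
      - ((1 - \<beta> * u) * (1 - q * \<beta> * u) * (t - u) / (u * u * u))"
    using nz by (simp add: divide_simps) (simp add: algebra_simps)
  have c: "(1 - 1 / u) * (1 - t * (1 / u)) * (t - 1 / u) =
      - ((1 - u) * (1 - t * u) * (t - u) / (u * u * u))"
    using nz by (simp add: divide_simps) (simp add: algebra_simps)
  have "T * T * G (y / t) / Y / T - G y / Y = (T * G (y / t) - G y) / Y"
    using nz by (simp add: divide_simps)
  moreover have "T * (G (t * y) / (T * T * Y)) - G y / Y = (G (t * y) / T - G y) / Y"
    using nz by (simp add: divide_simps)
  ultimately have "kernel_rhs n \<beta> q t G (1 / y) =
      - ((u - \<beta>) * (u - q * \<beta>) * (1 - t * u) / (u * u * u)) * ((T * G (y / t) - G y) / Y)
      + - ((1 - \<beta> * u) * (1 - q * \<beta> * u) * (t - u) / (u * u * u)) * ((G (t * y) / T - G y) / Y)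
      - \<kappa> * (- ((1 - u) * (1 - t * u) * (t - u) / (u * u * u)) * (G y / Y))"
    unfolding kernel_rhs_def g0 g1 g2 \<open>(1 / y)\<^sup>2 = 1 / u\<close> a b c T_def[symmetric] \<kappa>_def by (simp only:)
  also have "\<dots> = - kernel_rhs n \<beta> q t G y / (Y * (u * u * u))"
  proof -
    have lin: "- (p1 / v) * (w1 / Y) + - (p2 / v) * (w2 / Y) - \<kappa> * (- (p3 / v) * (g / Y)) =
        - (p2 * w2 + p1 * w1 - \<kappa> * (p3 * g)) / (Y * v)" for p1 p2 p3 w1 w2 v g
      by (simp add: add_divide_distrib diff_divide_distrib mult_ac)
    show ?thesis
      unfolding kernel_rhs_def T_def[symmetric] \<kappa>_def[symmetric] u_def[symmetric] lin ..
  qed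
  finally show ?thesis by (simp only: y6 Y_def)
qed

lemma card_torus_points:
  fixes x :: "nat \<Rightarrow> complex"
  assumes reg: "regular_point n q x"
  shows "card (x ` {..<n} \<union> (\<lambda>i. 1 / x i) ` {..<n}) = 2 * n"
proof -
  have nz: "x i \<noteq> 0" "(x i)\<^sup>2 \<noteq> 1" if "i < n" for i
    using reg that by (auto simp: regular_point_def)
  have ne: "x i \<noteq> x j" "x i * x j \<noteq> 1" if "i < n" "j < n" "i \<noteq> j" for i j
    using reg that by (auto simp: regular_point_def)
  have inj1: "inj_on x {..<n}" using ne(1) by (meson inj_onI lessThan_iff)
  have inj2: "inj_on (\<lambda>i. 1 / x i) {..<n}"
    using inj1 nz by (auto simp: inj_on_def)
  have "x i \<noteq> 1 / x j" if "i < n" "j < n" for i j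
  proof
    assume "x i = 1 / x j"
    then have "x i * x j = 1" using nz[OF that(2)] by simp
    then show False using ne(2)[OF that] nz(2)[OF that(1)] by (cases "i = j") (auto simp: power2_eq_square)
  qed
  then have "x ` {..<n} \<inter> (\<lambda>i. 1 / x i) ` {..<n} = {}" by blast
  then show ?thesis by (simp add: card_Un_disjoint card_image inj1 inj2)
qed

lemma degree_quads:
  "degree P \<le> m \<Longrightarrow> degree ([:a, 0, b:] * [:c, 0, d:] * [:e, 0, f:] * P :: complex poly) \<le> m + 6"
proof -
  assume P: "degree P \<le> m"
  have q: "degree [:u, 0, v:] \<le> 2" for u v :: complex by (simp add: degree_pCons_eq_if)
  have "degree ([:a, 0, b:] * [:c, 0, d:] * [:e, 0, f:] * P) \<le>
      degree [:a, 0, b:] + degree [:c, 0, d:] + degree [:e, 0, f:] + degree P"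
    by (intro order.trans[OF degree_mult_le] add_mono order.refl)
  then show ?thesis using q[of a b] q[of c d] q[of e f] P by linarith
qed

text \<open>The difference of both sides is a polynomial in \<open>y\<close> of degree at most \<open>2n + 6\<close> that vanishes at the
  \<open>2n + 7\<close> points \<open>0\<close>, \<open>\<plusminus>1\<close>, \<open>\<plusminus>\<surd>t\<close>, \<open>\<plusminus>1/\<surd>t\<close>, \<open>x\<^sub>i\<close>, \<open>1/x\<^sub>i\<close>.\<close>

lemma kernel_identity_generic:
  fixes x :: "nat \<Rightarrow> complex"
  assumes reg: "regular_point n q x" and t: "t \<noteq> 0" "t\<^sup>2 \<noteq> 1" and q: "q \<noteq> 0"
    and gen: "\<And>i. i < n \<Longrightarrow> (x i)\<^sup>2 \<noteq> t \<and> t * (x i)\<^sup>2 \<noteq> 1"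
    and par: "\<And>z. (1 - a * z) * (1 - b * z) * (1 - c * z) * (1 - d * z) = (1 - \<beta> * z\<^sup>2) * (1 - q * \<beta> * z\<^sup>2)"
    and \<alpha>: "koornwinder_alpha a b c d q \<noteq> 0"
  shows "(1 - y\<^sup>2) * (1 - t * y\<^sup>2) * (t - y\<^sup>2) * poly (op_poly n a b c d q t x) y =
     kernel_const (koornwinder_alpha a b c d q) q t * kernel_rhs n \<beta> q t (poly (gen_poly n x)) y"
proof -
  define k where "k = kernel_const (koornwinder_alpha a b c d q) q t"
  define G where "G = gen_poly n x"
  define D where "D = op_poly n a b c d q t x"
  define f where "f y = (1 - y\<^sup>2) * (1 - t * y\<^sup>2) * (t - y\<^sup>2) * poly D y - k * kernel_rhs n \<beta> q t (poly G) y" for y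
  \<comment> \<open>The polynomial in \<open>y\<close> with values \<open>f\<close>. The terms G(ty)
    and G(y/t) become compositions with linear polynomials, which keeps the degree visible.\<close>
  define p where "p = [:1,0,-1:] * [:1,0,-t:] * [:t,0,-1:] * D -
     smult k ([:1,0,-\<beta>:] * [:1,0,-(q*\<beta>):] * [:t,0,-1:] * (smult (1 / t ^ n) (G \<circ>\<^sub>p [:0, t:]) - G) +
       [:-\<beta>,0,1:] * [:-(q*\<beta>),0,1:] * [:1,0,-t:] * (smult (t ^ n) (G \<circ>\<^sub>p [:0, 1 / t:]) - G) -
       smult ((1 / t ^ n - 1) + q * \<beta>\<^sup>2 / t * (t ^ n - 1)) ([:1,0,-1:] * [:1,0,-t:] * [:t,0,-1:] * G))"
  have t1: "t \<noteq> 1" "t \<noteq> -1" using t by auto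
  have pf: "poly p y = f y" for y
  proof -
    have quad: "poly [:a, 0, b:] y = a + b * y\<^sup>2" and lin: "poly [:0, a:] y = a * y" for a b
      by (simp_all add: power2_eq_square)
    show ?thesis
      unfolding p_def f_def kernel_rhs_def poly_diff poly_mult poly_smult poly_add quad poly_pcompose lin
      by simp
  qed
  have Gdeg: "degree (G \<circ>\<^sub>p [:0, s:]) \<le> 2 * n" for s
    using degree_gen_poly[of n x] by (simp add: G_def degree_pcompose)
  have Gdeg0: "degree G \<le> 2 * n" using degree_gen_poly by (simp add: G_def)
  have "degree p \<le> 2 * n + 6"
    unfolding p_def
    by (intro degree_diff_le degree_add_le degree_quads order.trans[OF degree_smult_le] Gdeg Gdeg0)
       (simp add: D_def degree_op_poly)
  have f_reflect: "f (1 / y) = - f y / (y ^ (2 * n) * y ^ 6)" if "y \<noteq> 0" for y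
  proof -
    have u: "(1 / y)\<^sup>2 = 1 / y\<^sup>2" by (simp add: power_divide)
    have c: "(1 - 1 / y\<^sup>2) * (1 - t * (1 / y\<^sup>2)) * (t - 1 / y\<^sup>2) =
        - ((1 - y\<^sup>2) * (1 - t * y\<^sup>2) * (t - y\<^sup>2)) / y ^ 6"
      using that by (simp add: divide_simps) (simp add: algebra_simps eval_nat_numeral)
    have "poly D (1 / y) = poly D y / y ^ (2 * n)" using op_poly_reflect[OF that] by (simp add: D_def)
    moreover have "kernel_rhs n \<beta> q t (poly G) (1 / y) = - kernel_rhs n \<beta> q t (poly G) y / (y ^ (2 * n) * y ^ 6)"
      by (rule kernel_rhs_reflect) (use gen_poly_reflect that t in \<open>auto simp: G_def\<close>)
    ultimately show ?thesis unfolding f_def u c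
      by (simp add: diff_divide_distrib mult_ac)
  qed
  \<comment> \<open>At y = x_i the factor 1 - y/x_i annihilates G, also after a shift of any other
    variable. Only the two shifts of x_i survive, and \<open>kernel_plus\<close> and
    \<open>kernel_minus\<close> evaluate these.\<close>
  have root_x: "f (x i) = 0" if "i < n" for i
  proof -
    define z where "z = x i"
    have x0: "x j \<noteq> 0" if "j < n" for j using reg that by (simp add: regular_point_def)
    have z0: "z \<noteq> 0" using x0 \<open>i < n\<close> by (simp add: z_def)
    have G0: "poly G z = 0"
    proof -
      have "poly (gen_poly n x) z = (\<Prod>k<n. (1 - z * x k) * (1 - z / x k))"
        by (rule poly_gen_poly) (rule x0)
      also have "\<dots> = 0" using \<open>i < n\<close> z0 by (intro prod_zero) (auto simp: z_def)
      finally show ?thesis by (simp add: G_def)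
    qed
    have shift: "poly (gen_poly n (x(j := w))) z = 0" if "j < n" "j \<noteq> i" "w \<noteq> 0" for j w
    proof -
      have "poly (gen_poly n (x(j := w))) z =
          (\<Prod>k<n. (1 - z * (x(j := w)) k) * (1 - z / (x(j := w)) k))"
        by (rule poly_gen_poly) (use x0 that in auto)
      also have "\<dots> = 0" using \<open>i < n\<close> that z0 by (intro prod_zero) (auto simp: z_def)
      finally show ?thesis .
    qed
    have single: "(\<Sum>j<n. h j) = h i" if "\<And>j. j < n \<Longrightarrow> j \<noteq> i \<Longrightarrow> h j = 0" for h :: "nat \<Rightarrow> complex"
      using sum.remove[of "{..<n}" i h] \<open>i < n\<close> that by simp
    have "poly D z = koornwinder_plus n a b c d q t x i * poly (gen_poly n (x(i := q * x i))) z +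
        koornwinder_minus n a b c d q t x i * poly (gen_poly n (x(i := x i / q))) z"
      unfolding D_def op_poly_def poly_add poly_sum poly_smult poly_diff G_def[symmetric] G0
      by (subst single, use shift x0 q in simp)+ simp
    then have "(1 - z\<^sup>2) * (1 - t * z\<^sup>2) * (t - z\<^sup>2) * poly D z =
       (t - z\<^sup>2) * ((1 - z\<^sup>2) * (1 - t * z\<^sup>2) * koornwinder_plus n a b c d q t x i * poly (gen_poly n (x(i := q * x i))) z) +
       (1 - t * z\<^sup>2) * ((1 - z\<^sup>2) * (t - z\<^sup>2) * koornwinder_minus n a b c d q t x i * poly (gen_poly n (x(i := x i / q))) z)"
      by (simp add: algebra_simps)
    also have "\<dots> = (t - z\<^sup>2) * (k * ((1 - \<beta> * z\<^sup>2) * (1 - q * \<beta> * z\<^sup>2) * (poly G (t * z) / t ^ n))) +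
       (1 - t * z\<^sup>2) * (k * ((z\<^sup>2 - \<beta>) * (z\<^sup>2 - q * \<beta>) * (t ^ n * poly G (z / t))))"
      using kernel_plus[OF \<open>i < n\<close> reg t(1) t1(1) q par \<alpha>]
        kernel_minus[OF \<open>i < n\<close> reg t(1) t1(1) q par \<alpha>]
      by (simp only: z_def G_def k_def kernel_const_def)
    also have "\<dots> = k * kernel_rhs n \<beta> q t (poly G) z"
      unfolding kernel_rhs_def G0 by (simp add: distrib_left mult_ac)
    finally show ?thesis by (simp add: f_def z_def)
  qed
  have root_inv: "f (1 / y) = 0" if "f y = 0" "y \<noteq> 0" for y using f_reflect[OF that(2)] that(1) by simp
  have root_0: "f 0 = 0"
    using t by (simp add: f_def kernel_rhs_def D_def G_def poly_op_poly_0 poly_gen_poly_0)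
      (simp add: field_simps power2_eq_square)
  have G_inv: "poly G (1 / y) = poly G y / y ^ (2 * n)" if "y \<noteq> 0" for y
    using gen_poly_reflect[OF that] by (simp add: G_def)
  \<comment> \<open>Here y/t = 1/(ty), so by reflection the two shifted terms cancel, while the
    remaining terms contain 1 - y^2.\<close>
  have root_1: "f y = 0" if "y\<^sup>2 = 1" for y
  proof -
    have y0: "y \<noteq> 0" using that by auto
    moreover have "1 / y = y" using y0 that by (metis nonzero_eq_divide_eq power2_eq_square)
    ultimately have y: "y \<noteq> 0" "1 / y = y" .
    have "y / t = 1 / (t * y)" using y by (metis divide_divide_eq_left mult.commute)
    have "(t * y) ^ (2 * n) = (t\<^sup>2 * y\<^sup>2) ^ n" by (simp only: power_mult power_mult_distrib)
    also have "\<dots> = t ^ n * t ^ n" by (simp add: that power2_eq_square[of t] power_mult_distrib)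
    finally have pow: "(t * y) ^ (2 * n) = t ^ n * t ^ n" .
    have "poly G (y / t) = poly G (t * y) / (t ^ n * t ^ n)"
      unfolding \<open>y / t = 1 / (t * y)\<close>
      using G_inv[of "t * y"] y t pow by simp
    then show ?thesis
      using t by (simp add: f_def kernel_rhs_def that) (simp add: field_simps)
  qed
  \<comment> \<open>Only the term with G(y/t) lacks the factor t - y^2. It vanishes by reflection
    because y/t = 1/y.\<close>
  have root_t: "f y = 0" if "y\<^sup>2 = t" for y
  proof -
    have y: "y \<noteq> 0" using that t by auto
    have "y / t = 1 / y" unfolding that[symmetric] using y by (simp add: power2_eq_square)
    then have "poly G (y / t) = poly G y / t ^ n"
      using G_inv[OF y] that by (simp add: power_mult)
    then show ?thesis
      using t by (simp add: f_def kernel_rhs_def that)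
  qed
  define s where "s = csqrt t"
  have s: "s\<^sup>2 = t" "s \<noteq> 0" using t by (auto simp: s_def)
  define R where "R = x ` {..<n} \<union> (\<lambda>i. 1 / x i) ` {..<n}"
  define A where "A = {0, 1, -1, s, -s, 1 / s, -(1 / s)}"
  have sq: "(1 / s)\<^sup>2 = 1 / t" by (simp add: power_divide s)
  have s1: "s \<noteq> 1" "s \<noteq> -1" using s t1 by auto
  have s2: "1 / s \<noteq> 1" using s1 by simp
  have s3: "1 / s \<noteq> -1" using s1 by (metis divide_eq_minus_1_iff minus_minus)
  have s4: "s \<noteq> 1 / s" using s t1(1) by (auto simp: eq_divide_eq power2_eq_square)
  have "s \<noteq> -1 / s"
  proof
    assume "s = -1 / s"
    then have "s * s = -1" using s(2) by (metis nonzero_eq_divide_eq)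
    then show False using s(1) t1(2) by (simp add: power2_eq_square)
  qed
  then have s5: "s \<noteq> - (1 / s)" by simp
  have s6: "- s \<noteq> 1" using s1 by (metis minus_minus)
  have s7: "- (1 / s) \<noteq> 1" using s3 by (metis minus_minus)
  have s8: "- s \<noteq> 1 / s" using s5 by (metis minus_minus)
  have "card A = 7"
    unfolding A_def using s s1 s2 s3 s4 s5 s6 s7 s8 by (simp add: card_insert_if)
  have A_sq: "y = 0 \<or> y\<^sup>2 = 1 \<or> y\<^sup>2 = t \<or> t * y\<^sup>2 = 1" if "y \<in> A" for y
    using that s t sq by (auto simp: A_def)
  have "A \<inter> R = {}"
  proof -
    have "y \<notin> A" if "y \<in> R" for y
    proof
      assume "y \<in> A"
      from that obtain i where i: "i < n" "y = x i \<or> y = 1 / x i" by (auto simp: R_def)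
      have "x i \<noteq> 0" "(x i)\<^sup>2 \<noteq> 1" "(x i)\<^sup>2 \<noteq> t" "t * (x i)\<^sup>2 \<noteq> 1"
        using reg gen i by (auto simp: regular_point_def)
      moreover have "y \<noteq> 0" "y\<^sup>2 = (x i)\<^sup>2 \<or> y\<^sup>2 = 1 / (x i)\<^sup>2"
        using i(2) \<open>x i \<noteq> 0\<close> by (auto simp: power_divide)
      moreover have "(x i)\<^sup>2 = t" if "y\<^sup>2 * (x i)\<^sup>2 = 1" "t * y\<^sup>2 = 1"
        using that by (metis mult.assoc mult.left_neutral mult.right_neutral)
      ultimately show False using A_sq[OF \<open>y \<in> A\<close>] t by (auto simp: divide_eq_eq eq_divide_eq)
    qed
    then show ?thesis by blast
  qed
  moreover have "card R = 2 * n" unfolding R_def by (rule card_torus_points[OF reg])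
  moreover have "finite R" "finite A" by (auto simp: R_def A_def)
  ultimately have card: "card (A \<union> R) = 2 * n + 7" using \<open>card A = 7\<close> by (simp add: card_Un_disjoint)
  have "f y = 0" if "y \<in> A \<union> R" for y
    using that
  proof
    assume "y \<in> A"
    then consider "y = 0" | "y\<^sup>2 = 1" | "y\<^sup>2 = t" | "y \<noteq> 0" "t * y\<^sup>2 = 1" using A_sq by blast
    then show ?thesis
    proof cases
      case 4
      then have "(1 / y)\<^sup>2 = t" by (simp add: power_divide field_simps)
      from root_inv[OF root_t[OF this]] 4 show ?thesis by simp
    qed (use root_0 root_1 root_t in auto)
  next
    assume "y \<in> R"
    then show ?thesis using root_x root_inv reg by (auto simp: R_def regular_point_def)
  qed
  then have sub: "A \<union> R \<subseteq> {y. poly p y = 0}" by (auto simp: pf)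
  have "p = 0"
  proof (rule ccontr)
    assume "p \<noteq> 0"
    then have "card (A \<union> R) \<le> degree p"
      using card_mono[OF poly_roots_finite[OF \<open>p \<noteq> 0\<close>] sub] card_poly_roots_bound[OF \<open>p \<noteq> 0\<close>] by linarith
    then show False using card \<open>degree p \<le> 2 * n + 6\<close> by simp
  qed
  then have "f y = 0" using pf[of y] by simp
  then show ?thesis by (simp add: f_def k_def G_def D_def)
qed

lemma eventually_notin_finite: "finite F \<Longrightarrow> eventually (\<lambda>s. s \<notin> F) (at (t::'a::t1_space))"
proof -
  assume "finite F"
  then have "open (- (F - {t}))" by (intro open_Compl finite_imp_closed) auto
  then show ?thesis by (auto simp: eventually_at_topological intro!: exI[of _ "- (F - {t})"])
qed

text \<open>The points above are not distinct if \<open>x\<^sub>i\<^sup>2\<close> is \<open>t\<close> or \<open>1/t\<close>; these \<open>x\<close> are reached by letting \<open>t\<close> vary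
  with all other parameters fixed.\<close>

lemma kernel_identity:
  fixes x :: "nat \<Rightarrow> complex"
  assumes reg: "regular_point n q x" and t: "t \<noteq> 0" "t\<^sup>2 \<noteq> 1" and q: "q \<noteq> 0"
    and par: "\<And>z. (1 - a * z) * (1 - b * z) * (1 - c * z) * (1 - d * z) = (1 - \<beta> * z\<^sup>2) * (1 - q * \<beta> * z\<^sup>2)"
    and \<alpha>: "koornwinder_alpha a b c d q \<noteq> 0"
  shows "(1 - y\<^sup>2) * (1 - t * y\<^sup>2) * (t - y\<^sup>2) * poly (op_poly n a b c d q t x) y =
     kernel_const (koornwinder_alpha a b c d q) q t * kernel_rhs n \<beta> q t (poly (gen_poly n x)) y"
proof -
  define f where "f s = (1 - y\<^sup>2) * (1 - s * y\<^sup>2) * (s - y\<^sup>2) * poly (op_poly n a b c d q s x) y" for s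
  define g where "g s = kernel_const (koornwinder_alpha a b c d q) q s *
      kernel_rhs n \<beta> q s (poly (gen_poly n x)) y" for s
  \<comment> \<open>For a fixed regular point both sides are continuous in \<open>t\<close> away
    from 0 and 1, since alpha, like a, b, c, d and beta, does not vary with
    \<open>t\<close>.\<close>
  define S :: "complex set" where "S = - {0, 1}"
  have "open S" unfolding S_def by (intro open_Compl finite_imp_closed) auto
  have "t \<in> S" using t by (auto simp: S_def)
  have x: "x i \<noteq> 0" "1 - (x i)\<^sup>2 \<noteq> 0" "1 - q * (x i)\<^sup>2 \<noteq> 0"
    "1 - 1 / (x i)\<^sup>2 \<noteq> 0" "1 - q / (x i)\<^sup>2 \<noteq> 0" if "i < n" for i
    using reg that by (auto simp: regular_point_def)
  have xx: "1 - x i * x j \<noteq> 0" "1 - x i / x j \<noteq> 0" "1 - x j / x i \<noteq> 0" "1 - 1 / (x i * x j) \<noteq> 0"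
    if "i < n" "j \<in> {..<n} - {i}" for i j
    using reg that by (auto simp: regular_point_def)
  have pl: "continuous_on S (\<lambda>s. koornwinder_plus n a b c d q s x i)" if "i < n" for i
    unfolding koornwinder_plus_def
    by (intro continuous_intros) (use that x xx \<alpha> in \<open>auto simp: S_def\<close>)
  have mi: "continuous_on S (\<lambda>s. koornwinder_minus n a b c d q s x i)" if "i < n" for i
    unfolding koornwinder_minus_def
    by (intro continuous_intros) (use that x xx \<alpha> in \<open>auto simp: S_def\<close>)
  have "continuous_on S f"
    unfolding f_def op_poly_def poly_add poly_sum poly_smult
    by (intro continuous_intros pl mi) auto
  then have "isCont f t" using \<open>open S\<close> \<open>t \<in> S\<close> continuous_on_eq_continuous_at by blast
  have "continuous_on S g"
    unfolding g_def kernel_const_def kernel_rhs_def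
    by (intro continuous_intros) (use \<alpha> in \<open>auto simp: S_def\<close>)
  then have "isCont g t" using \<open>open S\<close> \<open>t \<in> S\<close> continuous_on_eq_continuous_at by blast
  define B where "B = {0, 1, -1} \<union> (\<lambda>i. (x i)\<^sup>2) ` {..<n} \<union> (\<lambda>i. 1 / (x i)\<^sup>2) ` {..<n}"
  have "eventually (\<lambda>s. s \<notin> B) (at t)" by (rule eventually_notin_finite) (simp add: B_def)
  then have "eventually (\<lambda>s. f s = g s) (at t)"
  proof eventually_elim
    case (elim s)
    have s: "s \<noteq> 0" "s\<^sup>2 \<noteq> 1" using elim by (auto simp: B_def power2_eq_1_iff)
    have "(x i)\<^sup>2 \<noteq> s \<and> s * (x i)\<^sup>2 \<noteq> 1" if "i < n" for i
    proof -
      have "s \<noteq> 1 / (x i)\<^sup>2" "s \<noteq> (x i)\<^sup>2" using elim that by (auto simp: B_def)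
      then show ?thesis using x(1)[OF that] by (auto simp: eq_divide_eq)
    qed
    then show ?case
      unfolding f_def g_def by (intro kernel_identity_generic[OF reg s q _ par \<alpha>])
  qed
  then have "f \<midarrow>t\<rightarrow> g t"
    using \<open>isCont g t\<close> unfolding isCont_def by (subst tendsto_cong)
  with \<open>isCont f t\<close> have "f t = g t" unfolding isCont_def by (rule LIM_unique)
  then show ?thesis by (simp add: f_def g_def)
qed

text \<open>The two shifted terms of \<open>kernel_rhs\<close> at y = 0 (with G(0) = 1), divided by
  t: the multiple of G(y) that is subtracted there.\<close>

definition kernel_shift :: "nat \<Rightarrow> complex \<Rightarrow> complex \<Rightarrow> complex \<Rightarrow> complex" where
  "kernel_shift n \<beta> q t = (1 / t ^ n - 1) + q * \<beta>\<^sup>2 / t * (t ^ n - 1)"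

text \<open>The first shifted term supplies the factor 1 - t y^2 and the second y^2 - t, so
  \<open>?Z\<close> divides every term. It is cancelled in the polynomial ring, without exceptions
  at its zeros.\<close>

lemma kernel_CC:
  fixes x :: "nat \<Rightarrow> complex"
  assumes reg: "regular_point n q x" and t: "t \<noteq> 0" "t\<^sup>2 \<noteq> 1" and q: "q \<noteq> 0"
    and par: "\<And>z. (1 - a * z) * (1 - b * z) * (1 - c * z) * (1 - d * z) = (1 - t * z\<^sup>2) * (1 - q * t * z\<^sup>2)"
    and \<alpha>: "koornwinder_alpha a b c d q \<noteq> 0"
  defines "G \<equiv> gen_poly n x"
  shows "[:1, 0, -1:] * op_poly n a b c d q t x =
     smult (kernel_const (koornwinder_alpha a b c d q) q t)
      ([:1, 0, -(q * t):] * (smult (1 / t ^ n) (G \<circ>\<^sub>p [:0, t:]) - G) +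
       [:q * t, 0, -1:] * (smult (t ^ n) (G \<circ>\<^sub>p [:0, 1 / t:]) - G) -
       smult (kernel_shift n t q t) ([:1, 0, -1:] * G))" (is "?L = ?R")
proof -
  let ?Z = "[:1, 0, - t:] * [:t, 0, -1:]"
  have ZLR: "?Z * ?L = ?Z * ?R"
  proof (rule poly_eq_poly_eq_iff[THEN iffD1] ext)+
    fix y :: complex
    have quad: "poly [:a, 0, b:] y = a + b * y\<^sup>2" and lin: "poly [:0, a:] y = a * y" for a b
      by (simp_all add: power2_eq_square mult_ac)
    have "poly (?Z * ?L) y = (1 - y\<^sup>2) * (1 - t * y\<^sup>2) * (t - y\<^sup>2) * poly (op_poly n a b c d q t x) y"
      unfolding poly_mult quad by simp
    also have "\<dots> = kernel_const (koornwinder_alpha a b c d q) q t *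
        kernel_rhs n t q t (poly (gen_poly n x)) y"
      by (rule kernel_identity[OF reg t q _ \<alpha>]) (rule par)
    also have "\<dots> = poly (?Z * ?R) y"
    proof -
      define k where "k = kernel_const (koornwinder_alpha a b c d q) q t"
      define A where "A = poly G (t * y) / t ^ n - poly G y"
      define B where "B = t ^ n * poly G (y / t) - poly G y"
      define K where "K = kernel_shift n t q t"
      have e1: "k * kernel_rhs n t q t (poly (gen_poly n x)) y =
         k * ((1 - t * y\<^sup>2) * (1 - q * t * y\<^sup>2) * (t - y\<^sup>2) * A +
           (y\<^sup>2 - t) * (y\<^sup>2 - q * t) * (1 - t * y\<^sup>2) * B - K * ((1 - y\<^sup>2) * (1 - t * y\<^sup>2) * (t - y\<^sup>2) * poly G y))"
        by (simp add: kernel_rhs_def A_def B_def K_def kernel_shift_def G_def)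
      have e2: "poly (?Z * ?R) y = (1 - t * y\<^sup>2) * (t - y\<^sup>2) * (k * ((1 - q * t * y\<^sup>2) * A +
           (q * t - y\<^sup>2) * B - K * ((1 - y\<^sup>2) * poly G y)))"
        unfolding poly_diff poly_mult poly_smult poly_add quad poly_pcompose lin
        by (simp add: k_def A_def B_def K_def)
      have e3: "k * ((1 - t * y\<^sup>2) * (1 - q * t * y\<^sup>2) * (t - y\<^sup>2) * A +
           (y\<^sup>2 - t) * (y\<^sup>2 - q * t) * (1 - t * y\<^sup>2) * B - K * ((1 - y\<^sup>2) * (1 - t * y\<^sup>2) * (t - y\<^sup>2) * poly G y)) =
         (1 - t * y\<^sup>2) * (t - y\<^sup>2) * (k * ((1 - q * t * y\<^sup>2) * A +
           (q * t - y\<^sup>2) * B - K * ((1 - y\<^sup>2) * poly G y)))"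
        by (simp add: algebra_simps)
      show ?thesis using e1 e2 e3 unfolding k_def by (simp only:)
    qed
    finally show "poly (?Z * ?L) y = poly (?Z * ?R) y" .
  qed
  have "?Z \<noteq> 0" using t by simp
  then show ?thesis using ZLR by (rule mult_left_cancel[THEN iffD1])
qed

text \<open>Here 1 - y^2 and y^2 - 1 in the numerators cancel the first denominator, and the two
  denominators containing t stay on the left.\<close>

lemma kernel_DD:
  fixes x :: "nat \<Rightarrow> complex"
  assumes reg: "regular_point n q x" and t: "t \<noteq> 0" "t\<^sup>2 \<noteq> 1" and q: "q \<noteq> 0"
    and par: "\<And>z. (1 - a * z) * (1 - b * z) * (1 - c * z) * (1 - d * z) = (1 - z\<^sup>2) * (1 - q * z\<^sup>2)"
    and \<alpha>: "koornwinder_alpha a b c d q \<noteq> 0"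
  defines "G \<equiv> gen_poly n x"
  shows "[:1, 0, -t:] * ([:t, 0, -1:] * op_poly n a b c d q t x) =
     smult (kernel_const (koornwinder_alpha a b c d q) q t)
      ([:1, 0, -q:] * ([:t, 0, -1:] * (smult (1 / t ^ n) (G \<circ>\<^sub>p [:0, t:]) - G)) +
       [:q, 0, -1:] * ([:1, 0, -t:] * (smult (t ^ n) (G \<circ>\<^sub>p [:0, 1 / t:]) - G)) -
       smult (kernel_shift n 1 q t) ([:1, 0, -t:] * ([:t, 0, -1:] * G)))" (is "?L = ?R")
proof -
  let ?Z = "[:1, 0, - 1:] :: complex poly"
  have ZLR: "?Z * ?L = ?Z * ?R"
  proof (rule poly_eq_poly_eq_iff[THEN iffD1] ext)+
    fix y :: complex
    have quad: "poly [:a, 0, b:] y = a + b * y\<^sup>2" and lin: "poly [:0, a:] y = a * y" for a b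
      by (simp_all add: power2_eq_square mult_ac)
    have "poly (?Z * ?L) y = (1 - y\<^sup>2) * (1 - t * y\<^sup>2) * (t - y\<^sup>2) * poly (op_poly n a b c d q t x) y"
      unfolding poly_mult quad by simp
    also have "\<dots> = kernel_const (koornwinder_alpha a b c d q) q t *
        kernel_rhs n 1 q t (poly (gen_poly n x)) y"
      by (rule kernel_identity[OF reg t q _ \<alpha>]) (simp add: par)
    also have "\<dots> = poly (?Z * ?R) y"
    proof -
      define k where "k = kernel_const (koornwinder_alpha a b c d q) q t"
      define A where "A = poly G (t * y) / t ^ n - poly G y"
      define B where "B = t ^ n * poly G (y / t) - poly G y"
      define K where "K = kernel_shift n 1 q t"
      have e1: "k * kernel_rhs n 1 q t (poly (gen_poly n x)) y =
         k * ((1 - y\<^sup>2) * (1 - q * y\<^sup>2) * (t - y\<^sup>2) * A +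
           (y\<^sup>2 - 1) * (y\<^sup>2 - q) * (1 - t * y\<^sup>2) * B - K * ((1 - y\<^sup>2) * (1 - t * y\<^sup>2) * (t - y\<^sup>2) * poly G y))"
        by (simp add: kernel_rhs_def A_def B_def K_def kernel_shift_def G_def)
      have e2: "poly (?Z * ?R) y = (1 - y\<^sup>2) * (k * ((1 - q * y\<^sup>2) * ((t - y\<^sup>2) * A) +
           (q - y\<^sup>2) * ((1 - t * y\<^sup>2) * B) - K * ((1 - t * y\<^sup>2) * ((t - y\<^sup>2) * poly G y))))"
        unfolding poly_diff poly_mult poly_smult poly_add quad poly_pcompose lin
        by (simp add: k_def A_def B_def K_def)
      have e3: "k * ((1 - y\<^sup>2) * (1 - q * y\<^sup>2) * (t - y\<^sup>2) * A +
           (y\<^sup>2 - 1) * (y\<^sup>2 - q) * (1 - t * y\<^sup>2) * B - K * ((1 - y\<^sup>2) * (1 - t * y\<^sup>2) * (t - y\<^sup>2) * poly G y)) =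
         (1 - y\<^sup>2) * (k * ((1 - q * y\<^sup>2) * ((t - y\<^sup>2) * A) +
           (q - y\<^sup>2) * ((1 - t * y\<^sup>2) * B) - K * ((1 - t * y\<^sup>2) * ((t - y\<^sup>2) * poly G y))))"
        by (simp add: algebra_simps)
      show ?thesis using e1 e2 e3 unfolding k_def by (simp only:)
    qed
    finally show "poly (?Z * ?L) y = poly (?Z * ?R) y" .
  qed
  have "?Z \<noteq> 0" by simp
  then show ?thesis using ZLR by (rule mult_left_cancel[THEN iffD1])
qed

subsection \<open>Recurrences for the action on the polynomials E\<close>

definition E_fun :: "nat \<Rightarrow> nat \<Rightarrow> (nat \<Rightarrow> complex) \<Rightarrow> complex" where
  "E_fun n r x = (-1) ^ r * coeff (gen_poly n x) r"

text \<open>Both sides are expanded in the e_s(x + 1/x), so the equation holds at every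
  \<open>x\<close>. As an equality of functions it can be substituted inside the operator, which
  evaluates at shifted points.\<close>

lemma leval_E_poly: "leval (E_poly n r) = E_fun n r"
proof
  fix x
  show "leval (E_poly n r) x = E_fun n r x"
    by (simp add: E_fun_def E_poly_eq_esym_gen coeff_esym_gen leval_sum lconst_of_nat[symmetric]
        leval_lconst_mult leval_esym del: lconst_of_nat)
qed

lemma coeff_op_poly_E_fun:
  "coeff (op_poly n a b c d q t x) r = (-1) ^ r * koornwinder_op n a b c d q t (E_fun n r) x"
proof -
  have "coeff (gen_poly n x) r = (-1) ^ r * E_fun n r x" for x
    by (simp add: E_fun_def flip: power_add mult.assoc)
  then show ?thesis
    using koornwinder_op_sum[of n a b c d q t "\<lambda>_. (-1) ^ r" "\<lambda>_. E_fun n r" "{()}" x]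
    by (simp add: coeff_op_poly)
qed

text \<open>The coefficient with which y^r is reproduced by the kernel identity: t^r/t^n stems from
  G(ty), t^n/t^r from G(y/t). For alpha^2 = beta^2 it is d_(1^r), see
  \<open>koornwinder_eigenvalue_one_column\<close>.\<close>

definition eigen :: "nat \<Rightarrow> complex \<Rightarrow> complex \<Rightarrow> complex \<Rightarrow> complex \<Rightarrow> nat \<Rightarrow> complex" where
  "eigen n \<alpha> \<beta> q t r = kernel_const \<alpha> q t *
     ((t ^ r / t ^ n - 1) + q * \<beta>\<^sup>2 / t * (t ^ n / t ^ r - 1) - kernel_shift n \<beta> q t)"

text \<open>\<open>X r\<close> is the defect of E_r. In the coefficients of the kernel identity the
  constant terms of the quadratic factors produce the eigenvalue; their y^2 terms bring in the index
  lower by two, which does not exist for the first two coefficients.\<close>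

lemma recurrence_CC:
  fixes x :: "nat \<Rightarrow> complex"
  assumes reg: "regular_point n q x" and t: "t \<noteq> 0" "t\<^sup>2 \<noteq> 1" and q: "q \<noteq> 0"
    and par: "\<And>z. (1 - a * z) * (1 - b * z) * (1 - c * z) * (1 - d * z) = (1 - t * z\<^sup>2) * (1 - q * t * z\<^sup>2)"
    and \<alpha>: "koornwinder_alpha a b c d q \<noteq> 0"
  defines "\<alpha> \<equiv> koornwinder_alpha a b c d q"
  defines "X \<equiv> \<lambda>r. koornwinder_op n a b c d q t (E_fun n r) x - eigen n \<alpha> t q t r * E_fun n r x"
  shows "r < 2 \<Longrightarrow> X r = 0"
    and "X (r + 2) = X r + kernel_const \<alpha> q t * (1 - q * t) * (t ^ r / t ^ n - t ^ n / t ^ r) * E_fun n r x"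
proof -
  define D where "D = op_poly n a b c d q t x"
  define G where "G = gen_poly n x"
  define k where "k = kernel_const \<alpha> q t"
  have g: "coeff G r = (-1) ^ r * E_fun n r x" for r
    by (simp add: E_fun_def G_def flip: power_add mult.assoc)
  have dd: "coeff D r = (-1) ^ r * koornwinder_op n a b c d q t (E_fun n r) x" for r
    by (simp add: D_def coeff_op_poly_E_fun)
  have main: "[:1, 0, -1:] * D = smult k
      ([:1, 0, -(q * t):] * (smult (1 / t ^ n) (G \<circ>\<^sub>p [:0, t:]) - G) +
       [:q * t, 0, -1:] * (smult (t ^ n) (G \<circ>\<^sub>p [:0, 1 / t:]) - G) -
       smult (kernel_shift n t q t) ([:1, 0, -1:] * G))"
    unfolding D_def G_def k_def \<alpha>_def by (rule kernel_CC[OF reg t q _ \<alpha>]) (rule par)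
  have eq2: "q * t\<^sup>2 / t = q * t" using t by (simp add: power2_eq_square)
  {
    assume "r < 2"
    then have "r = 0 \<or> r = 1" by auto
    then show "X r = 0"
      using arg_cong[OF main, of "\<lambda>p. coeff p r"] t
      by (auto simp: X_def eigen_def g dd coeff_pCons coeff_pcompose_linear k_def eq2 algebra_simps)
  }
  have L: "coeff ([:1, 0, -1:] * D) (Suc (Suc r)) = coeff D (Suc (Suc r)) - coeff D r"
    by simp
  have R: "coeff (smult k
      ([:1, 0, -(q * t):] * (smult (1 / t ^ n) (G \<circ>\<^sub>p [:0, t:]) - G) +
       [:q * t, 0, -1:] * (smult (t ^ n) (G \<circ>\<^sub>p [:0, 1 / t:]) - G) -
       smult (kernel_shift n t q t) ([:1, 0, -1:] * G))) (Suc (Suc r)) =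
    k * ((t ^ Suc (Suc r) / t ^ n - 1) * coeff G (Suc (Suc r)) - q * t * ((t ^ r / t ^ n - 1) * coeff G r) +
      q * t * ((t ^ n / t ^ Suc (Suc r) - 1) * coeff G (Suc (Suc r))) - (t ^ n / t ^ r - 1) * coeff G r
      - kernel_shift n t q t * (coeff G (Suc (Suc r)) - coeff G r))"
    by (simp add: coeff_pcompose_linear power_divide algebra_simps)
  note main_coeff = arg_cong[OF main, of "\<lambda>p. coeff p (Suc (Suc r))"]
  have main2: "coeff D (Suc (Suc r)) - coeff D r =
    k * ((t ^ Suc (Suc r) / t ^ n - 1) * coeff G (Suc (Suc r)) - q * t * ((t ^ r / t ^ n - 1) * coeff G r) +
      q * t * ((t ^ n / t ^ Suc (Suc r) - 1) * coeff G (Suc (Suc r))) - (t ^ n / t ^ r - 1) * coeff G r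
      - kernel_shift n t q t * (coeff G (Suc (Suc r)) - coeff G r))"
    by (rule trans[OF L[symmetric] trans[OF main_coeff R]])
  define e2 where "e2 = E_fun n (Suc (Suc r)) x"
  define e0 where "e0 = E_fun n r x"
  define o2 where "o2 = koornwinder_op n a b c d q t (E_fun n (Suc (Suc r))) x"
  define o0 where "o0 = koornwinder_op n a b c d q t (E_fun n r) x"
  define s2 where "s2 = t ^ Suc (Suc r) / t ^ n"
  define s2' where "s2' = t ^ n / t ^ Suc (Suc r)"
  define s0 where "s0 = t ^ r / t ^ n"
  define s0' where "s0' = t ^ n / t ^ r"
  define K where "K = kernel_shift n t q t"
  have "(-1) ^ r * (o2 - o0) = (-1) ^ r * (k * ((s2 - 1) * e2 - q * t * ((s0 - 1) * e0) +
      q * t * ((s2' - 1) * e2) - (s0' - 1) * e0 - K * (e2 - e0)))"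
    using main2 unfolding g dd power_Suc
      e2_def[symmetric] e0_def[symmetric] o2_def[symmetric] o0_def[symmetric]
      s2_def[unfolded power_Suc, symmetric] s2'_def[unfolded power_Suc, symmetric] s0_def[symmetric] s0'_def[symmetric] K_def[symmetric]
    by (simp add: algebra_simps)
  then have "o2 - o0 = k * ((s2 - 1) * e2 - q * t * ((s0 - 1) * e0) +
      q * t * ((s2' - 1) * e2) - (s0' - 1) * e0 - K * (e2 - e0))" by simp
  then show "X (r + 2) = X r + kernel_const \<alpha> q t * (1 - q * t) * (t ^ r / t ^ n - t ^ n / t ^ r) * E_fun n r x"
    unfolding X_def eigen_def eq2 add_2_eq_Suc'
      e2_def[symmetric] e0_def[symmetric] o2_def[symmetric] o0_def[symmetric]
      s2_def[symmetric] s2'_def[symmetric] s0_def[symmetric] s0'_def[symmetric] K_def[symmetric] k_def[symmetric]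
    by (simp add: algebra_simps)
qed

lemma coeff_two_quads:
  fixes p :: "complex poly"
  shows "r < 2 \<Longrightarrow> coeff ([:a, 0, b:] * ([:c, 0, d:] * p)) r = a * c * coeff p r"
    and "r < 2 \<Longrightarrow> coeff ([:a, 0, b:] * ([:c, 0, d:] * p)) (r + 2) =
      a * c * coeff p (r + 2) + (a * d + b * c) * coeff p r"
    and "coeff ([:a, 0, b:] * ([:c, 0, d:] * p)) (r + 4) =
      a * c * coeff p (r + 4) + (a * d + b * c) * coeff p (r + 2) + b * d * coeff p r"
proof -
  have quad: "coeff ([:u, 0, v:] * h) m = u * coeff h m + (if m < 2 then 0 else v * coeff h (m - 2))"
    for u v and h :: "complex poly" and m
  proof (cases "m < 2")
    case True
    then have "m = 0 \<or> m = 1" by auto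
    then show ?thesis by (auto simp: coeff_pCons)
  next
    case False
    then obtain m' where "m = Suc (Suc m')" by (metis add_2_eq_Suc le_Suc_ex not_le)
    then show ?thesis by simp
  qed
  show "r < 2 \<Longrightarrow> coeff ([:a, 0, b:] * ([:c, 0, d:] * p)) r = a * c * coeff p r"
    by (simp only: quad) simp
  show "r < 2 \<Longrightarrow> coeff ([:a, 0, b:] * ([:c, 0, d:] * p)) (r + 2) =
      a * c * coeff p (r + 2) + (a * d + b * c) * coeff p r"
    by (simp only: quad) (simp add: algebra_simps)
  show "coeff ([:a, 0, b:] * ([:c, 0, d:] * p)) (r + 4) =
      a * c * coeff p (r + 4) + (a * d + b * c) * coeff p (r + 2) + b * d * coeff p r"
    by (simp only: quad) (simp add: algebra_simps)
qed

text \<open>The weights of the defects are the coefficients of (1 - t y^2)(t - y^2) = t - (1 + t^2)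
  y^2 + t y^4. \<open>s\<close> and \<open>s'\<close> are the factors by which G(ty)/t^n and t^n
  G(y/t) scale y^r, and \<open>P\<close> is what remains with the middle E after the eigenvalue has
  been subtracted.\<close>

lemma three_term_DD:
  fixes x :: "nat \<Rightarrow> complex"
  assumes reg: "regular_point n q x" and t: "t \<noteq> 0" "t\<^sup>2 \<noteq> 1" and q: "q \<noteq> 0"
    and par: "\<And>z. (1 - a * z) * (1 - b * z) * (1 - c * z) * (1 - d * z) = (1 - z\<^sup>2) * (1 - q * z\<^sup>2)"
    and \<alpha>: "koornwinder_alpha a b c d q \<noteq> 0"
  defines "k \<equiv> kernel_const (koornwinder_alpha a b c d q) q t"
  defines "X \<equiv> \<lambda>r. koornwinder_op n a b c d q t (E_fun n r) x -
    eigen n (koornwinder_alpha a b c d q) 1 q t r * E_fun n r x"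
  defines "s \<equiv> \<lambda>r. t ^ r / t ^ n" and "s' \<equiv> \<lambda>r. t ^ n / t ^ r"
  defines "P \<equiv> \<lambda>r. k * ((1 + t\<^sup>2) * ((s r - 1) + q / t * (s' r - 1)) - (1 + q * t) * (s r + s' r - 2))"
  shows "r < 2 \<Longrightarrow> X r = 0"
    and "r < 2 \<Longrightarrow> t * X (r + 2) = P r * E_fun n r x"
    and "t * X (r + 4) = (1 + t\<^sup>2) * X (r + 2) - t * X r + P (r + 2) * E_fun n (r + 2) x +
      k * (t - q) * (s' r - s r) * E_fun n r x"
proof -
  define D where "D = op_poly n a b c d q t x"
  define G where "G = gen_poly n x"
  define A where "A = smult (1 / t ^ n) (G \<circ>\<^sub>p [:0, t:]) - G"
  define B where "B = smult (t ^ n) (G \<circ>\<^sub>p [:0, 1 / t:]) - G"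
  define e where "e r = E_fun n r x" for r
  define dv where "dv r = koornwinder_op n a b c d q t (E_fun n r) x" for r
  define K where "K = kernel_shift n 1 q t"
  have g: "coeff G r = (-1) ^ r * e r" for r
    by (simp add: E_fun_def G_def e_def flip: power_add mult.assoc)
  have dd: "coeff D r = (-1) ^ r * dv r" for r
    by (simp add: D_def coeff_op_poly_E_fun dv_def)
  have A: "coeff A r = (-1) ^ r * ((s r - 1) * e r)" for r
    unfolding A_def coeff_diff coeff_smult coeff_pcompose_linear g s_def by (simp add: algebra_simps)
  have B: "coeff B r = (-1) ^ r * ((s' r - 1) * e r)" for r
    unfolding B_def coeff_diff coeff_smult coeff_pcompose_linear g s'_def
    by (simp add: algebra_simps power_divide)
  have main: "[:1, 0, -t:] * ([:t, 0, -1:] * D) =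
     smult k ([:1, 0, -q:] * ([:t, 0, -1:] * A) + [:q, 0, -1:] * ([:1, 0, -t:] * B) -
       smult K ([:1, 0, -t:] * ([:t, 0, -1:] * G)))"
    unfolding D_def G_def A_def B_def k_def K_def by (rule kernel_DD[OF reg t q _ \<alpha>]) (rule par)
  define w where "w = q / t"
  have tw: "t * w = q" using t by (simp add: w_def)
  have X: "X r = dv r - k * ((s r - 1) + w * (s' r - 1) - K) * e r" for r
    unfolding X_def dv_def eigen_def k_def s_def s'_def K_def e_def w_def by simp
  have "s r + s' r - 2 = (s r - 1) + (s' r - 1)" for r by simp
  then have P: "P r = k * ((1 + t\<^sup>2) * ((s r - 1) + w * (s' r - 1)) -
      (1 + q * t) * ((s r - 1) + (s' r - 1)))" for r
    unfolding P_def w_def by simp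
  have sgn: "(-1) ^ (r + 2) = ((-1) ^ r :: complex)" "(-1) ^ (r + 4) = ((-1) ^ r :: complex)"
    by (simp_all add: power_add)
  {
    assume r: "r < 2"
    have "(-1) ^ r * (t * dv r) = (-1) ^ r * (k * (t * ((s r - 1) * e r) + q * ((s' r - 1) * e r) - K * (t * e r)))"
      using arg_cong[OF main, of "\<lambda>p. coeff p r"]
      unfolding coeff_smult coeff_diff coeff_add coeff_two_quads(1)[OF r] A B g dd
      by (simp add: algebra_simps)
    then have "t * dv r = k * (t * ((s r - 1) * e r) + t * w * ((s' r - 1) * e r) - K * (t * e r))"
      unfolding tw by simp
    then have "t * X r = 0" unfolding X by (simp add: algebra_simps)
    then show X0: "X r = 0" using t by simp
    have "(-1) ^ r * (t * dv (r + 2) - (1 + t\<^sup>2) * dv r) = (-1) ^ r * (k * (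
        t * ((s (r+2) - 1) * e (r+2)) - (1 + q * t) * ((s r - 1) * e r) +
        q * ((s' (r+2) - 1) * e (r+2)) - (1 + q * t) * ((s' r - 1) * e r)
        - K * (t * e (r+2) - (1 + t\<^sup>2) * e r)))"
      using arg_cong[OF main, of "\<lambda>p. coeff p (r + 2)"]
      unfolding coeff_smult coeff_diff coeff_add coeff_two_quads(2)[OF r] A B g dd sgn
      by (simp add: algebra_simps power2_eq_square)
    then have "t * dv (r + 2) - (1 + t\<^sup>2) * dv r = k * (
        t * ((s (r+2) - 1) * e (r+2)) - (1 + q * t) * ((s r - 1) * e r) +
        t * w * ((s' (r+2) - 1) * e (r+2)) - (1 + q * t) * ((s' r - 1) * e r)
        - K * (t * e (r+2) - (1 + t\<^sup>2) * e r))"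
      unfolding tw by simp
    moreover have "t * X (r + 2) - (1 + t\<^sup>2) * X r =
        t * dv (r + 2) - (1 + t\<^sup>2) * dv r - k * (t * ((s (r+2) - 1) + w * (s' (r+2) - 1) - K) * e (r+2)
          - (1 + t\<^sup>2) * ((s r - 1) + w * (s' r - 1) - K) * e r)"
      unfolding X by (simp only: ring_distribs mult_ac) (simp add: algebra_simps)
    ultimately show "t * X (r + 2) = P r * E_fun n r x"
      unfolding X0 P e_def[symmetric] by (simp add: ring_distribs mult_ac)
  }
  have "(-1) ^ r * (t * dv (r + 4) - (1 + t\<^sup>2) * dv (r + 2) + t * dv r) = (-1) ^ r * (k * (
        t * ((s (r+4) - 1) * e (r+4)) - (1 + q * t) * ((s (r+2) - 1) * e (r+2)) + q * ((s r - 1) * e r) +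
        q * ((s' (r+4) - 1) * e (r+4)) - (1 + q * t) * ((s' (r+2) - 1) * e (r+2)) + t * ((s' r - 1) * e r)
        - K * (t * e (r+4) - (1 + t\<^sup>2) * e (r+2) + t * e r)))"
    using arg_cong[OF main, of "\<lambda>p. coeff p (r + 4)"]
    unfolding coeff_smult coeff_diff coeff_add coeff_two_quads(3) A B g dd sgn
    by (simp add: algebra_simps power2_eq_square)
  then have dv: "t * dv (r + 4) - (1 + t\<^sup>2) * dv (r + 2) + t * dv r = k * (
        t * ((s (r+4) - 1) * e (r+4)) - (1 + q * t) * ((s (r+2) - 1) * e (r+2)) + t * w * ((s r - 1) * e r) +
        t * w * ((s' (r+4) - 1) * e (r+4)) - (1 + q * t) * ((s' (r+2) - 1) * e (r+2)) + t * ((s' r - 1) * e r)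
        - K * (t * e (r+4) - (1 + t\<^sup>2) * e (r+2) + t * e r))"
    unfolding tw by simp
  have X4: "t * X (r + 4) - (1 + t\<^sup>2) * X (r + 2) + t * X r =
      t * dv (r + 4) - (1 + t\<^sup>2) * dv (r + 2) + t * dv r -
      k * (t * ((s (r+4) - 1) + w * (s' (r+4) - 1) - K) * e (r+4)
          - (1 + t\<^sup>2) * ((s (r+2) - 1) + w * (s' (r+2) - 1) - K) * e (r+2)
          + t * ((s r - 1) + w * (s' r - 1) - K) * e r)"
    unfolding X by (simp only: ring_distribs mult_ac) (simp add: algebra_simps)
  have "k * (t * ((s4 - 1) * e4) - (1 + q * t) * ((s2 - 1) * e2) + t * w * ((s0 - 1) * e0) +
        t * w * ((s4' - 1) * e4) - (1 + q * t) * ((s2' - 1) * e2) + t * ((s0' - 1) * e0)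
        - K * (t * e4 - (1 + t\<^sup>2) * e2 + t * e0)) -
      k * (t * ((s4 - 1) + w * (s4' - 1) - K) * e4 - (1 + t\<^sup>2) * ((s2 - 1) + w * (s2' - 1) - K) * e2
          + t * ((s0 - 1) + w * (s0' - 1) - K) * e0) =
      k * ((1 + t\<^sup>2) * ((s2 - 1) + w * (s2' - 1)) - (1 + q * t) * ((s2 - 1) + (s2' - 1))) * e2 +
      k * (t - t * w) * (s0' - s0) * e0" for s0 s0' s2 s2' s4 s4' e0 e2 e4 :: complex
    by (simp add: algebra_simps)
  then have "t * X (r + 4) - (1 + t\<^sup>2) * X (r + 2) + t * X r =
      P (r + 2) * e (r + 2) + k * (t - t * w) * (s' r - s r) * e r"
    unfolding X4 dv P .
  then have "t * X (r + 4) = (1 + t\<^sup>2) * X (r + 2) - t * X r + P (r + 2) * e (r + 2) +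
      k * (t - t * w) * (s' r - s r) * e r"
    by (metis (no_types, lifting) add_diff_cancel diff_add_eq diff_eq_eq add.assoc add.commute)
  then show "t * X (r + 4) = (1 + t\<^sup>2) * X (r + 2) - t * X r + P (r + 2) * E_fun n (r + 2) x +
      k * (t - q) * (s' r - s r) * E_fun n r x"
    unfolding tw e_def .
qed

lemma one_plus_power_nonzero:
  fixes t :: complex
  assumes "\<And>k::nat. k \<ge> 1 \<Longrightarrow> t ^ k \<noteq> 1"
  shows "1 + t ^ k \<noteq> 0"
proof
  assume "1 + t ^ k = 0"
  then have tk: "t ^ k = -1" by (simp add: add_eq_0_iff)
  then have "t ^ (k * 2) = 1" unfolding power_mult by simp
  then have "k = 0" using assms[of "k * 2"] by (cases k) auto
  with tk show False by simp
qed

text \<open>The three-term relation is inhomogeneous of second order, but the two-term relation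
  propagates through it: if it holds one step earlier, the terms with the lowest defect and the
  lowest E combine into a multiple of the middle defect. The vanishing of the first two defects
  starts the induction.\<close>

lemma recurrence_DD:
  fixes x :: "nat \<Rightarrow> complex"
  assumes reg: "regular_point n q x" and t: "t \<noteq> 0" "\<And>k::nat. k \<ge> 1 \<Longrightarrow> t ^ k \<noteq> 1" and q: "q \<noteq> 0"
    and par: "\<And>z. (1 - a * z) * (1 - b * z) * (1 - c * z) * (1 - d * z) = (1 - z\<^sup>2) * (1 - q * z\<^sup>2)"
    and \<alpha>: "koornwinder_alpha a b c d q \<noteq> 0"
  defines "k \<equiv> kernel_const (koornwinder_alpha a b c d q) q t"
  defines "X \<equiv> \<lambda>r. koornwinder_op n a b c d q t (E_fun n r) x -
    eigen n (koornwinder_alpha a b c d q) 1 q t r * E_fun n r x"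
  assumes "r + 2 \<le> n"
  defines "u \<equiv> t ^ n / t ^ (r + 2)"
  shows "X (r + 2) = t * (1 + u) / (1 + u * t\<^sup>2) * X r +
    k * (1 - q / t) * (1 + u) * (1 / (t * u) - t) * E_fun n r x"
  using \<open>r + 2 \<le> n\<close> unfolding u_def
proof (induction r rule: less_induct)
  case (less r)
  have t2: "t\<^sup>2 \<noteq> 1" using t(2)[of 2] by simp
  have T1: "X r = 0" if "r < 2" for r
    unfolding X_def by (rule three_term_DD(1)[OF reg t(1) t2 q par \<alpha> that])
  have T2: "t * X (r + 2) = k * ((1 + t\<^sup>2) * ((t ^ r / t ^ n - 1) + q / t * (t ^ n / t ^ r - 1)) -
      (1 + q * t) * (t ^ r / t ^ n + t ^ n / t ^ r - 2)) * E_fun n r x" if "r < 2" for r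
    unfolding X_def k_def by (rule three_term_DD(2)[OF reg t(1) t2 q par \<alpha> that])
  have T3: "t * X (r + 4) = (1 + t\<^sup>2) * X (r + 2) - t * X r +
      k * ((1 + t\<^sup>2) * ((t ^ (r + 2) / t ^ n - 1) + q / t * (t ^ n / t ^ (r + 2) - 1)) -
      (1 + q * t) * (t ^ (r + 2) / t ^ n + t ^ n / t ^ (r + 2) - 2)) * E_fun n (r + 2) x +
      k * (t - q) * (t ^ n / t ^ r - t ^ r / t ^ n) * E_fun n r x" for r
    unfolding X_def k_def by (rule three_term_DD(3)[OF reg t(1) t2 q par \<alpha>])
  define e where "e r = E_fun n r x" for r
  define w where "w = q / t"
  have qw: "q = t * w" using t by (simp add: w_def)
  define u where "u = t ^ n / t ^ (r + 2)"
  have u: "u \<noteq> 0" using t by (simp add: u_def)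
  have pm: "1 + t ^ n / t ^ m \<noteq> 0" if "m \<le> n" for m
    using one_plus_power_nonzero[OF t(2), of "n - m"] t(1) that by (simp add: power_diff)
  have s'r: "t ^ n / t ^ r = u * t\<^sup>2" using t by (simp add: u_def power2_eq_square)
  have sr: "t ^ r / t ^ n = 1 / (u * t\<^sup>2)" using t by (simp add: u_def power2_eq_square)
  \<comment> \<open>In terms of w = q/t the coefficient of the middle E factors and is t times the
    inhomogeneous coefficient claimed.\<close>
  have P: "k * ((1 + t\<^sup>2) * (1 / (u * t\<^sup>2) - 1 + w * (u * t\<^sup>2 - 1)) -
       (1 + q * t) * (1 / (u * t\<^sup>2) + u * t\<^sup>2 - 2)) =
     t * (k * (1 - w) * (1 + u) * (1 / (t * u) - t))"
    unfolding qw using u t by (simp add: divide_simps) (simp add: algebra_simps power2_eq_square)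
  show ?case
  proof (cases "r < 2")
    case True
    have "t * X (r + 2) = t * (k * (1 - w) * (1 + u) * (1 / (t * u) - t)) * e r"
      using T2[OF True] unfolding s'r sr w_def[symmetric] P[symmetric] e_def by (simp add: mult_ac)
    then have "X (r + 2) = k * (1 - w) * (1 + u) * (1 / (t * u) - t) * e r" using t by simp
    then show ?thesis
      unfolding T1[OF True] u_def w_def e_def by (simp only: mult_zero_right add_0_left)
  next
    case False
    then obtain p where p: "r = p + 2" by (metis add.commute le_Suc_ex not_le)
    have IH: "X (p + 2) = t * (1 + u * t\<^sup>2) / (1 + u * t ^ 4) * X p +
        k * (1 - w) * (1 + u * t\<^sup>2) * (1 / (t * (u * t\<^sup>2)) - t) * e p"
    proof -
      have "t ^ n / t ^ (p + 2) = u * t\<^sup>2" using s'r p by simp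
      moreover have "u * t\<^sup>2 * t\<^sup>2 = u * t ^ 4" by (simp add: power2_eq_square eval_nat_numeral)
      ultimately show ?thesis
        using less.IH[of p] less.prems p by (simp add: e_def w_def)
    qed
    have s'p: "t ^ n / t ^ p = u * t ^ 4" using t by (simp add: u_def p power_add eval_nat_numeral)
    have sp: "t ^ p / t ^ n = 1 / (u * t ^ 4)" using t by (simp add: u_def p power_add eval_nat_numeral)
    have nz: "1 + u * t\<^sup>2 \<noteq> 0" "1 + u * t ^ 4 \<noteq> 0"
      using pm[of r] pm[of p] less.prems p unfolding s'r s'p by simp_all
    \<comment> \<open>The bracket (1 + t^2) - t^2 (1 + u)/(1 + u t^2) equals (1 + u t^4)/(1 + u
      t^2). Multiplying \<open>IH\<close> by it reduces the coefficient of \<open>X p\<close> to t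
      and that of \<open>e p\<close> to the one in the three-term relation.\<close>
    have key: "(1 + t\<^sup>2) * X (p + 2) - t * X p + k * (t - q) * (u * t ^ 4 - 1 / (u * t ^ 4)) * e p =
        t * (t * (1 + u) / (1 + u * t\<^sup>2)) * X (p + 2)"
    proof -
      have c1: "((1 + t\<^sup>2) - t * (t * (1 + u) / (1 + u * t\<^sup>2))) * (t * (1 + u * t\<^sup>2) / (1 + u * t ^ 4)) = t"
        using nz by (simp add: divide_simps) (simp add: algebra_simps power2_eq_square eval_nat_numeral)
      have c2: "((1 + t\<^sup>2) - t * (t * (1 + u) / (1 + u * t\<^sup>2))) * ((1 + u * t\<^sup>2) * (1 / (t * (u * t\<^sup>2)) - t)) =
          - t * (u * t ^ 4 - 1 / (u * t ^ 4))"
        using nz u t by (simp add: divide_simps) (simp add: algebra_simps power2_eq_square eval_nat_numeral)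
      have "((1 + t\<^sup>2) - t * (t * (1 + u) / (1 + u * t\<^sup>2))) * X (p + 2) =
         ((1 + t\<^sup>2) - t * (t * (1 + u) / (1 + u * t\<^sup>2))) * (t * (1 + u * t\<^sup>2) / (1 + u * t ^ 4)) * X p +
         ((1 + t\<^sup>2) - t * (t * (1 + u) / (1 + u * t\<^sup>2))) * ((1 + u * t\<^sup>2) * (1 / (t * (u * t\<^sup>2)) - t)) * (k * (1 - w) * e p)"
      proof -
        have "c * (\<alpha> * h + k * v * \<beta> * \<gamma> * e') = c * \<alpha> * h + c * (\<beta> * \<gamma>) * (k * v * e')"
          for c \<alpha> h v \<beta> \<gamma> e' :: complex by (simp add: algebra_simps)
        then show ?thesis unfolding IH .
      qed
      also have "\<dots> = t * X p - t * (u * t ^ 4 - 1 / (u * t ^ 4)) * (k * (1 - w) * e p)"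
        unfolding c1 c2 by simp
      finally have main: "((1 + t\<^sup>2) - t * (t * (1 + u) / (1 + u * t\<^sup>2))) * X (p + 2) =
         t * X p - t * (u * t ^ 4 - 1 / (u * t ^ 4)) * (k * (1 - w) * e p)" .
      have "(1 + t\<^sup>2) * h - t * h' + k * (t - t * w) * \<gamma> * e p = t * \<phi> * h"
        if "((1 + t\<^sup>2) - t * \<phi>) * h = t * h' - t * \<gamma> * (k * (1 - w) * e p)" for h h' \<gamma> \<phi>
        using that by (simp add: algebra_simps)
      from this[OF main] show ?thesis unfolding qw .
    qed
    have "t * X (r + 2) = (1 + t\<^sup>2) * X (p + 2) - t * X p + k * (t - q) * (u * t ^ 4 - 1 / (u * t ^ 4)) * e p
       + t * (k * (1 - w) * (1 + u) * (1 / (t * u) - t)) * e r"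
    proof -
      have "p + 4 = r + 2" "p + 2 = r" using p by auto
      then show ?thesis
        using T3[of p] unfolding s'p sp \<open>p + 4 = r + 2\<close> \<open>p + 2 = r\<close> s'r sr w_def[symmetric] P[symmetric] e_def
        by (simp add: mult_ac)
    qed
    also have "\<dots> = t * (t * (1 + u) / (1 + u * t\<^sup>2) * X r + k * (1 - w) * (1 + u) * (1 / (t * u) - t) * e r)"
      unfolding key p by (simp add: algebra_simps)
    finally show ?thesis using t unfolding u_def w_def e_def by simp
  qed
qed

text \<open>Both sides vanish for r = 0, and lengthening the column by one box changes only one
  summand of d. As only alpha^2 = beta^2 is assumed, the sign of the principal root does not
  matter.\<close>

lemma koornwinder_eigenvalue_one_column:
  assumes "r \<le> n" and t: "t \<noteq> 0" "t \<noteq> 1" and q: "q \<noteq> 0"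
    and \<alpha>: "koornwinder_alpha a b c d q \<noteq> 0" "(koornwinder_alpha a b c d q)\<^sup>2 = \<beta>\<^sup>2"
  shows "koornwinder_eigenvalue n (one_column r) a b c d q t = eigen n (koornwinder_alpha a b c d q) \<beta> q t r"
  using \<open>r \<le> n\<close>
proof (induction r)
  case 0
  show ?case
    using t by (simp add: koornwinder_eigenvalue_def Let_def lookup_one_column eigen_def kernel_shift_def)
next
  case (Suc r)
  define \<alpha> where "\<alpha> = koornwinder_alpha a b c d q"
  define h where "h r j = \<alpha> * t powi (int n - int j) * q powi (Poly_Mapping.lookup (one_column r) (j - 1)) +
        inverse \<alpha> * t powi (- int n + int j) * q powi (- Poly_Mapping.lookup (one_column r) (j - 1)) -
        \<alpha> * t powi (int n - int j) -
        inverse \<alpha> * t powi (- int n + int j)" for r j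
  have "h (Suc r) j = h r j" if "j \<in> {1..n} - {Suc r}" for j
    using that by (auto simp: h_def lookup_one_column)
  then have "(\<Sum>j\<in>{1..n} - {Suc r}. h (Suc r) j) = (\<Sum>j\<in>{1..n} - {Suc r}. h r j)"
    by (intro sum.cong refl)
  moreover have "(\<Sum>j=1..n. h l j) = h l (Suc r) + (\<Sum>j\<in>{1..n} - {Suc r}. h l j)" for l
    using Suc.prems by (intro sum.remove) auto
  ultimately have "(\<Sum>j=1..n. h (Suc r) j) - (\<Sum>j=1..n. h r j) = h (Suc r) (Suc r) - h r (Suc r)"
    by simp
  also have "\<dots> = eigen n \<alpha> \<beta> q t (Suc r) - eigen n \<alpha> \<beta> q t r"
  proof -
    define s where "s = t ^ n / t ^ Suc r"
    have s: "s \<noteq> 0" using t by (simp add: s_def)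
    have p1: "t powi (int n - int (Suc r)) = s"
    proof -
      have "int n - int (Suc r) = int (n - Suc r)" using Suc.prems by simp
      moreover have "t ^ (n - Suc r) = t ^ n / t ^ Suc r"
        by (rule power_diff) (use t Suc.prems in auto)
      ultimately show ?thesis unfolding s_def by (simp only: power_int_of_nat)
    qed
    have p2: "t powi (- int n + int (Suc r)) = inverse s"
      unfolding p1[symmetric] power_int_minus[symmetric] by simp
    have s1: "t ^ n / t ^ r = s * t" using t by (simp add: s_def)
    have s2: "t ^ Suc r / t ^ n = 1 / s" "t ^ r / t ^ n = 1 / (s * t)" using t by (simp_all add: s_def)
    have "h (Suc r) (Suc r) - h r (Suc r) = \<alpha> * s * (q - 1) + inverse \<alpha> * inverse s * (inverse q - 1)"
      unfolding h_def p1 p2 by (simp add: lookup_one_column algebra_simps power_int_minus)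
    also have "\<dots> = kernel_const \<alpha> q t * (1 / s - 1 / (s * t) + q * \<alpha>\<^sup>2 / t * (s - s * t))"
      using s t q \<alpha>(1) by (simp add: kernel_const_def \<alpha>_def[symmetric] divide_simps power2_eq_square) (simp add: algebra_simps)
    also have "\<dots> = eigen n \<alpha> \<beta> q t (Suc r) - eigen n \<alpha> \<beta> q t r"
    proof -
      define B where "B = q * \<beta>\<^sup>2 / t"
      have B: "q * \<alpha>\<^sup>2 / t = B" using \<alpha>(2) by (simp add: B_def \<alpha>_def)
      show ?thesis
        unfolding eigen_def s_def[symmetric] s1 s2 B B_def[symmetric] by (simp add: algebra_simps)
    qed
    finally show ?thesis .
  qed
  finally have "(\<Sum>j=1..n. h (Suc r) j) = (\<Sum>j=1..n. h r j) + eigen n \<alpha> \<beta> q t (Suc r) - eigen n \<alpha> \<beta> q t r"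
    by (simp add: algebra_simps)
  moreover have "(\<Sum>j=1..n. h r j) = eigen n \<alpha> \<beta> q t r"
    using Suc by (simp add: h_def koornwinder_eigenvalue_def Let_def \<alpha>_def)
  ultimately show ?case
    by (simp add: h_def koornwinder_eigenvalue_def Let_def \<alpha>_def)
qed

text \<open>The difference factors completely. Its factors 1 - t^(2m) and 1 - q beta^2 U^2 t^(2m-1)
  are the ones that appear in the denominators of the expansion coefficients.\<close>

lemma eigen_diff:
  fixes n :: nat and t :: complex
  assumes t: "t \<noteq> 0" and "2 * m \<le> r"
  defines "U \<equiv> t ^ n / t ^ r"
  shows "eigen n \<alpha> \<beta> q t r - eigen n \<alpha> \<beta> q t (r - 2 * m) =
    - kernel_const \<alpha> q t * (1 - t ^ (2 * m)) / (U * t ^ (2 * m)) * (1 - q * \<beta>\<^sup>2 / t * U\<^sup>2 * t ^ (2 * m))"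
proof -
  have "t ^ n / t ^ (r - 2 * m) = U * t ^ (2 * m)"
    using assms by (simp add: power_diff)
  moreover have "t ^ (r - 2 * m) / t ^ n = 1 / (U * t ^ (2 * m))"
    using assms by (simp add: power_diff)
  moreover have "t ^ r / t ^ n = 1 / U" using t by (simp add: U_def)
  moreover have "U \<noteq> 0" using t by (simp add: U_def)
  ultimately show ?thesis
    unfolding eigen_def U_def[symmetric]
    using t by (simp add: divide_simps) (simp add: algebra_simps power2_eq_square)
qed

lemma eigen_neq:
  assumes "s < r" "r \<le> n" and t: "t \<noteq> 0" "\<And>k::nat. k \<ge> 1 \<Longrightarrow> t ^ k \<noteq> 1" and q: "q \<noteq> 0" "q \<noteq> 1" and "\<alpha> \<noteq> 0"
    and \<beta>: "\<And>k. q * \<beta>\<^sup>2 * t ^ k \<noteq> 1"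
  shows "eigen n \<alpha> \<beta> q t r \<noteq> eigen n \<alpha> \<beta> q t s"
proof
  assume eq: "eigen n \<alpha> \<beta> q t r = eigen n \<alpha> \<beta> q t s"
  have "kernel_const \<alpha> q t \<noteq> 0"
    using q t(1) t(2)[of 1] \<open>\<alpha> \<noteq> 0\<close> by (simp add: kernel_const_def)
  define B where "B = q * \<beta>\<^sup>2 / t"
  have "eigen n \<alpha> \<beta> q t r - eigen n \<alpha> \<beta> q t s =
      kernel_const \<alpha> q t * (t ^ r / t ^ n - t ^ s / t ^ n + B * (t ^ n / t ^ r - t ^ n / t ^ s))"
    unfolding eigen_def B_def[symmetric] by (simp add: algebra_simps)
  with eq \<open>kernel_const \<alpha> q t \<noteq> 0\<close>
  have eq0: "t ^ r / t ^ n - t ^ s / t ^ n + B * (t ^ n / t ^ r - t ^ n / t ^ s) = 0" by simp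
  define U where "U = t ^ (n - r)"
  define l where "l = r - s"
  define L where "L = t ^ l"
  define S where "S = t ^ s"
  have tn: "t ^ n = U * L * S" and tr: "t ^ r = L * S" and ts: "t ^ s = S"
    using assms by (simp_all add: U_def l_def L_def S_def flip: power_add)
  have nz: "U \<noteq> 0" "L \<noteq> 0" "S \<noteq> 0" using t by (auto simp: U_def L_def S_def)
  have "1 / U - 1 / (U * L) + B * (U - U * L) = 0"
    using eq0 nz unfolding tn tr ts by simp
  moreover have "(L - 1) * (1 - B * (U * U * L)) = U * L * (1 / U - 1 / (U * L) + B * (U - U * L))"
    using nz by (simp add: field_simps)
  ultimately have "(t ^ l - 1) * (1 - q * \<beta>\<^sup>2 / t * (U * U * t ^ l)) = 0"
    by (simp add: L_def B_def)
  moreover have "t ^ l \<noteq> 1" using t(2)[of l] assms(1) by (simp add: l_def)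
  \<comment> \<open>As l is at least 1, one factor t absorbs the division by t, which leaves a
    natural exponent as required by the genericity assumption.\<close>
  moreover have "U * U * t ^ l = t * t ^ (2 * (n - r) + (l - 1))"
  proof -
    have "t ^ l = t * t ^ (l - 1)" using assms(1) by (simp add: l_def power_eq_if)
    then show ?thesis by (simp add: U_def mult_2 power_add)
  qed
  ultimately have "q * \<beta>\<^sup>2 * t ^ (2 * (n - r) + (l - 1)) = 1" using t(1) by (simp add: mult.assoc)
  then show False using \<beta> by blast
qed

subsection \<open>Uniqueness of one-column eigenfunctions\<close>

text \<open>The admissible lower terms of P_(1^r), because the partitions strictly below a column
  are the shorter columns.\<close>

definition lower_span :: "nat \<Rightarrow> nat \<Rightarrow> laurent set" where
  "lower_span n r = {P. \<exists>w. P = (\<Sum>s<r. lconst (w s) * m_poly n (one_column s))}"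

lemma lower_span_0 [simp]: "lower_span n 0 = {0}"
  by (simp add: lower_span_def)

lemma zero_lower_span: "0 \<in> lower_span n r"
  unfolding lower_span_def by (intro CollectI exI[of _ "\<lambda>_. 0"]) simp

lemma lower_span_add: "P \<in> lower_span n r \<Longrightarrow> Q \<in> lower_span n r \<Longrightarrow> P + Q \<in> lower_span n r"
proof -
  assume "P \<in> lower_span n r" "Q \<in> lower_span n r"
  then obtain v w where "P = (\<Sum>s<r. lconst (v s) * m_poly n (one_column s))"
    "Q = (\<Sum>s<r. lconst (w s) * m_poly n (one_column s))" by (auto simp: lower_span_def)
  then have "P + Q = (\<Sum>s<r. lconst (v s + w s) * m_poly n (one_column s))"
    by (simp add: lconst_add distrib_right sum.distrib)
  then show ?thesis by (auto simp: lower_span_def)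
qed

lemma lower_span_lconst: "P \<in> lower_span n r \<Longrightarrow> lconst c * P \<in> lower_span n r"
proof -
  assume "P \<in> lower_span n r"
  then obtain v where "P = (\<Sum>s<r. lconst (v s) * m_poly n (one_column s))"
    by (auto simp: lower_span_def)
  then have "lconst c * P = (\<Sum>s<r. lconst (c * v s) * m_poly n (one_column s))"
    by (simp add: lconst_mult sum_distrib_left mult.assoc)
  then show ?thesis by (auto simp: lower_span_def)
qed

lemma lower_span_uminus: "P \<in> lower_span n r \<Longrightarrow> - P \<in> lower_span n r"
  using lower_span_lconst[of P n r "-1"] by (simp add: lconst_uminus)

lemma lower_span_diff: "P \<in> lower_span n r \<Longrightarrow> Q \<in> lower_span n r \<Longrightarrow> P - Q \<in> lower_span n r"
  using lower_span_add[of P n r "- Q"] lower_span_uminus by simp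

lemma lower_span_sum: "(\<And>i. i \<in> A \<Longrightarrow> f i \<in> lower_span n r) \<Longrightarrow> (\<Sum>i\<in>A. f i) \<in> lower_span n r"
  by (induction A rule: infinite_finite_induct) (auto simp: zero_lower_span lower_span_add)

lemma lower_span_Suc: "P \<in> lower_span n (Suc r) \<longleftrightarrow>
    (\<exists>c. P - lconst c * m_poly n (one_column r) \<in> lower_span n r)"
proof
  assume "P \<in> lower_span n (Suc r)"
  then obtain w where "P = (\<Sum>s<Suc r. lconst (w s) * m_poly n (one_column s))"
    by (auto simp: lower_span_def)
  then have "P - lconst (w r) * m_poly n (one_column r) = (\<Sum>s<r. lconst (w s) * m_poly n (one_column s))"
    by simp
  then show "\<exists>c. P - lconst c * m_poly n (one_column r) \<in> lower_span n r"
    unfolding lower_span_def by blast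
next
  assume "\<exists>c. P - lconst c * m_poly n (one_column r) \<in> lower_span n r"
  then obtain c w where cw: "P - lconst c * m_poly n (one_column r) =
      (\<Sum>s<r. lconst (w s) * m_poly n (one_column s))"
    unfolding lower_span_def by blast
  have "(\<Sum>s<r. lconst ((w(r := c)) s) * m_poly n (one_column s)) =
      (\<Sum>s<r. lconst (w s) * m_poly n (one_column s))" by (intro sum.cong) auto
  then have "P = (\<Sum>s<Suc r. lconst ((w(r := c)) s) * m_poly n (one_column s))"
    using cw by (simp add: algebra_simps)
  then show "P \<in> lower_span n (Suc r)" unfolding lower_span_def by blast
qed

lemma lower_span_SucI: "P \<in> lower_span n r \<Longrightarrow> P \<in> lower_span n (Suc r)"
  unfolding lower_span_Suc by (intro exI[of _ 0]) simp

lemma lower_span_mono: "r \<le> s \<Longrightarrow> P \<in> lower_span n r \<Longrightarrow> P \<in> lower_span n s"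
  by (induction s rule: dec_induct) (auto intro: lower_span_SucI)

text \<open>The coefficient of e_r in E_r is a binomial coefficient over 0, that is 1, so the E_s
  are unitriangular in the m_(1^s).\<close>

lemma E_poly_minus_m_poly:
  assumes "r \<le> n"
  shows "E_poly n r - m_poly n (one_column r) \<in> lower_span n r"
proof -
  have "E_poly n r = (\<Sum>s\<le>r. lconst (of_nat (esym_coeff n r s)) * m_poly n (one_column s))"
    unfolding E_poly_eq_esym_gen coeff_esym_gen
    using assms by (intro sum.cong refl) (simp add: m_poly_one_column lconst_of_nat)
  also have "\<dots> = m_poly n (one_column r) +
      (\<Sum>s<r. lconst (of_nat (esym_coeff n r s)) * m_poly n (one_column s))"
    by (simp add: esym_coeff_def flip: lessThan_Suc_atMost)
  finally show ?thesis unfolding lower_span_def by auto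
qed

text \<open>Passes from the m_(1^s) to the E_s, on which the action of the operator is
  known.\<close>

lemma lower_span_SucE:
  assumes "P \<in> lower_span n (Suc r)" "r \<le> n"
  obtains c Q where "Q \<in> lower_span n r" "P = lconst c * E_poly n r + Q"
proof -
  obtain c where "P - lconst c * m_poly n (one_column r) \<in> lower_span n r"
    using assms(1) by (auto simp: lower_span_Suc)
  then have "P - lconst c * m_poly n (one_column r) -
      lconst c * (E_poly n r - m_poly n (one_column r)) \<in> lower_span n r"
    by (rule lower_span_diff) (intro lower_span_lconst E_poly_minus_m_poly assms)
  then show ?thesis by (intro that[of "P - lconst c * E_poly n r" c]) (auto simp: algebra_simps)
qed

lemma E_poly_lower_span: "r < s \<Longrightarrow> r \<le> n \<Longrightarrow> E_poly n r \<in> lower_span n s"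
proof -
  assume "r < s" "r \<le> n"
  then have "E_poly n r \<in> lower_span n (Suc r)"
    unfolding lower_span_Suc using E_poly_minus_m_poly by (intro exI[of _ 1]) auto
  then show ?thesis using \<open>r < s\<close> lower_span_mono[of "Suc r" s] by simp
qed

lemma in_vars_lower_span: "P \<in> lower_span n r \<Longrightarrow> r \<le> Suc n \<Longrightarrow> in_vars n P"
proof -
  assume P: "P \<in> lower_span n r" "r \<le> Suc n"
  have add: "in_vars n (P + Q)" if "in_vars n P" "in_vars n Q" for P Q
    using that Poly_Mapping.keys_add[of P Q] by (auto simp: in_vars_def)
  have lc: "in_vars n (lconst c * P)" if "in_vars n P" for c P
    using that by (auto simp: in_vars_def in_keys_iff lookup_lconst_mult)
  have sum: "in_vars n (\<Sum>i\<in>A. f i)" if "\<And>i. i \<in> A \<Longrightarrow> in_vars n (f i)" for A and f :: "'a \<Rightarrow> laurent"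
    using that by (induction A rule: infinite_finite_induct) (auto simp: add, auto simp: in_vars_def)
  have "in_vars n (m_poly n la)" for la
    unfolding m_poly_def
  proof (rule sum)
    fix \<mu> assume "\<mu> \<in> W_orbit n la"
    then show "in_vars n (monomial \<mu>)" by (auto simp: in_vars_def monomial_def W_orbit_def)
  qed
  then show ?thesis
    using P(1) by (auto simp: lower_span_def intro!: sum lc)
qed

lemma W_invariant_E_poly: "W_invariant n (E_poly n r)"
  unfolding W_invariant_def
proof (intro allI impI conjI)
  fix x :: "nat \<Rightarrow> complex" and \<pi> assume "\<pi> permutes {..<n}"
  then have "gen_poly n (x \<circ> \<pi>) = gen_poly n x"
    unfolding esym_gen_def using prod.permute[of \<pi> "{..<n}" "\<lambda>i. [:1, - (x i + inverse (x i)), 1:]"]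
    by (simp add: o_def)
  then show "leval (E_poly n r) (x \<circ> \<pi>) = leval (E_poly n r) x" by (simp add: leval_E_poly E_fun_def)
next
  fix x :: "nat \<Rightarrow> complex" and i
  have "gen_poly n (x(i := inverse (x i))) = gen_poly n x"
    unfolding esym_gen_def by (intro prod.cong) (auto simp: add.commute)
  then show "leval (E_poly n r) (x(i := inverse (x i))) = leval (E_poly n r) x"
    by (simp add: leval_E_poly E_fun_def)
qed

lemma W_invariant_lower_span: "P \<in> lower_span n r \<Longrightarrow> r \<le> Suc n \<Longrightarrow> W_invariant n P"
proof (induction r arbitrary: P)
  case 0
  then show ?case by (simp add: W_invariant_def)
next
  case (Suc r)
  obtain c Q where Q: "Q \<in> lower_span n r" "P = lconst c * E_poly n r + Q"
    using lower_span_SucE Suc.prems by (metis Suc_le_mono)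
  with Suc have "W_invariant n Q" by simp
  with W_invariant_E_poly[of n r] show ?case
    unfolding Q W_invariant_def by (auto simp: leval_add leval_lconst_mult)
qed

section \<open>Independence on the regular points\<close>

lemma exists_plus_inverse: "\<exists>x::complex. x \<noteq> 0 \<and> x + inverse x = v"
proof -
  define s where "s = csqrt (v\<^sup>2 - 4)"
  have "s\<^sup>2 = v\<^sup>2 - 4" by (simp add: s_def)
  then have prod: "((v + s) / 2) * ((v - s) / 2) = 1"
    by (simp add: field_simps power2_eq_square)
  then have "(v + s) / 2 \<noteq> 0" by auto
  moreover have "inverse ((v + s) / 2) = (v - s) / 2" using prod by (rule inverse_unique)
  moreover have "(v + s) / 2 + (v - s) / 2 = v" by (simp add: field_simps)
  ultimately show ?thesis by metis
qed

text \<open>In terms of V = x + 1/x every excluded coincidence is a bound or an equality: x^2 = 1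
  means V = 2 or V = -2, x^2 in {q, 1/q} implies V^2 = q + 1/q + 2, and x_i equal to x_j or 1/x_j
  implies V_i = V_j. Large distinct values of V avoid all of them.\<close>

lemma exists_regular_point:
  fixes q :: complex
  assumes m: "real m > 2 + norm (q + 1 / q + 2)" and "q \<noteq> 0"
  shows "\<exists>x. regular_point n q x \<and> (\<forall>i. x i + inverse (x i) = of_nat m * of_nat (i + 1))"
proof -
  obtain x :: "nat \<Rightarrow> complex" where x: "\<And>i. x i \<noteq> 0" "\<And>i. x i + inverse (x i) = of_nat m * of_nat (i + 1)"
  proof -
    have "\<forall>i. \<exists>x::complex. x \<noteq> 0 \<and> x + inverse x = of_nat m * of_nat (i + 1)"
      using exists_plus_inverse by blast
    then show ?thesis using that by metis
  qed
  have "m > 2" using m norm_ge_zero[of "q + 1 / q + 2"] by linarith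
  have big: "norm (x i + inverse (x i)) \<ge> real m" for i
    unfolding x(2) norm_mult norm_of_nat by (simp add: algebra_simps)
  have sq: "(x i + inverse (x i))\<^sup>2 = (x i)\<^sup>2 + 1 / (x i)\<^sup>2 + 2" for i
    using x(1)[of i] by (simp add: power2_eq_square field_simps)
  have bad: "(x i)\<^sup>2 + 1 / (x i)\<^sup>2 \<noteq> q + 1 / q" for i
  proof
    assume "(x i)\<^sup>2 + 1 / (x i)\<^sup>2 = q + 1 / q"
    then have "norm (x i + inverse (x i)) ^ 2 = norm (q + 1 / q + 2)"
      using sq[of i] by (simp flip: norm_power)
    moreover have "norm (x i + inverse (x i)) ^ 2 \<ge> real m ^ 2"
      using big by (intro power_mono) auto
    moreover have "real m ^ 2 \<ge> real m" using \<open>m > 2\<close> by (simp add: power2_eq_square)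
    ultimately show False using m by linarith
  qed
  have "(x i)\<^sup>2 \<noteq> 1" for i
  proof
    assume "(x i)\<^sup>2 = 1"
    then have "x i = 1 \<or> x i = -1" by (simp add: power2_eq_1_iff)
    then have "norm (x i + inverse (x i)) = 2" by auto
    then show False using big[of i] \<open>m > 2\<close> by simp
  qed
  moreover have "q * (x i)\<^sup>2 \<noteq> 1" "(x i)\<^sup>2 \<noteq> q" for i
  proof -
    show "q * (x i)\<^sup>2 \<noteq> 1"
    proof
      assume "q * (x i)\<^sup>2 = 1"
      then have "(x i)\<^sup>2 = 1 / q" using \<open>q \<noteq> 0\<close> by (simp add: field_simps)
      then show False using bad[of i] by simp
    qed
    show "(x i)\<^sup>2 \<noteq> q" using bad[of i] by auto
  qed
  moreover have "x i \<noteq> x j" "x i * x j \<noteq> 1" if "i \<noteq> j" for i j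
  proof -
    have ne: "x i + inverse (x i) \<noteq> x j + inverse (x j)"
      unfolding x(2) using \<open>m > 2\<close> that by (simp del: of_nat_Suc)
    then show "x i \<noteq> x j" by auto
    show "x i * x j \<noteq> 1"
    proof
      assume "x i * x j = 1"
      then have "inverse (x i) = x j" "inverse (x j) = x i"
        by (auto intro: inverse_unique simp: mult.commute)
      then show False using ne by simp
    qed
  qed
  ultimately have "regular_point n q x" using x(1) by (simp add: regular_point_def)
  with x(2) show ?thesis by blast
qed

lemma esym_scale: "esym n s (\<lambda>i. z * V i) = z ^ s * esym n s V"
  unfolding esym_def sum_distrib_left by (intro sum.cong refl) (simp add: prod.distrib)

text \<open>A one-parameter family replaces density of the regular points: at V_i = m(i + 1) the
  polynomial m_(1^s) takes the value m^s e_s(1,...,n). The evaluation is then a polynomial in m with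
  infinitely many zeros, and its top coefficient is c e_k(1,...,n), where the second factor is a
  positive integer because k is at most n.\<close>

lemma lower_span_independent:
  assumes Q: "Q \<in> lower_span n k" and "k \<le> n" and "q \<noteq> 0"
    and zero: "\<And>x. regular_point n q x \<Longrightarrow> leval (lconst c * E_poly n k + Q) x = 0"
  shows "c = 0"
proof -
  define Q' where "Q' = lconst c * (E_poly n k - m_poly n (one_column k)) + Q"
  have "Q' \<in> lower_span n k"
    unfolding Q'_def by (intro lower_span_add lower_span_lconst E_poly_minus_m_poly Q assms)
  then obtain w where w: "Q' = (\<Sum>s<k. lconst (w s) * m_poly n (one_column s))"
    by (auto simp: lower_span_def)
  define e where "e s = esym n s (\<lambda>i. of_nat (i + 1) :: complex)" for s
  define p where "p = monom (c * e k) k + (\<Sum>s<k. monom (w s * e s) s)"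
  have "poly p (of_nat m) = 0" if m: "real m > 2 + norm (q + 1 / q + 2)" for m
  proof -
    obtain x where x: "regular_point n q x" "\<And>i. x i + inverse (x i) = of_nat m * of_nat (i + 1)"
      using exists_regular_point[OF m \<open>q \<noteq> 0\<close>] by blast
    have lm: "leval (m_poly n (one_column s)) x = of_nat m ^ s * e s" if "s \<le> k" for s
      using that \<open>k \<le> n\<close> unfolding e_def
      by (simp only: m_poly_one_column[OF order.trans] leval_esym x(2) esym_scale)
    have "0 = leval (lconst c * E_poly n k + Q) x" using zero[OF x(1)] by simp
    also have "lconst c * E_poly n k + Q = lconst c * m_poly n (one_column k) + Q'"
      by (simp add: Q'_def algebra_simps)
    also have "leval \<dots> x = poly p (of_nat m)"
      unfolding w leval_add leval_sum leval_lconst_mult p_def poly_add poly_sum poly_monom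
      by (simp add: lm mult_ac)
    finally show ?thesis by simp
  qed
  then have "of_nat ` {m. real m > 2 + norm (q + 1 / q + 2)} \<subseteq> {z. poly p z = 0}" by auto
  moreover have "infinite ((of_nat :: nat \<Rightarrow> complex) ` {m. real m > 2 + norm (q + 1 / q + 2)})"
  proof -
    obtain M where M: "2 + norm (q + 1 / q + 2) < real M" using reals_Archimedean2 by blast
    then have "{M..} \<subseteq> {m. real m > 2 + norm (q + 1 / q + 2)}" by auto
    then have "infinite {m. real m > 2 + norm (q + 1 / q + 2)}"
      using infinite_Ici infinite_super by blast
    then show ?thesis by (simp add: finite_image_iff inj_on_def)
  qed
  ultimately have "infinite {z. poly p z = 0}" using infinite_super by blast
  then have "p = 0" using poly_roots_finite by blast
  then have "coeff p k = 0" by simp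
  then have "c * e k = 0" by (simp add: p_def coeff_sum)
  moreover have "e k \<noteq> 0"
  proof -
    define N where "N = (\<Sum>S | S \<subseteq> {..<n} \<and> card S = k. \<Prod>i\<in>S. i + 1)"
    have "e k = of_nat N"
      unfolding e_def esym_def N_def of_nat_sum of_nat_prod ..
    moreover have "N \<ge> (\<Prod>i\<in>{..<k}. i + 1)"
      unfolding N_def using \<open>k \<le> n\<close> by (intro member_le_sum) auto
    moreover have "(\<Prod>i\<in>{..<k}. i + 1) > 0" by (intro prod_pos) simp
    ultimately show ?thesis by (metis less_le_trans not_gr_zero of_nat_eq_0_iff)
  qed
  ultimately show ?thesis by simp
qed

text \<open>What both families have in common: the defects of the E_r start at zero and satisfy a
  two-term recurrence with multiplier \<open>f\<close> and inhomogeneity \<open>g\<close>, and the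
  column eigenvalues are distinct.\<close>

locale column_operator =
  fixes n :: nat and a b c d q t :: complex and eig f g :: "nat \<Rightarrow> complex"
  assumes q0: "q \<noteq> 0"
    and eig_low: "\<And>r x. r < 2 \<Longrightarrow> r \<le> n \<Longrightarrow> regular_point n q x \<Longrightarrow>
      koornwinder_op n a b c d q t (E_fun n r) x = eig r * E_fun n r x"
    and eig_step: "\<And>r x. r + 2 \<le> n \<Longrightarrow> regular_point n q x \<Longrightarrow>
      koornwinder_op n a b c d q t (E_fun n (r + 2)) x - eig (r + 2) * E_fun n (r + 2) x =
      f r * (koornwinder_op n a b c d q t (E_fun n r) x - eig r * E_fun n r x) + g r * E_fun n r x"
    and eig_inj: "\<And>r s. s < r \<Longrightarrow> r \<le> n \<Longrightarrow> eig r \<noteq> eig s"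
    and eig_val: "\<And>r. r \<le> n \<Longrightarrow> koornwinder_eigenvalue n (one_column r) a b c d q t = eig r"
begin

abbreviation "D P x \<equiv> koornwinder_op n a b c d q t (leval P) x"

lemma D_sum: "D (\<Sum>i\<in>A. lconst (w i) * P i) x = (\<Sum>i\<in>A. w i * D (P i) x)"
proof -
  have "leval (\<Sum>i\<in>A. lconst (w i) * P i) = (\<lambda>x. \<Sum>i\<in>A. w i * leval (P i) x)"
    by (simp add: leval_sum leval_lconst_mult fun_eq_iff)
  then show ?thesis by (simp only: koornwinder_op_sum)
qed

lemma D_add: "D (P + Q) x = D P x + D Q x"
  using D_sum[of "\<lambda>_. 1" "\<lambda>i. if i then P else Q" "{True, False}" x] by simp

lemma D_lconst: "D (lconst k * P) x = k * D P x"
  using D_sum[of "\<lambda>_. k" "\<lambda>_. P" "{()}" x] by simp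

lemma D_diff: "D (P - Q) x = D P x - D Q x"
  using D_add[of P "lconst (-1) * Q" x] D_lconst[of "-1" Q x] by (simp add: lconst_uminus)

definition defect :: "nat \<Rightarrow> (nat \<Rightarrow> complex) \<Rightarrow> complex" where
  "defect r x = D (E_poly n r) x - eig r * leval (E_poly n r) x"

lemma defect_low: "r < 2 \<Longrightarrow> r \<le> n \<Longrightarrow> regular_point n q x \<Longrightarrow> defect r x = 0"
  using eig_low by (simp add: defect_def leval_E_poly)

lemma defect_step: "r + 2 \<le> n \<Longrightarrow> regular_point n q x \<Longrightarrow>
    defect (r + 2) x = f r * defect r x + g r * leval (E_poly n r) x"
  using eig_step by (simp add: defect_def leval_E_poly)

text \<open>This is the triangularity of the operator on the E_r. It is read off from the
  recurrence, whose right side contains only indices lowered by two or more.\<close>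

lemma defect_lower_span:
  "r \<le> n \<Longrightarrow> \<exists>R\<in>lower_span n r. \<forall>x. regular_point n q x \<longrightarrow> defect r x = leval R x"
proof (induction r rule: less_induct)
  case (less r)
  show ?case
  proof (cases "r < 2")
    case True
    then show ?thesis using defect_low less.prems zero_lower_span by (intro bexI[of _ 0]) auto
  next
    case False
    then obtain p where p: "r = p + 2" by (metis add.commute le_Suc_ex not_le)
    then obtain R where R: "R \<in> lower_span n p" "\<And>x. regular_point n q x \<Longrightarrow> defect p x = leval R x"
      using less.IH[of p] less.prems by auto
    have "lconst (f p) * R + lconst (g p) * E_poly n p \<in> lower_span n r"
      using less.prems p
      by (intro lower_span_add lower_span_lconst lower_span_mono[OF _ R(1)] E_poly_lower_span) auto
    then show ?thesis
      using defect_step[of p] less.prems p R(2)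
      by (intro bexI[of _ "lconst (f p) * R + lconst (g p) * E_poly n p"])
         (auto simp: leval_add leval_lconst_mult)
  qed
qed

lemma D_lower_span:
  "P \<in> lower_span n r \<Longrightarrow> r \<le> Suc n \<Longrightarrow>
     \<exists>R\<in>lower_span n r. \<forall>x. regular_point n q x \<longrightarrow> D P x = leval R x"
proof (induction r arbitrary: P)
  case 0
  then show ?case by (auto simp: koornwinder_op_eq)
next
  case (Suc r)
  obtain k Q where Q: "Q \<in> lower_span n r" "P = lconst k * E_poly n r + Q"
    using lower_span_SucE Suc.prems by (metis Suc_le_mono)
  obtain R1 where R1: "R1 \<in> lower_span n r" "\<And>x. regular_point n q x \<Longrightarrow> D Q x = leval R1 x"
    using Suc.IH[OF Q(1)] Suc.prems by auto
  obtain R where R: "R \<in> lower_span n r" "\<And>x. regular_point n q x \<Longrightarrow> defect r x = leval R x"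
    using defect_lower_span[of r] Suc.prems by auto
  let ?S = "lconst k * (R + lconst (eig r) * E_poly n r) + R1"
  have "?S \<in> lower_span n (Suc r)"
    using Suc.prems
    by (intro lower_span_add lower_span_lconst lower_span_SucI[OF R(1)] lower_span_SucI[OF R1(1)]
        E_poly_lower_span) auto
  moreover have "D P x = leval ?S x" if "regular_point n q x" for x
    using R(2)[OF that, symmetric] R1(2)[OF that, symmetric]
    unfolding Q(2) D_add D_lconst leval_add leval_lconst_mult defect_def
    by (simp only:) (simp add: algebra_simps)
  ultimately show ?case by blast
qed

text \<open>By triangularity the coefficient k of the highest E_s in \<open>P\<close> contributes k
  (eig s - eig r) to the eigenvalue equation. Independence and distinct eigenvalues force k = 0, and
  the next lower index becomes the highest.\<close>

lemma eigen_unique: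
  assumes "r \<le> n" and "P \<in> lower_span n s" "s \<le> r"
    and "\<And>x. regular_point n q x \<Longrightarrow> D P x = eig r * leval P x"
  shows "P = 0"
  using assms(2-)
proof (induction s arbitrary: P)
  case 0
  then show ?case by simp
next
  case (Suc s)
  have "s \<le> n" using Suc.prems assms(1) by simp
  obtain k Q where Q: "Q \<in> lower_span n s" "P = lconst k * E_poly n s + Q"
    using lower_span_SucE Suc.prems \<open>s \<le> n\<close> by metis
  obtain R1 where R1: "R1 \<in> lower_span n s" "\<And>x. regular_point n q x \<Longrightarrow> D Q x = leval R1 x"
    using D_lower_span[OF Q(1)] \<open>s \<le> n\<close> by auto
  obtain R where R: "R \<in> lower_span n s" "\<And>x. regular_point n q x \<Longrightarrow> defect s x = leval R x"
    using defect_lower_span[OF \<open>s \<le> n\<close>] by auto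
  let ?S = "lconst k * R + R1 - lconst (eig r) * Q"
  have S: "?S \<in> lower_span n s"
    by (intro lower_span_add lower_span_diff lower_span_lconst Q R R1)
  have "leval (lconst (k * (eig s - eig r)) * E_poly n s + ?S) x = 0" if "regular_point n q x" for x
  proof -
    have "D P x = k * D (E_poly n s) x + D Q x" unfolding Q(2) D_add D_lconst ..
    moreover have "leval P x = k * leval (E_poly n s) x + leval Q x"
      unfolding Q(2) leval_add leval_lconst_mult ..
    ultimately show ?thesis
      using Suc.prems(3)[OF that] R(2)[OF that, symmetric] R1(2)[OF that, symmetric]
      unfolding leval_add leval_diff leval_lconst_mult defect_def
      by (simp only:) (simp add: algebra_simps)
  qed
  from lower_span_independent[OF S \<open>s \<le> n\<close> q0 this] have "k * (eig s - eig r) = 0" .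
  moreover have "eig r \<noteq> eig s" using eig_inj[of s r] Suc.prems assms(1) by simp
  ultimately have "k = 0" by simp
  then have "P = Q" using Q by simp
  then show ?case using Suc.IH[of P] Suc.prems(2,3) Q(1) by simp
qed

text \<open>Invariance and the restriction to n variables follow from lying in the span of columns,
  and E_r may replace m_(1^r) as leading term.\<close>

lemma is_koornwinder_iff:
  assumes "r \<le> n"
  shows "is_koornwinder n (one_column r) a b c d q t P \<longleftrightarrow>
    P - E_poly n r \<in> lower_span n r \<and> (\<forall>x. regular_point n q x \<longrightarrow> D P x = eig r * leval P x)"
proof -
  let ?M = "{\<mu>. is_partition n \<mu> \<and> dominated n \<mu> (one_column r) \<and> \<mu> \<noteq> one_column r}"
  have reindex: "(\<Sum>\<mu>\<in>?M. lconst (w \<mu>) * m_poly n \<mu>) =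
      (\<Sum>s<r. lconst (w (one_column s)) * m_poly n (one_column s))" for w
    unfolding dominated_one_column[OF assms]
    by (subst sum.reindex) (auto intro: inj_on_subset[OF inj_one_column])
  have span: "(\<exists>w. P = m_poly n (one_column r) + (\<Sum>\<mu>\<in>?M. lconst (w \<mu>) * m_poly n \<mu>)) \<longleftrightarrow>
      P - m_poly n (one_column r) \<in> lower_span n r"
  proof
    assume "\<exists>w. P = m_poly n (one_column r) + (\<Sum>\<mu>\<in>?M. lconst (w \<mu>) * m_poly n \<mu>)"
    then show "P - m_poly n (one_column r) \<in> lower_span n r"
      unfolding reindex lower_span_def by auto
  next
    assume "P - m_poly n (one_column r) \<in> lower_span n r"
    then obtain w where "P - m_poly n (one_column r) = (\<Sum>s<r. lconst (w s) * m_poly n (one_column s))"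
      unfolding lower_span_def by blast
    \<comment> \<open>The definition indexes coefficients by partitions and the span by column
      lengths; \<open>inv one_column\<close> translates the latter into the former.\<close>
    then have "P = m_poly n (one_column r) +
        (\<Sum>s<r. lconst ((w \<circ> inv one_column) (one_column s)) * m_poly n (one_column s))"
      by (simp add: inj_one_column algebra_simps)
    then show "\<exists>w. P = m_poly n (one_column r) + (\<Sum>\<mu>\<in>?M. lconst (w \<mu>) * m_poly n \<mu>)"
      unfolding reindex by blast
  qed
  have mE: "P - m_poly n (one_column r) \<in> lower_span n r \<longleftrightarrow> P - E_poly n r \<in> lower_span n r"
    using lower_span_add[of "P - E_poly n r" n r, OF _ E_poly_minus_m_poly[OF assms]]
      lower_span_diff[of "P - m_poly n (one_column r)" n r, OF _ E_poly_minus_m_poly[OF assms]]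
    by auto
  have "in_vars n P \<and> W_invariant n P" if "P - E_poly n r \<in> lower_span n r"
  proof -
    have "P - E_poly n r + E_poly n r \<in> lower_span n (Suc r)"
      by (intro lower_span_add lower_span_SucI[OF that] E_poly_lower_span assms) simp
    then have "P \<in> lower_span n (Suc r)" by simp
    then show ?thesis using in_vars_lower_span W_invariant_lower_span assms by (meson Suc_le_mono)
  qed
  then show ?thesis
    unfolding is_koornwinder_def span mE eig_val[OF assms] by blast
qed

lemma koornwinder_eqI:
  assumes "r \<le> n" "P - E_poly n r \<in> lower_span n r"
    and "\<And>x. regular_point n q x \<Longrightarrow> D P x = eig r * leval P x"
  shows "koornwinder n (one_column r) a b c d q t = P"
  unfolding koornwinder_def
proof (rule the_equality)
  show "is_koornwinder n (one_column r) a b c d q t P"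
    using assms by (simp add: is_koornwinder_iff)
next
  fix Q assume "is_koornwinder n (one_column r) a b c d q t Q"
  then have Q: "Q - E_poly n r \<in> lower_span n r" "\<And>x. regular_point n q x \<Longrightarrow> D Q x = eig r * leval Q x"
    using assms(1) by (auto simp: is_koornwinder_iff)
  have "(Q - E_poly n r) - (P - E_poly n r) \<in> lower_span n r"
    by (intro lower_span_diff Q assms)
  then have "Q - P \<in> lower_span n r" by simp
  moreover have "D (Q - P) x = eig r * leval (Q - P) x" if "regular_point n q x" for x
    using Q(2)[OF that] assms(3)[OF that] by (simp add: D_diff leval_diff algebra_simps)
  ultimately have "Q - P = 0" using eigen_unique[OF \<open>r \<le> n\<close>] by blast
  then show "Q = P" by simp
qed

text \<open>Applying the operator minus its eigenvalue to the partial sum over \<open>j \<le> m\<close> leaves the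
  multiple \<open>S m\<close> of the last defect, so the whole sum is an eigenfunction.\<close>

lemma eigenfunction:
  assumes "r \<le> n" and "S 0 = 1" "w 0 = 1"
    and step: "\<And>m. 2 * m + 2 \<le> r \<Longrightarrow> S (Suc m) = S m * f (r - 2 * m - 2) + w (Suc m)"
    and coef: "\<And>m. 2 * m + 2 \<le> r \<Longrightarrow> S m * g (r - 2 * m - 2) = w (Suc m) * (eig r - eig (r - 2 * m - 2))"
  defines "P \<equiv> \<Sum>j=0..r div 2. lconst (w j) * E_poly n (r - 2 * j)"
  shows "koornwinder n (one_column r) a b c d q t = P"
    and "P - E_poly n r \<in> lower_span n r"
    and "regular_point n q x \<Longrightarrow> D P x = eig r * leval P x"
proof -
  have partial: "(\<Sum>j\<le>m. w j * (D (E_poly n (r - 2 * j)) x - eig r * leval (E_poly n (r - 2 * j)) x)) =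
      S m * defect (r - 2 * m) x" if "2 * m \<le> r" "regular_point n q x" for m x
    using that(1)
  proof (induction m)
    case 0
    then show ?case using assms by (simp add: defect_def)
  next
    case (Suc m)
    define p where "p = r - 2 * m - 2"
    have p: "r - 2 * m = p + 2" "r - 2 * Suc m = p" using Suc.prems by (auto simp: p_def)
    have "defect (p + 2) x = f p * defect p x + g p * leval (E_poly n p) x"
      using defect_step[of p x] p assms(1) that(2) by simp
    then have "S m * defect (r - 2 * m) x = S m * f p * defect p x + S m * g p * leval (E_poly n p) x"
      unfolding p by (simp add: algebra_simps)
    moreover have "S m * g p = w (Suc m) * (eig r - eig p)" "S (Suc m) = S m * f p + w (Suc m)"
      using step[of m] coef[of m] Suc.prems by (auto simp: p_def)
    moreover have "w (Suc m) * (D (E_poly n p) x - eig r * leval (E_poly n p) x) =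
        w (Suc m) * defect p x - w (Suc m) * (eig r - eig p) * leval (E_poly n p) x"
      by (simp add: defect_def algebra_simps)
    moreover have "2 * m \<le> r" using Suc.prems by simp
    ultimately show ?case
      unfolding sum.atMost_Suc p(2) Suc.IH[OF \<open>2 * m \<le> r\<close>] by (simp only:) (simp add: algebra_simps)
  qed
  show ev: "D P x = eig r * leval P x" if "regular_point n q x" for x
  proof -
    have "D P x - eig r * leval P x =
        (\<Sum>j\<le>r div 2. w j * (D (E_poly n (r - 2 * j)) x - eig r * leval (E_poly n (r - 2 * j)) x))"
      unfolding P_def D_sum leval_sum leval_lconst_mult atLeast0AtMost
      by (simp add: sum_distrib_left sum_subtractf[symmetric] algebra_simps)
    also have "\<dots> = S (r div 2) * defect (r - 2 * (r div 2)) x" by (rule partial[OF _ that]) simp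
    \<comment> \<open>The last index is r mod 2, and the defects of E_0 and E_1 vanish.\<close>
    also have "\<dots> = 0" using defect_low[of "r - 2 * (r div 2)" x] that assms(1) by (simp add: minus_mult_div_eq_mod)
    finally show ?thesis by simp
  qed
  show low: "P - E_poly n r \<in> lower_span n r"
  proof -
    have "P = E_poly n r + (\<Sum>j=1..r div 2. lconst (w j) * E_poly n (r - 2 * j))"
      unfolding P_def using \<open>w 0 = 1\<close> by (simp add: sum.atLeast_Suc_atMost)
    moreover have "(\<Sum>j=1..r div 2. lconst (w j) * E_poly n (r - 2 * j)) \<in> lower_span n r"
      using assms(1) by (intro lower_span_sum lower_span_lconst E_poly_lower_span) auto
    ultimately show ?thesis by simp
  qed
  show "koornwinder n (one_column r) a b c d q t = P"
    by (rule koornwinder_eqI[OF \<open>r \<le> n\<close> low ev])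
qed

text \<open>Applying the operator minus \<open>eig r\<close> to the right side multiplies the
  summand P_(r-2j) by \<open>eig (r - 2 * j) - eig r\<close>. The assumption \<open>step\<close>
  says that the result is the defect of E_r, computed by the recurrence from the expansion of
  E_(r-2). The two sides then differ by an eigenfunction in the lower span, so
  \<open>eigen_unique\<close> applies.\<close>

lemma inverse_expansion:
  fixes P :: "nat \<Rightarrow> laurent" and w :: "nat \<Rightarrow> nat \<Rightarrow> complex"
  assumes P: "\<And>r. r \<le> n \<Longrightarrow> P r - E_poly n r \<in> lower_span n r"
      "\<And>r x. r \<le> n \<Longrightarrow> regular_point n q x \<Longrightarrow> D (P r) x = eig r * leval (P r) x"
    and w0: "\<And>r. w r 0 = 1"
    and step: "\<And>r m. r + 2 \<le> n \<Longrightarrow> 2 * m \<le> r \<Longrightarrow>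
      w (r + 2) (Suc m) * (eig (r - 2 * m) - eig (r + 2)) =
      w r m * (f r * (eig (r - 2 * m) - eig r) + g r)"
  shows "r \<le> n \<Longrightarrow> E_poly n r = (\<Sum>j=0..r div 2. lconst (w r j) * P (r - 2 * j))"
proof (induction r rule: less_induct)
  case (less r)
  define F where "F = (\<Sum>j=0..r div 2. lconst (w r j) * P (r - 2 * j))"
  have Plow: "P s \<in> lower_span n r" if "s < r" for s
  proof -
    have "P s - E_poly n s + E_poly n s \<in> lower_span n r"
      using that less.prems
      by (intro lower_span_add lower_span_mono[OF _ P(1)] E_poly_lower_span) auto
    then show ?thesis by simp
  qed
  have F: "F = P r + (\<Sum>j=1..r div 2. lconst (w r j) * P (r - 2 * j))"
    unfolding F_def using w0 by (simp add: sum.atLeast_Suc_atMost)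
  have "(\<Sum>j=1..r div 2. lconst (w r j) * P (r - 2 * j)) \<in> lower_span n r"
    by (intro lower_span_sum lower_span_lconst Plow) auto
  then have "(P r - E_poly n r) + (\<Sum>j=1..r div 2. lconst (w r j) * P (r - 2 * j)) \<in> lower_span n r"
    by (intro lower_span_add P less.prems)
  then have low: "F - E_poly n r \<in> lower_span n r" unfolding F by (simp add: algebra_simps)
  have "D (F - E_poly n r) x = eig r * leval (F - E_poly n r) x" if x: "regular_point n q x" for x
  proof -
    have DF: "D F x - eig r * leval F x =
        (\<Sum>j=0..r div 2. w r j * (eig (r - 2 * j) - eig r) * leval (P (r - 2 * j)) x)"
      unfolding F_def D_sum leval_sum leval_lconst_mult sum_distrib_left sum_subtractf[symmetric]
      using P(2) x less.prems by (intro sum.cong refl) (simp add: algebra_simps)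
    have "D F x - eig r * leval F x = defect r x"
    proof (cases "r < 2")
      case True
      then have "r div 2 = 0" by simp
      then show ?thesis using DF defect_low[OF True less.prems x] by simp
    next
      case False
      then obtain p where p: "r = p + 2" by (metis add.commute le_Suc_ex not_le)
      have IH: "E_poly n p = (\<Sum>j=0..p div 2. lconst (w p j) * P (p - 2 * j))"
        using less.IH[of p] less.prems p by simp
      have dp: "defect p x = (\<Sum>j=0..p div 2. w p j * (eig (p - 2 * j) - eig p) * leval (P (p - 2 * j)) x)"
        unfolding defect_def IH D_sum leval_sum leval_lconst_mult sum_distrib_left sum_subtractf[symmetric]
        using P(2) x less.prems p by (intro sum.cong refl) (simp add: algebra_simps)
      have "defect r x = f p * defect p x + g p * leval (E_poly n p) x"
        using defect_step[of p x] less.prems p x by simp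
      also have "\<dots> = (\<Sum>j=0..p div 2. w p j * (f p * (eig (p - 2 * j) - eig p) + g p) * leval (P (p - 2 * j)) x)"
        unfolding dp unfolding IH leval_sum leval_lconst_mult sum_distrib_left sum.distrib[symmetric]
        by (intro sum.cong refl) (simp add: algebra_simps)
      also have "\<dots> = (\<Sum>j=0..p div 2. w r (Suc j) * (eig (r - 2 * Suc j) - eig r) * leval (P (r - 2 * Suc j)) x)"
        using step[of p] less.prems p by (intro sum.cong refl) auto
      also have "\<dots> = (\<Sum>j=Suc 0..Suc (p div 2). w r j * (eig (r - 2 * j) - eig r) * leval (P (r - 2 * j)) x)"
        by (rule sum.shift_bounds_cl_Suc_ivl[symmetric])
      also have "Suc (p div 2) = r div 2" using p by simp
      \<comment> \<open>The summand j = 0 may be added because it contains eig r - eig r.\<close>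
      also have "(\<Sum>j=Suc 0..r div 2. w r j * (eig (r - 2 * j) - eig r) * leval (P (r - 2 * j)) x) =
          (\<Sum>j=0..r div 2. w r j * (eig (r - 2 * j) - eig r) * leval (P (r - 2 * j)) x)"
        by (simp add: sum.atLeast_Suc_atMost)
      also have "\<dots> = D F x - eig r * leval F x" by (rule DF[symmetric])
      finally show ?thesis by simp
    qed
    then show ?thesis by (simp add: D_diff leval_diff defect_def algebra_simps)
  qed
  with low less.prems have "F - E_poly n r = 0" by (intro eigen_unique[of r _ r]) auto
  then show ?case by (simp add: F_def)
qed

end

subsection \<open>The coefficients\<close>

lemma qpoch_Suc: "qpoch z p (Suc m) = qpoch z p m * (1 - p ^ m * z)"
  by (simp add: qpoch_def)

lemma qpoch_Suc_shift: "qpoch z p (Suc m) = (1 - z) * qpoch (p * z) p m"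
  by (simp add: qpoch_def prod.lessThan_Suc_shift mult_ac del: prod.lessThan_Suc)

text \<open>Absorbs the power (qt)^j or q^j of the coefficients into the Pochhammer symbol whose
  argument has qt or q in its denominator.\<close>

lemma scaled_qpoch: "s \<noteq> 0 \<Longrightarrow> qpoch (z / s) p m * s ^ m = (\<Prod>i<m. s - p ^ i * z)"
  by (induction m) (simp_all add: qpoch_def field_simps)

text \<open>Cancellation becomes a statement about limits: a function continuous at the point and
  equal to \<open>f\<close> around it supplies the value.\<close>

lemma remove_sings_eq_at:
  assumes "eventually (\<lambda>u. f u = g u) (at z)" and "isCont g z"
  shows "remove_sings f z = g z"
proof (rule remove_sings_eqI)
  show "f \<midarrow>z\<rightarrow> g z"
    using assms unfolding isCont_def by (subst tendsto_cong)
qed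

text \<open>\<open>term_CC\<close> and \<open>term_DD\<close> are the coefficients as functions of \<open>u\<close> after cancellation.  \<open>sum_CC\<close>, and
  \<open>sum_DD\<close> times \<open>(1 + u)/(1 + ut\<^sup>2\<^sup>m)\<close>, are the corresponding multipliers \<open>S\<close> in the lemma
  \<open>eigenfunction\<close>.\<close>

definition sum_CC :: "complex \<Rightarrow> complex \<Rightarrow> complex \<Rightarrow> nat \<Rightarrow> complex" where
  "sum_CC q t u m = (\<Prod>i\<in>{1..m}. (q * t - (t\<^sup>2) ^ i) * (1 - u\<^sup>2 * (t\<^sup>2) ^ i) /
     ((1 - (t\<^sup>2) ^ i) * (1 - q * t * u\<^sup>2 * (t\<^sup>2) ^ i)))"

fun term_CC :: "complex \<Rightarrow> complex \<Rightarrow> complex \<Rightarrow> nat \<Rightarrow> complex" where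
  "term_CC q t u 0 = 1"
| "term_CC q t u (Suc m) = sum_CC q t u m * ((q * t - 1) * (1 - u\<^sup>2 * ((t\<^sup>2) ^ Suc m)\<^sup>2) /
     ((1 - (t\<^sup>2) ^ Suc m) * (1 - q * t * u\<^sup>2 * (t\<^sup>2) ^ Suc m)))"

definition sum_DD :: "complex \<Rightarrow> complex \<Rightarrow> complex \<Rightarrow> nat \<Rightarrow> complex" where
  "sum_DD q t u m = (\<Prod>i\<in>{1..m}. (q - t * (t\<^sup>2) ^ i) * (1 - u\<^sup>2 * (t\<^sup>2) ^ i) /
     ((1 - (t\<^sup>2) ^ i) * (1 - q / t * u\<^sup>2 * (t\<^sup>2) ^ i)))"

fun term_DD :: "complex \<Rightarrow> complex \<Rightarrow> complex \<Rightarrow> nat \<Rightarrow> complex" where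
  "term_DD q t u 0 = 1"
| "term_DD q t u (Suc m) = sum_DD q t u m * ((1 + u) * (q - t) * (1 - u * (t\<^sup>2) ^ Suc m) /
     ((1 - (t\<^sup>2) ^ Suc m) * (1 - q / t * u\<^sup>2 * (t\<^sup>2) ^ Suc m)))"

lemma sum_CC_Suc: "sum_CC q t u (Suc m) = sum_CC q t u m *
    ((q * t - (t\<^sup>2) ^ Suc m) * (1 - u\<^sup>2 * (t\<^sup>2) ^ Suc m) /
     ((1 - (t\<^sup>2) ^ Suc m) * (1 - q * t * u\<^sup>2 * (t\<^sup>2) ^ Suc m)))"
  unfolding sum_CC_def by (subst prod.nat_ivl_Suc') (simp_all add: mult.commute)

lemma sum_DD_Suc: "sum_DD q t u (Suc m) = sum_DD q t u m *
    ((q - t * (t\<^sup>2) ^ Suc m) * (1 - u\<^sup>2 * (t\<^sup>2) ^ Suc m) /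
     ((1 - (t\<^sup>2) ^ Suc m) * (1 - q / t * u\<^sup>2 * (t\<^sup>2) ^ Suc m)))"
  unfolding sum_DD_def by (subst prod.nat_ivl_Suc') (simp_all add: mult.commute)

text \<open>The first factor of (u^2; t^2)_j is 1 - u^2 and cancels the denominator. The other
  Pochhammer factors, apart from the first of (1/(qt); t^2)_j and the last ones in the denominator,
  form \<open>sum_CC\<close> at j - 1.\<close>

lemma term_CC_generic:
  assumes "u\<^sup>2 \<noteq> 1" and q: "q \<noteq> 0" and t: "t \<noteq> 0"
  shows "(qpoch (1 / (q * t)) (t\<^sup>2) j * qpoch (u\<^sup>2) (t\<^sup>2) j) /
     (qpoch (t\<^sup>2) (t\<^sup>2) j * qpoch (q * u\<^sup>2 * t ^ 3) (t\<^sup>2) j) *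
     ((1 - u\<^sup>2 * t ^ (4 * j)) / (1 - u\<^sup>2)) * (q * t) ^ j = term_CC q t u j"
proof (cases j)
  case 0
  then show ?thesis using assms by (simp add: qpoch_def)
next
  case (Suc m)
  define Q where "Q = t\<^sup>2"
  define w where "w = u\<^sup>2"
  have "qpoch (1 / (q * t)) Q j * (q * t) ^ j = (\<Prod>i<j. q * t - Q ^ i * 1)"
    by (rule scaled_qpoch) (use q t in auto)
  also have "\<dots> = (q * t - 1) * (\<Prod>i\<in>{1..m}. q * t - Q ^ i)"
    unfolding Suc by (subst prod.lessThan_Suc_shift) (simp add: prod.atLeast1_atMost_eq)
  finally have 1: "qpoch (1 / (q * t)) Q j * (q * t) ^ j = (q * t - 1) * (\<Prod>i\<in>{1..m}. q * t - Q ^ i)" .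
  have 2: "qpoch w Q j = (1 - w) * (\<Prod>i\<in>{1..m}. 1 - w * Q ^ i)"
    unfolding Suc qpoch_def by (subst prod.lessThan_Suc_shift) (simp add: prod.atLeast1_atMost_eq mult_ac)
  have 3: "qpoch Q Q j = (\<Prod>i\<in>{1..m}. 1 - Q ^ i) * (1 - Q ^ Suc m)"
    unfolding Suc qpoch_def by (simp add: prod.atLeast1_atMost_eq mult_ac)
  have 4: "qpoch (q * w * t ^ 3) Q j = (\<Prod>i\<in>{1..m}. 1 - q * t * w * Q ^ i) * (1 - q * t * w * Q ^ Suc m)"
  proof -
    have eq: "q * w * t ^ 3 = q * t * w * Q" by (simp add: Q_def power2_eq_square power3_eq_cube)
    show ?thesis
      unfolding eq Suc qpoch_def by (simp add: prod.atLeast1_atMost_eq mult_ac)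
  qed
  have 5: "t ^ (4 * j) = (Q ^ Suc m)\<^sup>2"
  proof -
    have "4 * j = 2 * Suc m * 2" using Suc by simp
    then show ?thesis by (simp only: power_mult Q_def)
  qed
  have w: "1 - w \<noteq> 0" using assms by (simp add: w_def)
  have 6: "sum_CC q t u m = ((\<Prod>i\<in>{1..m}. q * t - Q ^ i) * (\<Prod>i\<in>{1..m}. 1 - w * Q ^ i)) /
      ((\<Prod>i\<in>{1..m}. 1 - Q ^ i) * (\<Prod>i\<in>{1..m}. 1 - q * t * w * Q ^ i))"
    unfolding sum_CC_def Q_def[symmetric] w_def[symmetric] by (simp only: prod_dividef prod.distrib)
  have "(qpoch (1 / (q * t)) Q j * qpoch w Q j) / (qpoch Q Q j * qpoch (q * w * t ^ 3) Q j) *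
     ((1 - w * t ^ (4 * j)) / (1 - w)) * (q * t) ^ j =
     (qpoch (1 / (q * t)) Q j * (q * t) ^ j) * qpoch w Q j / (qpoch Q Q j * qpoch (q * w * t ^ 3) Q j) *
     ((1 - w * t ^ (4 * j)) / (1 - w))" by (simp add: mult_ac)
  also have "\<dots> = term_CC q t u j"
    unfolding 1 2 3 4 5 unfolding Suc term_CC.simps 6 Q_def[symmetric] w_def[symmetric]
    using w by (simp add: mult_ac)
  finally show ?thesis by (simp only: Q_def w_def)
qed

text \<open>Here 1 - u^2 = (1 - u)(1 + u) is cancelled only in part, which leaves the factor 1 + u
  in \<open>term_DD\<close>.\<close>

lemma term_DD_generic:
  assumes "u \<noteq> 1" and q: "q \<noteq> 0" and t: "t \<noteq> 0"
  shows "(qpoch (t / q) (t\<^sup>2) j * qpoch (u\<^sup>2) (t\<^sup>2) j) /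
     (qpoch (t\<^sup>2) (t\<^sup>2) j * qpoch (q * u\<^sup>2 * t) (t\<^sup>2) j) *
     ((1 - u * t ^ (2 * j)) / (1 - u)) * q ^ j = term_DD q t u j"
proof (cases j)
  case 0
  then show ?thesis using assms by (simp add: qpoch_def)
next
  case (Suc m)
  define Q where "Q = t\<^sup>2"
  define w where "w = u\<^sup>2"
  have "qpoch (t / q) Q j * q ^ j = (\<Prod>i<j. q - Q ^ i * t)"
    by (rule scaled_qpoch) (rule q)
  also have "\<dots> = (q - t) * (\<Prod>i\<in>{1..m}. q - t * Q ^ i)"
    unfolding Suc by (subst prod.lessThan_Suc_shift) (simp add: prod.atLeast1_atMost_eq mult_ac)
  finally have 1: "qpoch (t / q) Q j * q ^ j = (q - t) * (\<Prod>i\<in>{1..m}. q - t * Q ^ i)" .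
  have 2: "qpoch w Q j = (1 - w) * (\<Prod>i\<in>{1..m}. 1 - w * Q ^ i)"
    unfolding Suc qpoch_def by (subst prod.lessThan_Suc_shift) (simp add: prod.atLeast1_atMost_eq mult_ac)
  have 3: "qpoch Q Q j = (\<Prod>i\<in>{1..m}. 1 - Q ^ i) * (1 - Q ^ Suc m)"
    unfolding Suc qpoch_def by (simp add: prod.atLeast1_atMost_eq mult_ac)
  have 4: "qpoch (q * w * t) Q j = (\<Prod>i\<in>{1..m}. 1 - q / t * w * Q ^ i) * (1 - q / t * w * Q ^ Suc m)"
  proof -
    have eq: "q * w * t = q / t * w * Q" using t by (simp add: Q_def power2_eq_square)
    show ?thesis
      unfolding eq Suc qpoch_def by (simp add: prod.atLeast1_atMost_eq mult_ac)
  qed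
  have 5: "t ^ (2 * j) = Q ^ Suc m"
    unfolding Suc Q_def power_mult ..
  have w: "1 - u \<noteq> 0" "1 - w = (1 - u) * (1 + u)" using assms by (simp_all add: w_def power2_eq_square algebra_simps)
  have 6: "sum_DD q t u m = ((\<Prod>i\<in>{1..m}. q - t * Q ^ i) * (\<Prod>i\<in>{1..m}. 1 - w * Q ^ i)) /
      ((\<Prod>i\<in>{1..m}. 1 - Q ^ i) * (\<Prod>i\<in>{1..m}. 1 - q / t * w * Q ^ i))"
    unfolding sum_DD_def Q_def[symmetric] w_def[symmetric] by (simp only: prod_dividef prod.distrib)
  have "(qpoch (t / q) Q j * qpoch w Q j) / (qpoch Q Q j * qpoch (q * w * t) Q j) *
     ((1 - u * t ^ (2 * j)) / (1 - u)) * q ^ j =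
     (qpoch (t / q) Q j * q ^ j) * qpoch w Q j / (qpoch Q Q j * qpoch (q * w * t) Q j) *
     ((1 - u * t ^ (2 * j)) / (1 - u))" by (simp add: mult_ac)
  also have "\<dots> = term_DD q t u j"
    unfolding 1 2 3 4 5 w(2) unfolding Suc term_DD.simps 6 Q_def[symmetric] w_def[symmetric]
    using w(1) by (simp add: mult_ac)
  finally show ?thesis by (simp only: Q_def w_def)
qed

text \<open>The two forms agree away from u = 1 and u = -1, and genericity makes the cancelled form
  continuous at u = t^(n - r), including u = 1 for r = n.\<close>

lemma coeff_CC_eq:
  assumes q: "q \<noteq> 0" and t: "t \<noteq> 0" "\<And>k::nat. k \<ge> 1 \<Longrightarrow> t ^ k \<noteq> 1"
    and qt: "\<And>k::nat. k \<ge> 1 \<Longrightarrow> q * t ^ k \<noteq> 1"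
  shows "coeff_CC n r j q t = term_CC q t (t ^ (n - r)) j"
  unfolding coeff_CC_def
proof (rule remove_sings_eq_at)
  have "eventually (\<lambda>u. u \<notin> {1, -1}) (at (t ^ (n - r)))"
    by (rule eventually_notin_finite) simp
  then show "\<forall>\<^sub>F u in at (t ^ (n - r)). (qpoch (1 / (q * t)) (t\<^sup>2) j * qpoch (u\<^sup>2) (t\<^sup>2) j) /
     (qpoch (t\<^sup>2) (t\<^sup>2) j * qpoch (q * u\<^sup>2 * t ^ 3) (t\<^sup>2) j) *
     ((1 - u\<^sup>2 * t ^ (4 * j)) / (1 - u\<^sup>2)) * (q * t) ^ j = term_CC q t u j"
    by eventually_elim (rule term_CC_generic, use q t in \<open>auto simp: power2_eq_1_iff\<close>)
  have nz: "1 - (t\<^sup>2) ^ i \<noteq> 0" if "i \<ge> 1" for i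
    using t(2)[of "2 * i"] that by (simp add: power_mult)
  have nz': "1 - q * t * (t ^ (n - r))\<^sup>2 * (t\<^sup>2) ^ i \<noteq> 0" for i
  proof -
    have "q * t * (t ^ (n - r))\<^sup>2 * (t\<^sup>2) ^ i = q * t ^ (1 + (n - r) * 2 + 2 * i)"
      by (simp only: power_add power_mult power_one_right mult.assoc)
    moreover have "q * t ^ (1 + (n - r) * 2 + 2 * i) \<noteq> 1" by (rule qt) simp
    ultimately show ?thesis by (metis right_minus_eq)
  qed
  have S: "isCont (\<lambda>u. sum_CC q t u m) (t ^ (n - r))" for m
    unfolding sum_CC_def by (intro continuous_intros) (use nz nz' in auto)
  show "isCont (\<lambda>u. term_CC q t u j) (t ^ (n - r))"
  proof (cases j)
    case (Suc m)
    show ?thesis unfolding Suc term_CC.simps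
      by (intro continuous_intros S) (use nz[of "Suc m"] nz'[of "Suc m"] in \<open>simp del: power_Suc\<close>)
  qed simp
qed

lemma coeff_DD_eq:
  assumes q: "q \<noteq> 0" and t: "t \<noteq> 0" "\<And>k::nat. k \<ge> 1 \<Longrightarrow> t ^ k \<noteq> 1"
    and qt: "\<And>k::nat. k \<ge> 1 \<Longrightarrow> q * t ^ k \<noteq> 1"
  shows "coeff_DD n r j q t = term_DD q t (t ^ (n - r)) j"
  unfolding coeff_DD_def
proof (rule remove_sings_eq_at)
  have "eventually (\<lambda>u. u \<notin> {1}) (at (t ^ (n - r)))"
    by (rule eventually_notin_finite) simp
  then show "\<forall>\<^sub>F u in at (t ^ (n - r)). (qpoch (t / q) (t\<^sup>2) j * qpoch (u\<^sup>2) (t\<^sup>2) j) /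
     (qpoch (t\<^sup>2) (t\<^sup>2) j * qpoch (q * u\<^sup>2 * t) (t\<^sup>2) j) *
     ((1 - u * t ^ (2 * j)) / (1 - u)) * q ^ j = term_DD q t u j"
    by eventually_elim (rule term_DD_generic, use q t in auto)
  have nz: "1 - (t\<^sup>2) ^ i \<noteq> 0" if "i \<ge> 1" for i
    using t(2)[of "2 * i"] that by (simp add: power_mult)
  \<comment> \<open>As i is at least 1, a factor t^2 is available to absorb the division by t, so
    that \<open>qt\<close> applies.\<close>
  have nz': "1 - q / t * (t ^ (n - r))\<^sup>2 * (t\<^sup>2) ^ i \<noteq> 0" if i1: "i \<ge> 1" for i
  proof -
    obtain i' where i: "i = Suc i'" using i1 by (cases i) auto
    have "q / t * (t ^ (n - r))\<^sup>2 * (t\<^sup>2) ^ i = q * t * (t ^ (n - r))\<^sup>2 * (t\<^sup>2) ^ i'"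
      using t by (simp add: i power2_eq_square)
    also have "\<dots> = q * t ^ (1 + (n - r) * 2 + 2 * i')"
      by (simp only: power_add power_mult power_one_right mult.assoc)
    also have "\<dots> \<noteq> 1" by (rule qt) simp
    finally show ?thesis by (metis right_minus_eq)
  qed
  have S: "isCont (\<lambda>u. sum_DD q t u m) (t ^ (n - r))" for m
    unfolding sum_DD_def by (intro continuous_intros) (use nz nz' in auto)
  show "isCont (\<lambda>u. term_DD q t u j) (t ^ (n - r))"
  proof (cases j)
    case (Suc m)
    show ?thesis unfolding Suc term_DD.simps
      by (intro continuous_intros S) (use nz[of "Suc m"] nz'[of "Suc m"] in \<open>simp del: power_Suc\<close>)
  qed simp
qed

text \<open>Replacing (r, m) by (r + 2, m + 1) lowers the exponents in the r-dependent symbols by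
  two, so these gain a factor at the front, while (qt; t^2) and (t^2; t^2) gain one at the end. The
  ratio is therefore a single quotient of factors.\<close>

lemma coeff_CC_inv_step:
  fixes q t :: complex
  assumes t: "t \<noteq> 0" and "r + 2 \<le> n"
  defines "U \<equiv> t ^ n / t ^ (r + 2)"
  shows "coeff_CC_inv n (r + 2) (Suc m) q t = coeff_CC_inv n r m q t *
    ((1 - q * t * (t\<^sup>2) ^ m) * (1 - U\<^sup>2 * (t\<^sup>2)\<^sup>2 * (t\<^sup>2) ^ m) /
      ((1 - t\<^sup>2 * (t\<^sup>2) ^ m) * (1 - q * t * U\<^sup>2 * t\<^sup>2 * (t\<^sup>2) ^ m)))"
proof -
  define Q where "Q = t\<^sup>2"
  have U: "U = t ^ (n - (r + 2))" unfolding U_def using assms by (simp add: power_diff)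
  have a: "t powi (2 * int n - 2 * int (r + 2) + 2 * int (Suc m) + 2) = U\<^sup>2 * Q\<^sup>2 * Q ^ m"
  proof -
    have "2 * int n - 2 * int (r + 2) + 2 * int (Suc m) + 2 = int ((n - (r + 2)) * 2 + 2 * 2 + 2 * m)"
      using assms by simp
    then show ?thesis unfolding U Q_def by (simp only: power_int_of_nat power_add power_mult)
  qed
  have b: "t powi (2 * int n - 2 * int r + 2 * int m + 2) = Q * (U\<^sup>2 * Q\<^sup>2 * Q ^ m)"
  proof -
    have "2 * int n - 2 * int r + 2 * int m + 2 = int (2 + ((n - (r + 2)) * 2 + 2 * 2 + 2 * m))"
      using assms by simp
    then show ?thesis unfolding U Q_def by (simp only: power_int_of_nat power_add power_mult)
  qed
  have c: "q * t powi (2 * int n - 2 * int (r + 2) + 2 * int (Suc m) + 1) = q * t * U\<^sup>2 * Q * Q ^ m"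
  proof -
    have "2 * int n - 2 * int (r + 2) + 2 * int (Suc m) + 1 = int (1 + (n - (r + 2)) * 2 + 2 + 2 * m)"
      using assms by simp
    then show ?thesis unfolding U Q_def
      by (simp only: power_int_of_nat power_add power_mult power_one_right mult.assoc)
  qed
  have d: "q * t powi (2 * int n - 2 * int r + 2 * int m + 1) = Q * (q * t * U\<^sup>2 * Q * Q ^ m)"
  proof -
    have "2 * int n - 2 * int r + 2 * int m + 1 = int (2 + (1 + (n - (r + 2)) * 2 + 2 + 2 * m))"
      using assms by simp
    then show ?thesis unfolding U Q_def
      by (simp only: power_int_of_nat power_add power_mult power_one_right) (simp only: mult_ac)
  qed
  show ?thesis
    unfolding coeff_CC_inv_def a b c d Q_def[symmetric]
    by (simp only: qpoch_Suc_shift[of "U\<^sup>2 * Q\<^sup>2 * Q ^ m"] qpoch_Suc_shift[of "q * t * U\<^sup>2 * Q * Q ^ m"]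
        qpoch_Suc[of "q * t"] qpoch_Suc[of Q]) (simp add: mult_ac)
qed

text \<open>In addition to the front and end factors of the symbols, the quotient (1 + t^(n-r))/(1 +
  t^(n-r+2j)) changes only in its numerator, because n - r + 2j is unchanged. Together with t^j this
  contributes exactly the multiplier \<open>f\<close>.\<close>

lemma coeff_DD_inv_step:
  fixes q t :: complex
  assumes t: "t \<noteq> 0" "\<And>k. 1 + t ^ k \<noteq> 0" and "r + 2 \<le> n"
  defines "U \<equiv> t ^ n / t ^ (r + 2)"
  shows "coeff_DD_inv n (r + 2) (Suc m) q t = coeff_DD_inv n r m q t * (t * (1 + U) / (1 + U * t\<^sup>2) *
    ((1 - q / t * (t\<^sup>2) ^ m) * (1 - U\<^sup>2 * (t\<^sup>2)\<^sup>2 * (t\<^sup>2) ^ m) /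
      ((1 - t\<^sup>2 * (t\<^sup>2) ^ m) * (1 - q / t * U\<^sup>2 * t\<^sup>2 * (t\<^sup>2) ^ m))))"
proof -
  define Q where "Q = t\<^sup>2"
  have U: "U = t ^ (n - (r + 2))" unfolding U_def using assms by (simp add: power_diff)
  have a: "t powi (2 * int n - 2 * int (r + 2) + 2 * int (Suc m) + 2) = U\<^sup>2 * Q\<^sup>2 * Q ^ m"
  proof -
    have "2 * int n - 2 * int (r + 2) + 2 * int (Suc m) + 2 = int ((n - (r + 2)) * 2 + 2 * 2 + 2 * m)"
      using assms by simp
    then show ?thesis unfolding U Q_def by (simp only: power_int_of_nat power_add power_mult)
  qed
  have b: "t powi (2 * int n - 2 * int r + 2 * int m + 2) = Q * (U\<^sup>2 * Q\<^sup>2 * Q ^ m)"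
  proof -
    have "2 * int n - 2 * int r + 2 * int m + 2 = int (2 + ((n - (r + 2)) * 2 + 2 * 2 + 2 * m))"
      using assms by simp
    then show ?thesis unfolding U Q_def by (simp only: power_int_of_nat power_add power_mult)
  qed
  have c: "q * t powi (2 * int n - 2 * int (r + 2) + 2 * int (Suc m) - 1) = q / t * U\<^sup>2 * Q * Q ^ m"
  proof -
    have eq: "2 * int n - 2 * int (r + 2) + 2 * int (Suc m) - 1 = int ((n - (r + 2)) * 2 + 2 + 2 * m) - 1"
      using assms by simp
    have p: "t powi (int k - 1) = t ^ k / t" for k using t(1) by (simp add: power_int_diff)
    show ?thesis unfolding eq p U Q_def by (simp only: power_add power_mult) simp
  qed
  have d: "q * t powi (2 * int n - 2 * int r + 2 * int m - 1) = Q * (q / t * U\<^sup>2 * Q * Q ^ m)"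
  proof -
    have eq: "2 * int n - 2 * int r + 2 * int m - 1 = int (2 + ((n - (r + 2)) * 2 + 2 + 2 * m)) - 1"
      using assms by simp
    have p: "t powi (int k - 1) = t ^ k / t" for k using t(1) by (simp add: power_int_diff)
    show ?thesis unfolding eq p U Q_def by (simp only: power_add power_mult) simp
  qed
  have nr: "n - r = (n - (r + 2)) + 2" using assms by simp
  have e: "t ^ (n - (r + 2) + 2 * Suc m) = U * Q * Q ^ m" "t ^ (n - r) = U * Q" "t ^ (n - r + 2 * m) = U * Q * Q ^ m"
    "t ^ (n - (r + 2)) = U"
    unfolding nr U Q_def power_add power_mult by simp_all
  have nz: "1 + U * Q \<noteq> 0" using t(2)[of "n - r"] unfolding e(2) .
  have gen: "A / B * ((1 + U) / E) * (t * T) = A' / B' * ((1 + U * Q) / E) * T * (t * (1 + U) / (1 + U * Q) * (C / F))"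
    if "A = A' * C" "B = B' * F" for A B E T A' B' C F
    using nz unfolding that by (simp add: mult_ac)
  show ?thesis
    unfolding coeff_DD_inv_def a b c d e Q_def[symmetric] power_Suc
  proof (rule gen)
    show "qpoch (q / t) Q (Suc m) * qpoch (U\<^sup>2 * Q\<^sup>2 * Q ^ m) Q (Suc m) =
        qpoch (q / t) Q m * qpoch (Q * (U\<^sup>2 * Q\<^sup>2 * Q ^ m)) Q m *
          ((1 - q / t * Q ^ m) * (1 - U\<^sup>2 * Q\<^sup>2 * Q ^ m))"
      unfolding qpoch_Suc_shift[of "U\<^sup>2 * Q\<^sup>2 * Q ^ m"] qpoch_Suc[of "q / t"] by (simp add: mult_ac)
    show "qpoch Q Q (Suc m) * qpoch (q / t * U\<^sup>2 * Q * Q ^ m) Q (Suc m) =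
        qpoch Q Q m * qpoch (Q * (q / t * U\<^sup>2 * Q * Q ^ m)) Q m *
          ((1 - Q * Q ^ m) * (1 - q / t * U\<^sup>2 * Q * Q ^ m))"
      unfolding qpoch_Suc_shift[of "q / t * U\<^sup>2 * Q * Q ^ m"] qpoch_Suc[of Q] by (simp add: mult_ac)
  qed
qed

subsection \<open>The expansions\<close>

lemma column_operator_CC:
  assumes q: "q \<noteq> 0" and t: "t \<noteq> 0" "\<And>k::nat. k \<ge> 1 \<Longrightarrow> t ^ k \<noteq> 1"
    and qt: "\<And>k. q * t ^ k \<noteq> 1"
    and par: "\<And>z. (1 - a * z) * (1 - b * z) * (1 - c * z) * (1 - d * z) = (1 - t * z\<^sup>2) * (1 - q * t * z\<^sup>2)"
    and \<alpha>: "(koornwinder_alpha a b c d q)\<^sup>2 = t\<^sup>2"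
  shows "column_operator n a b c d q t (eigen n (koornwinder_alpha a b c d q) t q t) (\<lambda>_. 1)
    (\<lambda>r. kernel_const (koornwinder_alpha a b c d q) q t * (1 - q * t) * (t ^ r / t ^ n - t ^ n / t ^ r))"
proof -
  have \<alpha>0: "koornwinder_alpha a b c d q \<noteq> 0" using \<alpha> t by auto
  have t1: "t \<noteq> 1" "t\<^sup>2 \<noteq> 1" using t(2)[of 1] t(2)[of 2] by auto
  have q1: "q \<noteq> 1" using qt[of 0] by simp
  show ?thesis
  proof
    fix r x assume x: "regular_point n q x"
    note rec = recurrence_CC[OF x t(1) t1(2) q par \<alpha>0]
    show "koornwinder_op n a b c d q t (E_fun n r) x =
        eigen n (koornwinder_alpha a b c d q) t q t r * E_fun n r x" if "r < 2"
      using rec(1)[OF that] by simp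
    show "koornwinder_op n a b c d q t (E_fun n (r + 2)) x -
        eigen n (koornwinder_alpha a b c d q) t q t (r + 2) * E_fun n (r + 2) x =
      1 * (koornwinder_op n a b c d q t (E_fun n r) x -
        eigen n (koornwinder_alpha a b c d q) t q t r * E_fun n r x) +
      kernel_const (koornwinder_alpha a b c d q) q t * (1 - q * t) * (t ^ r / t ^ n - t ^ n / t ^ r) * E_fun n r x"
      using rec(2)[of r] by (simp only: mult_1_left)
  next
    fix r s assume rs: "s < r" "r \<le> n"
    have "q * t\<^sup>2 * t ^ k \<noteq> 1" for k using qt[of "2 + k"] by (simp only: power_add mult.assoc not_False_eq_True)
    then show "eigen n (koornwinder_alpha a b c d q) t q t r \<noteq> eigen n (koornwinder_alpha a b c d q) t q t s"
      by (intro eigen_neq rs t q q1 \<alpha>0)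
  qed (use q in \<open>auto intro!: koornwinder_eigenvalue_one_column t t1 \<alpha> \<alpha>0\<close>)
qed

lemma column_operator_DD:
  assumes q: "q \<noteq> 0" and t: "t \<noteq> 0" "\<And>k::nat. k \<ge> 1 \<Longrightarrow> t ^ k \<noteq> 1"
    and qt: "\<And>k. q * t ^ k \<noteq> 1"
    and par: "\<And>z. (1 - a * z) * (1 - b * z) * (1 - c * z) * (1 - d * z) = (1 - z\<^sup>2) * (1 - q * z\<^sup>2)"
    and \<alpha>: "(koornwinder_alpha a b c d q)\<^sup>2 = 1"
  shows "column_operator n a b c d q t (eigen n (koornwinder_alpha a b c d q) 1 q t)
    (\<lambda>r. t * (1 + t ^ n / t ^ (r + 2)) / (1 + t ^ n / t ^ (r + 2) * t\<^sup>2))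
    (\<lambda>r. kernel_const (koornwinder_alpha a b c d q) q t * (1 - q / t) * (1 + t ^ n / t ^ (r + 2)) *
      (1 / (t * (t ^ n / t ^ (r + 2))) - t))"
proof -
  have \<alpha>0: "koornwinder_alpha a b c d q \<noteq> 0" using \<alpha> by auto
  have t1: "t \<noteq> 1" "t\<^sup>2 \<noteq> 1" using t(2)[of 1] t(2)[of 2] by auto
  have q1: "q \<noteq> 1" using qt[of 0] by simp
  show ?thesis
  proof
    fix r x assume x: "regular_point n q x"
    show "koornwinder_op n a b c d q t (E_fun n r) x =
        eigen n (koornwinder_alpha a b c d q) 1 q t r * E_fun n r x" if "r < 2"
      using three_term_DD(1)[OF x t(1) t1(2) q par \<alpha>0 that] by simp
    show "koornwinder_op n a b c d q t (E_fun n (r + 2)) x -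
        eigen n (koornwinder_alpha a b c d q) 1 q t (r + 2) * E_fun n (r + 2) x =
      t * (1 + t ^ n / t ^ (r + 2)) / (1 + t ^ n / t ^ (r + 2) * t\<^sup>2) *
      (koornwinder_op n a b c d q t (E_fun n r) x -
        eigen n (koornwinder_alpha a b c d q) 1 q t r * E_fun n r x) +
      kernel_const (koornwinder_alpha a b c d q) q t * (1 - q / t) * (1 + t ^ n / t ^ (r + 2)) *
      (1 / (t * (t ^ n / t ^ (r + 2))) - t) * E_fun n r x" if "r + 2 \<le> n"
      by (rule recurrence_DD[OF x t q par \<alpha>0 that])
  next
    fix r s assume rs: "s < r" "r \<le> n"
    have "q * 1\<^sup>2 * t ^ k \<noteq> 1" for k using qt[of k] by simp
    then show "eigen n (koornwinder_alpha a b c d q) 1 q t r \<noteq> eigen n (koornwinder_alpha a b c d q) 1 q t s"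
      by (intro eigen_neq rs t q q1 \<alpha>0)
  next
    fix r assume "r \<le> n"
    then show "koornwinder_eigenvalue n (one_column r) a b c d q t = eigen n (koornwinder_alpha a b c d q) 1 q t r"
      by (intro koornwinder_eigenvalue_one_column t t1 q \<alpha>0) (simp_all only: \<alpha> power_one)
  qed (rule q)
qed

text \<open>The two assumptions of \<open>eigenfunction\<close> for beta = t. As the multiplier is 1
  there, \<open>sum_CC\<close> is the partial sum of the \<open>term_CC\<close>; the claim is that
  it has the product form.\<close>

lemma sum_CC_steps:
  fixes q t :: complex
  assumes t: "t \<noteq> 0" and r: "2 * m + 2 \<le> r" "r \<le> n"
    and nz: "1 - (t\<^sup>2) ^ Suc m \<noteq> 0" "1 - q * t * (t ^ (n - r))\<^sup>2 * (t\<^sup>2) ^ Suc m \<noteq> 0"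
  defines "u \<equiv> t ^ (n - r)" and "s \<equiv> r - 2 * m - 2"
  shows "sum_CC q t u (Suc m) = sum_CC q t u m + term_CC q t u (Suc m)"
    and "sum_CC q t u m * (kernel_const \<alpha> q t * (1 - q * t) * (t ^ s / t ^ n - t ^ n / t ^ s)) =
      term_CC q t u (Suc m) * (eigen n \<alpha> t q t r - eigen n \<alpha> t q t s)"
proof -
  define p where "p = (t\<^sup>2) ^ Suc m"
  define w where "w = u\<^sup>2"
  define S where "S = sum_CC q t u m"
  define k where "k = kernel_const \<alpha> q t"
  have nz: "1 - p \<noteq> 0" "1 - q * t * w * p \<noteq> 0" using nz by (simp_all add: p_def w_def u_def)
  \<comment> \<open>Divided by (1 - p)(1 - qtwp), this identity splits the last factor of the
    product into 1 and the factor of the new term.\<close>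
  have "(q * t - p) * (1 - w * p) = (1 - p) * (1 - q * t * w * p) + (q * t - 1) * (1 - w * p\<^sup>2)"
    by (simp add: algebra_simps power2_eq_square)
  then show "sum_CC q t u (Suc m) = sum_CC q t u m + term_CC q t u (Suc m)"
    unfolding sum_CC_Suc term_CC.simps p_def[symmetric] w_def[symmetric]
    using nz by (simp add: add_divide_distrib distrib_left)
  have u: "u = t ^ n / t ^ r" "u \<noteq> 0" using t r by (simp_all add: u_def power_diff)
  have p: "p \<noteq> 0" "p = t ^ (2 * Suc m)" unfolding p_def power_mult using t by auto
  have s: "s = r - 2 * Suc m" using r by (simp add: s_def)
  have "s + 2 * Suc m = r" using r by (simp add: s_def)
  then have "t ^ s * t ^ (2 * Suc m) = t ^ r" by (simp only: power_add[symmetric])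
  then have tr: "t ^ r = t ^ s * p" unfolding p(2) by simp
  have g: "t ^ n / t ^ s = u * p" "t ^ s / t ^ n = 1 / (u * p)"
    unfolding u(1) tr using t p by simp_all
  have qt: "q * t\<^sup>2 / t = q * t" using t by (simp add: power2_eq_square)
  have e: "eigen n \<alpha> t q t r - eigen n \<alpha> t q t s = - k * (1 - p) / (u * p) * (1 - q * t * w * p)"
    using eigen_diff[OF t, of "Suc m" r n \<alpha> t q] r unfolding s p(2)[symmetric] u(1)[symmetric] qt w_def k_def by simp
  have "S * (k * (1 - q * t) * (1 / (u * p) - u * p)) =
      S * ((q * t - 1) * (1 - w * p\<^sup>2) / ((1 - p) * (1 - q * t * w * p))) *
        (- k * (1 - p) / (u * p) * (1 - q * t * w * p))"
  proof -
    have "1 / (u * p) - u * p = (1 - w * p\<^sup>2) / (u * p)"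
      using u(2) p(1) by (simp add: w_def divide_simps power2_eq_square)
    moreover define y where "y = q * t - 1"
    moreover have "1 - q * t = - y" by (simp add: y_def)
    ultimately show ?thesis unfolding y_def[symmetric] using nz by (simp only:) (simp add: mult_ac)
  qed
  then show "sum_CC q t u m * (kernel_const \<alpha> q t * (1 - q * t) * (t ^ s / t ^ n - t ^ n / t ^ s)) =
      term_CC q t u (Suc m) * (eigen n \<alpha> t q t r - eigen n \<alpha> t q t s)"
    unfolding term_CC.simps p_def[symmetric] w_def[symmetric] S_def[symmetric] k_def[symmetric] e g .
qed

text \<open>The two assumptions of \<open>eigenfunction\<close> for beta = 1. The multipliers t(1 +
  u t^(2i))/(1 + u t^(2i+2)), i < m, telescope to t^m (1 + u)/(1 + u t^(2m)), which is where the
  factor in front of \<open>sum_DD\<close> comes from.\<close>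

lemma sum_DD_steps:
  fixes q t :: complex
  assumes t: "t \<noteq> 0" "\<And>k. 1 + t ^ k \<noteq> 0" and r: "2 * m + 2 \<le> r" "r \<le> n"
    and nz: "1 - (t\<^sup>2) ^ Suc m \<noteq> 0" "1 - q / t * (t ^ (n - r))\<^sup>2 * (t\<^sup>2) ^ Suc m \<noteq> 0"
  defines "u \<equiv> t ^ (n - r)" and "s \<equiv> r - 2 * m - 2"
  defines "S \<equiv> \<lambda>m. (1 + u) / (1 + u * (t\<^sup>2) ^ m) * sum_DD q t u m"
  shows "S (Suc m) = S m * (t * (1 + t ^ n / t ^ (s + 2)) / (1 + t ^ n / t ^ (s + 2) * t\<^sup>2)) +
      term_DD q t u (Suc m)"
    and "S m * (kernel_const \<alpha> q t * (1 - q / t) * (1 + t ^ n / t ^ (s + 2)) *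
      (1 / (t * (t ^ n / t ^ (s + 2))) - t)) =
      term_DD q t u (Suc m) * (eigen n \<alpha> 1 q t r - eigen n \<alpha> 1 q t s)"
proof -
  define M where "M = (t\<^sup>2) ^ m"
  define p where "p = (t\<^sup>2) ^ Suc m"
  define w where "w = u\<^sup>2"
  define R where "R = sum_DD q t u m"
  define k where "k = kernel_const \<alpha> q t"
  define v where "v = q / t"
  have qv: "q = t * v" using t by (simp add: v_def)
  have pM: "p = M * t\<^sup>2" by (simp add: p_def M_def mult.commute)
  have nz: "1 - p \<noteq> 0" "1 - v * w * p \<noteq> 0" using nz by (simp_all add: p_def w_def u_def v_def)
  have plus: "1 + u * M \<noteq> 0" "1 + u * p \<noteq> 0"
    using t(2)[of "n - r + 2 * m"] t(2)[of "n - r + 2 * Suc m"]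
    unfolding u_def M_def p_def power_add power_mult by auto
  have u: "u = t ^ n / t ^ r" "u \<noteq> 0" using t r by (simp_all add: u_def power_diff)
  have p: "p \<noteq> 0" "p = t ^ (2 * Suc m)" unfolding p_def power_mult using t by auto
  have M0: "M \<noteq> 0" using t by (simp add: M_def)
  have s: "s = r - 2 * Suc m" "s + 2 = r - 2 * m" using r by (simp_all add: s_def)
  have "t ^ (s + 2) * t ^ (2 * m) = t ^ r" unfolding s(2) power_add[symmetric] using r by simp
  then have tr: "t ^ r = t ^ (s + 2) * M" unfolding M_def power_mult by simp
  have g: "t ^ n / t ^ (s + 2) = u * M"
    unfolding u(1) tr using t M0 by simp
  have e: "eigen n \<alpha> 1 q t r - eigen n \<alpha> 1 q t s = - k * (1 - p) / (u * p) * (1 - v * w * p)"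
    using eigen_diff[OF t(1), of "Suc m" r n \<alpha> 1 q] r
    unfolding s(1) p(2)[symmetric] u(1)[symmetric] w_def k_def v_def by simp
  \<comment> \<open>The analogue of the splitting for beta = t: the first summand reproduces the
    previous partial sum times the multiplier, the second gives the new term.\<close>
  have id: "(q - t * p) * (1 - w * p) = t * (1 - p) * (1 - v * w * p) + (q - t) * (1 - u * p) * (1 + u * p)"
    unfolding qv w_def by (simp add: algebra_simps power2_eq_square)
  show "S (Suc m) = S m * (t * (1 + t ^ n / t ^ (s + 2)) / (1 + t ^ n / t ^ (s + 2) * t\<^sup>2)) +
      term_DD q t u (Suc m)"
  proof -
    have "(1 + u) / (1 + u * p) * (R * ((q - t * p) * (1 - w * p) / ((1 - p) * (1 - v * w * p)))) =
        (1 + u) / (1 + u * M) * R * (t * (1 + u * M) / (1 + u * p)) +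
        R * ((1 + u) * (q - t) * (1 - u * p) / ((1 - p) * (1 - v * w * p)))"
      unfolding id using nz plus by (simp add: divide_simps) (simp add: algebra_simps)
    then show ?thesis
      unfolding S_def sum_DD_Suc term_DD.simps p_def[symmetric] w_def[symmetric] M_def[symmetric] R_def[symmetric]
        v_def[symmetric] g pM by (simp add: mult.assoc)
  qed
  have "(1 + u) / (1 + u * M) * R * (k * (1 - v) * (1 + u * M) * (1 / (t * (u * M)) - t)) =
      R * ((1 + u) * (q - t) * (1 - u * p) / ((1 - p) * (1 - v * w * p))) *
        (- k * (1 - p) / (u * p) * (1 - v * w * p))"
  proof -
    have 1: "1 / (t * (u * M)) - t = t * (1 - u * p) / (u * p)"
      using u(2) M0 t(1) unfolding pM by (simp add: divide_simps power2_eq_square)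
    have 2: "(q - t) = - t * (1 - v)" unfolding qv by (simp add: algebra_simps)
    show ?thesis unfolding 1 2 using nz plus by (simp add: mult_ac)
  qed
  then show "S m * (kernel_const \<alpha> q t * (1 - q / t) * (1 + t ^ n / t ^ (s + 2)) *
      (1 / (t * (t ^ n / t ^ (s + 2))) - t)) =
      term_DD q t u (Suc m) * (eigen n \<alpha> 1 q t r - eigen n \<alpha> 1 q t s)"
    unfolding S_def term_DD.simps p_def[symmetric] w_def[symmetric] M_def[symmetric] R_def[symmetric] k_def[symmetric] v_def[symmetric] e g .
qed

lemma diff_flip: "x - y = - k * a / b * c \<Longrightarrow> y - x = k * a / b * c" for x :: complex
  using minus_diff_eq[of x y] by (simp only: minus_mult_left[symmetric] minus_divide_left[symmetric] minus_minus)

text \<open>The assumption \<open>step\<close> of \<open>inverse_expansion\<close>. The denominators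
  in the ratio of the coefficients cancel against the factored eigenvalue difference on the left,
  and only the polynomial identity \<open>id\<close> remains.\<close>

lemma inverse_step_CC:
  fixes q t :: complex
  assumes t: "t \<noteq> 0" and r: "r + 2 \<le> n" "2 * m \<le> r"
    and nz: "1 - t\<^sup>2 * (t\<^sup>2) ^ m \<noteq> 0" "1 - q * t * (t ^ n / t ^ (r + 2))\<^sup>2 * t\<^sup>2 * (t\<^sup>2) ^ m \<noteq> 0"
  shows "coeff_CC_inv n (r + 2) (Suc m) q t * (eigen n \<alpha> t q t (r - 2 * m) - eigen n \<alpha> t q t (r + 2)) =
    coeff_CC_inv n r m q t * (1 * (eigen n \<alpha> t q t (r - 2 * m) - eigen n \<alpha> t q t r) +
      kernel_const \<alpha> q t * (1 - q * t) * (t ^ r / t ^ n - t ^ n / t ^ r))"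
proof -
  define U where "U = t ^ n / t ^ (r + 2)"
  define w where "w = U\<^sup>2"
  define Q where "Q = t\<^sup>2"
  define M where "M = Q ^ m"
  define k where "k = kernel_const \<alpha> q t"
  have nz: "1 - Q * M \<noteq> 0" "1 - q * t * w * Q * M \<noteq> 0"
    using nz by (simp_all add: Q_def M_def w_def U_def)
  have n0: "U \<noteq> 0" "Q \<noteq> 0" "M \<noteq> 0" using t by (auto simp: U_def Q_def M_def)
  have qt: "q * t\<^sup>2 / t = q * t" using t by (simp add: power2_eq_square)
  have Ur: "t ^ n / t ^ r = U * Q" "t ^ r / t ^ n = 1 / (U * Q)"
    using t by (simp_all add: U_def Q_def power2_eq_square)
  have pM: "t ^ (2 * Suc m) = Q * M" "t ^ (2 * m) = M" unfolding power_mult Q_def M_def by simp_all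
  have sub: "r + 2 - 2 * Suc m = r - 2 * m" by simp
  have "eigen n \<alpha> t q t (r + 2) - eigen n \<alpha> t q t (r - 2 * m) =
      - k * (1 - Q * M) / (U * (Q * M)) * (1 - q * t * w * (Q * M))"
    using eigen_diff[OF t, of "Suc m" "r + 2" n \<alpha> t q] r
    unfolding sub pM U_def[symmetric] qt w_def[symmetric] k_def[symmetric] by simp
  note e1 = diff_flip[OF this]
  have "eigen n \<alpha> t q t r - eigen n \<alpha> t q t (r - 2 * m) =
      - k * (1 - M) / (U * Q * M) * (1 - q * t * (U * Q)\<^sup>2 * M)"
    using eigen_diff[OF t, of m r n \<alpha> t q] r
    unfolding pM Ur(1) qt k_def[symmetric] by simp
  note e2 = diff_flip[OF this]
  have id: "(1 - q * t * M) * (1 - w * Q\<^sup>2 * M) = (1 - M) * (1 - q * t * (U * Q)\<^sup>2 * M) + M * ((1 - q * t) * (1 - w * Q\<^sup>2))"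
    by (simp add: w_def algebra_simps power2_eq_square)
  have "(1 - q * t * M) * (1 - w * Q\<^sup>2 * M) / ((1 - Q * M) * (1 - q * t * w * Q * M)) *
      (k * (1 - Q * M) / (U * (Q * M)) * (1 - q * t * w * (Q * M))) =
      k / (U * Q * M) * ((1 - q * t * M) * (1 - w * Q\<^sup>2 * M))"
    using nz by (simp add: mult_ac)
  also have "\<dots> = 1 * (k * (1 - M) / (U * Q * M) * (1 - q * t * (U * Q)\<^sup>2 * M)) +
      k * (1 - q * t) * (1 / (U * Q) - U * Q)"
    unfolding id using n0 by (simp add: w_def divide_simps) (simp add: algebra_simps power2_eq_square)
  finally show ?thesis
    unfolding coeff_CC_inv_step[OF t r(1)] U_def[symmetric] w_def[symmetric] Q_def[symmetric] M_def[symmetric]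
      e1 e2 Ur k_def[symmetric] by (simp only: mult.assoc)
qed

text \<open>The same reduction for beta = 1; the multiplier occurs on both sides, already contained
  in the ratio of the coefficients.\<close>

lemma inverse_step_DD:
  fixes q t :: complex
  assumes t: "t \<noteq> 0" "\<And>k. 1 + t ^ k \<noteq> 0" and r: "r + 2 \<le> n" "2 * m \<le> r"
    and nz: "1 - t\<^sup>2 * (t\<^sup>2) ^ m \<noteq> 0" "1 - q / t * (t ^ n / t ^ (r + 2))\<^sup>2 * t\<^sup>2 * (t\<^sup>2) ^ m \<noteq> 0"
  shows "coeff_DD_inv n (r + 2) (Suc m) q t * (eigen n \<alpha> 1 q t (r - 2 * m) - eigen n \<alpha> 1 q t (r + 2)) =
    coeff_DD_inv n r m q t *
      (t * (1 + t ^ n / t ^ (r + 2)) / (1 + t ^ n / t ^ (r + 2) * t\<^sup>2) *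
        (eigen n \<alpha> 1 q t (r - 2 * m) - eigen n \<alpha> 1 q t r) +
      kernel_const \<alpha> q t * (1 - q / t) * (1 + t ^ n / t ^ (r + 2)) * (1 / (t * (t ^ n / t ^ (r + 2))) - t))"
proof -
  define U where "U = t ^ n / t ^ (r + 2)"
  define w where "w = U\<^sup>2"
  define Q where "Q = t\<^sup>2"
  define M where "M = Q ^ m"
  define k where "k = kernel_const \<alpha> q t"
  define v where "v = q / t"
  have nz: "1 - Q * M \<noteq> 0" "1 - v * w * Q * M \<noteq> 0"
    using nz by (simp_all add: Q_def M_def w_def U_def v_def)
  have n0: "U \<noteq> 0" "Q \<noteq> 0" "M \<noteq> 0" using t by (auto simp: U_def Q_def M_def)
  have Ur: "t ^ n / t ^ r = U * Q"
    using t by (simp add: U_def Q_def power2_eq_square)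
  have "U * Q = t ^ (n - r)" unfolding Ur[symmetric] using t r by (simp add: power_diff)
  then have plus: "1 + U * Q \<noteq> 0" using t(2) by simp
  have pM: "t ^ (2 * Suc m) = Q * M" "t ^ (2 * m) = M" unfolding power_mult Q_def M_def by simp_all
  have sub: "r + 2 - 2 * Suc m = r - 2 * m" by simp
  have "eigen n \<alpha> 1 q t (r + 2) - eigen n \<alpha> 1 q t (r - 2 * m) =
      - k * (1 - Q * M) / (U * (Q * M)) * (1 - v * w * (Q * M))"
    using eigen_diff[OF t(1), of "Suc m" "r + 2" n \<alpha> 1 q] r
    unfolding sub pM U_def[symmetric] w_def[symmetric] k_def[symmetric] power_one mult_1_right v_def[symmetric]
    by simp
  note e1 = diff_flip[OF this]
  have "eigen n \<alpha> 1 q t r - eigen n \<alpha> 1 q t (r - 2 * m) =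
      - k * (1 - M) / (U * Q * M) * (1 - v * (U * Q)\<^sup>2 * M)"
    using eigen_diff[OF t(1), of m r n \<alpha> 1 q] r
    unfolding pM Ur k_def[symmetric] power_one mult_1_right v_def[symmetric] by simp
  note e2 = diff_flip[OF this]
  have id: "(1 - v * M) * (1 - w * Q\<^sup>2 * M) = (1 - M) * (1 - v * (U * Q)\<^sup>2 * M) + M * ((1 - v) * (1 - w * Q\<^sup>2))"
    by (simp add: w_def algebra_simps power2_eq_square)
  have "t * (1 + U) / (1 + U * Q) *
      ((1 - v * M) * (1 - w * Q\<^sup>2 * M) / ((1 - Q * M) * (1 - v * w * Q * M))) *
      (k * (1 - Q * M) / (U * (Q * M)) * (1 - v * w * (Q * M))) =
      k * (t * (1 + U) / (1 + U * Q)) / (U * Q * M) * ((1 - v * M) * (1 - w * Q\<^sup>2 * M))"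
    using nz by (simp add: mult_ac)
  also have "\<dots> = t * (1 + U) / (1 + U * Q) * (k * (1 - M) / (U * Q * M) * (1 - v * (U * Q)\<^sup>2 * M)) +
      k * (1 - v) * (1 + U) * (t * (1 - w * Q\<^sup>2) / (U * Q * (1 + U * Q)))"
    unfolding id using n0 plus by (simp add: divide_simps) (simp add: algebra_simps)
  \<comment> \<open>The factor 1 + UQ of the difference of squares cancels the denominator of the
    multiplier, which turns the last term into the inhomogeneity.\<close>
  also have "t * (1 - w * Q\<^sup>2) / (U * Q * (1 + U * Q)) = 1 / (t * U) - t"
  proof -
    have "1 - w * Q\<^sup>2 = (1 - U * Q) * (1 + U * Q)" by (simp add: w_def algebra_simps power2_eq_square)
    then have "t * (1 - w * Q\<^sup>2) / (U * Q * (1 + U * Q)) = t * (1 - U * Q) / (U * Q)"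
      using plus by simp
    also have "\<dots> = 1 / (t * U) - t"
      using n0 t(1) by (simp add: Q_def divide_simps power2_eq_square)
    finally show ?thesis .
  qed
  finally show ?thesis
    unfolding coeff_DD_inv_step[OF t r(1)] U_def[symmetric] w_def[symmetric] Q_def[symmetric] M_def[symmetric]
      e1 e2 k_def[symmetric] v_def[symmetric] by (simp only: mult.assoc)
qed

lemma expansions_CC:
  fixes n r :: nat and q t :: complex
  assumes q: "q \<noteq> 0" "cmod q < 1" and t: "t \<noteq> 0" "\<And>k::nat. k \<ge> 1 \<Longrightarrow> t ^ k \<noteq> 1"
    and qt: "\<And>k::nat. k \<ge> 1 \<Longrightarrow> q * t ^ k \<noteq> 1" and "r \<le> n"
  shows "P_CC n (one_column r) t q t = (\<Sum>j=0..r div 2. lconst (coeff_CC n r j q t) * E_poly n (r - 2 * j))"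
    and "E_poly n r = (\<Sum>j=0..r div 2. lconst (coeff_CC_inv n r j q t) * P_CC n (one_column (r - 2 * j)) t q t)"
proof -
  define a b c d where "a = csqrt t" and "b = - csqrt t" and "c = csqrt q * csqrt t" and "d = - (csqrt q * csqrt t)"
  define \<alpha> where "\<alpha> = koornwinder_alpha a b c d q"
  have P: "P_CC n la t q t = koornwinder n la a b c d q t" for la
    by (simp add: P_CC_def a_def b_def c_def d_def)
  have sq: "csqrt t * csqrt t = t" "csqrt q * csqrt q = q" by (simp_all flip: power2_eq_square)
  have par: "(1 - a * z) * (1 - b * z) * (1 - c * z) * (1 - d * z) = (1 - t * z\<^sup>2) * (1 - q * t * z\<^sup>2)" for z
  proof -
    have "(1 - a * z) * (1 - b * z) * (1 - c * z) * (1 - d * z) =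
      (1 - (csqrt t * csqrt t) * z\<^sup>2) * (1 - (csqrt q * csqrt q) * (csqrt t * csqrt t) * z\<^sup>2)"
      by (simp add: a_def b_def c_def d_def algebra_simps power2_eq_square)
    then show ?thesis unfolding sq .
  qed
  have "a * b * c * d = (csqrt q * csqrt q) * (csqrt t * csqrt t) * (csqrt t * csqrt t)"
    by (simp add: a_def b_def c_def d_def)
  then have "a * b * c * d / q = t\<^sup>2" unfolding sq using q by (simp add: power2_eq_square)
  \<comment> \<open>The principal root of t^2 may be -t, so only the square of alpha is
    recorded.\<close>
  then have \<alpha>: "\<alpha>\<^sup>2 = t\<^sup>2" by (simp add: \<alpha>_def koornwinder_alpha_def)
  \<comment> \<open>The exponent k = 0 is covered by |q| < 1.\<close>
  have qt0: "q * t ^ k \<noteq> 1" for k using q(2) qt[of k] by (cases k) auto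
  interpret column_operator n a b c d q t "eigen n \<alpha> t q t" "\<lambda>_. 1"
    "\<lambda>r. kernel_const \<alpha> q t * (1 - q * t) * (t ^ r / t ^ n - t ^ n / t ^ r)"
    unfolding \<alpha>_def
    by (rule column_operator_CC) (use q t qt0 par \<alpha> in \<open>auto simp: \<alpha>_def\<close>)
  have nz: "1 - (t\<^sup>2) ^ Suc m \<noteq> 0" for m
    using t(2)[of "2 * Suc m"] unfolding power_mult by simp
  have nz': "1 - q * t * (t ^ l)\<^sup>2 * (t\<^sup>2) ^ Suc m \<noteq> 0" for l m
  proof -
    have "q * t * (t ^ l)\<^sup>2 * (t\<^sup>2) ^ Suc m = q * t ^ (1 + l * 2 + 2 * Suc m)"
      by (simp only: power_add power_mult power_one_right mult.assoc)
    then show ?thesis using qt0[of "1 + l * 2 + 2 * Suc m"] by (metis right_minus_eq)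
  qed
  define Q where "Q r = (\<Sum>j=0..r div 2. lconst (coeff_CC n r j q t) * E_poly n (r - 2 * j))" for r
  have Q: "koornwinder n (one_column r) a b c d q t = Q r" "Q r - E_poly n r \<in> lower_span n r"
    "regular_point n q x \<Longrightarrow> D (Q r) x = eigen n \<alpha> t q t r * leval (Q r) x" if "r \<le> n" for r x
  proof -
    have co: "coeff_CC n r j q t = term_CC q t (t ^ (n - r)) j" for j
      by (rule coeff_CC_eq) (use q t qt in auto)
    note ef = eigenfunction[OF that, where S = "sum_CC q t (t ^ (n - r))" and w = "term_CC q t (t ^ (n - r))"]
    have steps: "sum_CC q t (t ^ (n - r)) (Suc m) = sum_CC q t (t ^ (n - r)) m * 1 + term_CC q t (t ^ (n - r)) (Suc m)"
      "sum_CC q t (t ^ (n - r)) m * (kernel_const \<alpha> q t * (1 - q * t) *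
         (t ^ (r - 2 * m - 2) / t ^ n - t ^ n / t ^ (r - 2 * m - 2))) =
       term_CC q t (t ^ (n - r)) (Suc m) * (eigen n \<alpha> t q t r - eigen n \<alpha> t q t (r - 2 * m - 2))"
      if "2 * m + 2 \<le> r" for m
      using sum_CC_steps[OF t(1) that \<open>r \<le> n\<close> nz nz'] by simp_all
    show "koornwinder n (one_column r) a b c d q t = Q r"
      unfolding Q_def co by (rule ef(1)) (use steps in \<open>auto simp: sum_CC_def\<close>)
    show "Q r - E_poly n r \<in> lower_span n r"
      unfolding Q_def co by (rule ef(2)) (use steps in \<open>auto simp: sum_CC_def\<close>)
    show "D (Q r) x = eigen n \<alpha> t q t r * leval (Q r) x" if "regular_point n q x"
      unfolding Q_def co by (rule ef(3)) (use steps that in \<open>auto simp: sum_CC_def\<close>)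
  qed
  show "P_CC n (one_column r) t q t = (\<Sum>j=0..r div 2. lconst (coeff_CC n r j q t) * E_poly n (r - 2 * j))"
    unfolding P Q(1)[OF \<open>r \<le> n\<close>] Q_def ..
  have "E_poly n r = (\<Sum>j=0..r div 2. lconst (coeff_CC_inv n r j q t) * Q (r - 2 * j))"
  proof (rule inverse_expansion[OF _ _ _ _ \<open>r \<le> n\<close>])
    show "coeff_CC_inv n r 0 q t = 1" for r by (simp add: coeff_CC_inv_def qpoch_def)
    fix r m assume r: "r + 2 \<le> n" "2 * m \<le> r"
    have "t ^ n / t ^ (r + 2) = t ^ (n - (r + 2))" using t r by (simp add: power_diff)
    then show "coeff_CC_inv n (r + 2) (Suc m) q t * (eigen n \<alpha> t q t (r - 2 * m) - eigen n \<alpha> t q t (r + 2)) =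
      coeff_CC_inv n r m q t * (1 * (eigen n \<alpha> t q t (r - 2 * m) - eigen n \<alpha> t q t r) +
      kernel_const \<alpha> q t * (1 - q * t) * (t ^ r / t ^ n - t ^ n / t ^ r))"
      using nz[of m] nz'[of "n - (r + 2)" m] by (intro inverse_step_CC t r) (simp_all add: mult.assoc)
  qed (use Q in auto)
  also have "\<dots> = (\<Sum>j=0..r div 2. lconst (coeff_CC_inv n r j q t) * P_CC n (one_column (r - 2 * j)) t q t)"
    using Q(1) \<open>r \<le> n\<close> by (intro sum.cong refl) (simp add: P)
  finally show "E_poly n r = (\<Sum>j=0..r div 2. lconst (coeff_CC_inv n r j q t) * P_CC n (one_column (r - 2 * j)) t q t)" .
qed

lemma expansions_DD:
  fixes n r :: nat and q t :: complex
  assumes q: "q \<noteq> 0" "cmod q < 1" and t: "t \<noteq> 0" "\<And>k::nat. k \<ge> 1 \<Longrightarrow> t ^ k \<noteq> 1"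
    and qt: "\<And>k::nat. k \<ge> 1 \<Longrightarrow> q * t ^ k \<noteq> 1" and "r \<le> n"
  shows "P_DD n (one_column r) q t = (\<Sum>j=0..r div 2. lconst (coeff_DD n r j q t) * E_poly n (r - 2 * j))"
    and "E_poly n r = (\<Sum>j=0..r div 2. lconst (coeff_DD_inv n r j q t) * P_DD n (one_column (r - 2 * j)) q t)"
proof -
  define a b c d where "a = (1::complex)" and "b = (- 1::complex)" and "c = csqrt q" and "d = - csqrt q"
  define \<alpha> where "\<alpha> = koornwinder_alpha a b c d q"
  have P: "P_DD n la q t = koornwinder n la a b c d q t" for la
    by (simp add: P_DD_def a_def b_def c_def d_def)
  have sq: "csqrt q * csqrt q = q" by (simp flip: power2_eq_square)
  have par: "(1 - a * z) * (1 - b * z) * (1 - c * z) * (1 - d * z) = (1 - z\<^sup>2) * (1 - q * z\<^sup>2)" for z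
  proof -
    have "(1 - a * z) * (1 - b * z) * (1 - c * z) * (1 - d * z) = (1 - z\<^sup>2) * (1 - (csqrt q * csqrt q) * z\<^sup>2)"
      by (simp add: a_def b_def c_def d_def algebra_simps power2_eq_square)
    then show ?thesis unfolding sq .
  qed
  have "a * b * c * d = csqrt q * csqrt q"
    by (simp add: a_def b_def c_def d_def)
  then have "a * b * c * d / q = 1" unfolding sq using q by simp
  then have \<alpha>: "\<alpha>\<^sup>2 = 1" by (simp add: \<alpha>_def koornwinder_alpha_def)
  have qt0: "q * t ^ k \<noteq> 1" for k using q(2) qt[of k] by (cases k) auto
  have plus: "1 + t ^ k \<noteq> 0" for k using t(2) by (rule one_plus_power_nonzero)
  interpret column_operator n a b c d q t "eigen n \<alpha> 1 q t"
    "\<lambda>r. t * (1 + t ^ n / t ^ (r + 2)) / (1 + t ^ n / t ^ (r + 2) * t\<^sup>2)"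
    "\<lambda>r. kernel_const \<alpha> q t * (1 - q / t) * (1 + t ^ n / t ^ (r + 2)) * (1 / (t * (t ^ n / t ^ (r + 2))) - t)"
    unfolding \<alpha>_def
    by (rule column_operator_DD[OF q(1) t qt0 par \<alpha>[unfolded \<alpha>_def]])
  have nz: "1 - (t\<^sup>2) ^ Suc m \<noteq> 0" for m
    using t(2)[of "2 * Suc m"] unfolding power_mult by simp
  have nz': "1 - q / t * (t ^ l)\<^sup>2 * (t\<^sup>2) ^ Suc m \<noteq> 0" for l m
  proof -
    \<comment> \<open>One factor t^2 absorbs the division by t, so that a natural power of t
      remains.\<close>
    have "q / t * (t ^ l)\<^sup>2 * (t\<^sup>2) ^ Suc m = q * t * (t ^ l)\<^sup>2 * (t\<^sup>2) ^ m"
      using t by (simp add: power2_eq_square)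
    also have "\<dots> = q * t ^ (1 + l * 2 + 2 * m)"
      by (simp only: power_add power_mult power_one_right mult.assoc)
    finally show ?thesis using qt0[of "1 + l * 2 + 2 * m"] by (metis right_minus_eq)
  qed
  define Q where "Q r = (\<Sum>j=0..r div 2. lconst (coeff_DD n r j q t) * E_poly n (r - 2 * j))" for r
  have Q: "koornwinder n (one_column r) a b c d q t = Q r" "Q r - E_poly n r \<in> lower_span n r"
    "regular_point n q x \<Longrightarrow> D (Q r) x = eigen n \<alpha> 1 q t r * leval (Q r) x" if "r \<le> n" for r x
  proof -
    define S where "S m = (1 + t ^ (n - r)) / (1 + t ^ (n - r) * (t\<^sup>2) ^ m) * sum_DD q t (t ^ (n - r)) m" for m
    have S0: "S 0 = 1" using plus[of "n - r"] by (simp add: S_def sum_DD_def)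
    have co: "coeff_DD n r j q t = term_DD q t (t ^ (n - r)) j" for j
      by (rule coeff_DD_eq) (use q t qt in auto)
    note ef = eigenfunction[OF that, where S = S and w = "term_DD q t (t ^ (n - r))", OF S0 term_DD.simps(1)]
    have steps: "S (Suc m) = S m * (t * (1 + t ^ n / t ^ (r - 2 * m - 2 + 2)) / (1 + t ^ n / t ^ (r - 2 * m - 2 + 2) * t\<^sup>2))
        + term_DD q t (t ^ (n - r)) (Suc m)"
      "S m * (kernel_const \<alpha> q t * (1 - q / t) * (1 + t ^ n / t ^ (r - 2 * m - 2 + 2)) *
        (1 / (t * (t ^ n / t ^ (r - 2 * m - 2 + 2))) - t)) =
       term_DD q t (t ^ (n - r)) (Suc m) * (eigen n \<alpha> 1 q t r - eigen n \<alpha> 1 q t (r - 2 * m - 2))"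
      if "2 * m + 2 \<le> r" for m
      unfolding S_def using sum_DD_steps[OF t(1) plus that \<open>r \<le> n\<close> nz nz'] by (simp_all only:)
    show "koornwinder n (one_column r) a b c d q t = Q r"
      unfolding Q_def co by (rule ef(1)) (fact steps)+
    show "Q r - E_poly n r \<in> lower_span n r"
      unfolding Q_def co by (rule ef(2)) (fact steps)+
    show "D (Q r) x = eigen n \<alpha> 1 q t r * leval (Q r) x" if "regular_point n q x"
      unfolding Q_def co by (rule ef(3)) (fact steps that)+
  qed
  show "P_DD n (one_column r) q t = (\<Sum>j=0..r div 2. lconst (coeff_DD n r j q t) * E_poly n (r - 2 * j))"
    unfolding P Q(1)[OF \<open>r \<le> n\<close>] Q_def ..
  have "E_poly n r = (\<Sum>j=0..r div 2. lconst (coeff_DD_inv n r j q t) * Q (r - 2 * j))"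
  proof (rule inverse_expansion[OF _ _ _ _ \<open>r \<le> n\<close>])
    show "coeff_DD_inv n r 0 q t = 1" for r
      using plus[of "n - r"] by (simp add: coeff_DD_inv_def qpoch_def)
    fix r m assume r: "r + 2 \<le> n" "2 * m \<le> r"
    have "t ^ n / t ^ (r + 2) = t ^ (n - (r + 2))" using t r by (simp add: power_diff)
    then have "1 - t\<^sup>2 * (t\<^sup>2) ^ m \<noteq> 0" "1 - q / t * (t ^ n / t ^ (r + 2))\<^sup>2 * t\<^sup>2 * (t\<^sup>2) ^ m \<noteq> 0"
      using nz[of m] nz'[of "n - (r + 2)" m] by (simp_all add: mult.assoc)
    then show "coeff_DD_inv n (r + 2) (Suc m) q t * (eigen n \<alpha> 1 q t (r - 2 * m) - eigen n \<alpha> 1 q t (r + 2)) =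
      coeff_DD_inv n r m q t *
      (t * (1 + t ^ n / t ^ (r + 2)) / (1 + t ^ n / t ^ (r + 2) * t\<^sup>2) *
        (eigen n \<alpha> 1 q t (r - 2 * m) - eigen n \<alpha> 1 q t r) +
      kernel_const \<alpha> q t * (1 - q / t) * (1 + t ^ n / t ^ (r + 2)) * (1 / (t * (t ^ n / t ^ (r + 2))) - t))"
      by (rule inverse_step_DD[OF t(1) plus r])
  qed (use Q in auto)
  also have "\<dots> = (\<Sum>j=0..r div 2. lconst (coeff_DD_inv n r j q t) * P_DD n (one_column (r - 2 * j)) q t)"
    using Q(1) \<open>r \<le> n\<close> by (intro sum.cong refl) (simp add: P)
  finally show "E_poly n r = (\<Sum>j=0..r div 2. lconst (coeff_DD_inv n r j q t) * P_DD n (one_column (r - 2 * j)) q t)" .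
qed

theorem theorem8p7:
  fixes n r :: nat and q t :: complex
  assumes "n \<ge> 1" and "r \<le> n"
    and "q \<noteq> 0" and "cmod q < 1" and "t \<noteq> 0"
    and "\<And>k::nat. k \<ge> 1 \<Longrightarrow> t ^ k \<noteq> 1"
    and "\<And>k::nat. k \<ge> 1 \<Longrightarrow> q * t ^ k \<noteq> 1"
  shows
    "P_CC n (one_column r) t q t = (\<Sum>j=0..r div 2. lconst (coeff_CC n r j q t) * E_poly n (r - 2 * j)) \<and>
     E_poly n r = (\<Sum>j=0..r div 2. lconst (coeff_CC_inv n r j q t) * P_CC n (one_column (r - 2 * j)) t q t) \<and>
     P_DD n (one_column r) q t = (\<Sum>j=0..r div 2. lconst (coeff_DD n r j q t) * E_poly n (r - 2 * j)) \<and>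
     E_poly n r = (\<Sum>j=0..r div 2. lconst (coeff_DD_inv n r j q t) * P_DD n (one_column (r - 2 * j)) q t)"
  using expansions_CC[OF assms(3-7,2)] expansions_DD[OF assms(3-7,2)] by blast

end
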